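(* Consider on the torus $\mathbb{T}^d$ with angle coordinates $\varphi_1,\ldots,\varphi_d$ the control system $$\dot\varphi_k=u_{0k}+\sin\varphi_k\,u_{1k}+\sin 2\varphi_k\,u_{2k}+\Big(\sum_{j=1}^d\sin\varphi_j\Big)v_k,\qquad k=1,\ldots,d, \qquad (A)$$ with scalar controls $u_{0k}(t),u_{1k}(t),u_{2k}(t),v_k(t)$, and on the circle $\mathbb{T}^1$ with angle coordinate $\varphi$ the control system $$\dot\varphi=u_0+u_1\sin\varphi+u_2\sin 2\varphi \qquad (B)$$ with scalar controls $u_0(t),u_1(t),u_2(t)$. i) For $d>1$ system (A) is ensemble controllable on $\mathbb{T}^d$; that is: (a) for each $N\ge 1$, each $T>0$ and any two $N$-tuples $(x^1_\alpha,\ldots,x^N_\alpha)$, $(x^1_\omega,\ldots,x^N_\omega)$ of pairwise distinct points of $\mathbb{T}^d$ there is a control on $[0,T]$ such that for each $k=1,\ldots,N$ the trajectory starting at $x^k_\alpha$ at time $0$ is at $x^k_\omega$ at time $T$; (b) for each $\hat P\in\mathrm{Diff}_0(\mathbb{T}^d)$ and each $\varepsilon>0$ there is a control on $[0,T]$ such that the corresponding flow satisfies $\sup_{x\in\mathbb{T}^d}\mathrm{dist}(\hat P(x),P_T(x))<\varepsilon$. ii) System (B) is $C^0$-approximately controllable in $\mathrm{Diff}_0(\mathbb{T}^1)$, i.e. for each $\hat P\in\mathrm{Diff}_0(\mathbb{T}^1)$ and each $\varepsilon>0$ there is a control on $[0,T]$ such that the corresponding flow satisfies $\sup_{x\in\mathbb{T}^1}\mathrm{dist}(\hat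 P(x),P_T(x))<\varepsilon$. iii) Two finite ensembles $(x^1_\alpha,\ldots,x^N_\alpha)$, $(x^1_\omega,\ldots,x^N_\omega)$ of pairwise distinct points of $\mathbb{T}^1$ can be steered one into another (each $x^k_\alpha$ to $x^k_\omega$, $k=1,\ldots,N$, by one common control) by means of system (B) in time $T>0$ if and only if they are equally ordered.
   Context: $\mathrm{Diff}_0(\mathbb{T}^d)$ is the connected component of the identity in the group of smooth diffeomorphisms of $\mathbb{T}^d$. Controls are integrable functions of $t$. The flow $P_t$ corresponding to a control maps $x$ to the value at time $t$ of the solution starting at $x$ at time $0$. The length $T>0$ of the time interval is irrelevant, since rescaling time and control replaces $T$ by any $T'>0$. For a given orientation of $\mathbb{T}^1$, any ensemble of $N$ points is ordered up to cyclic permutation; two ensembles are equally ordered if the sequences of the indices of their points (listed along the orientation) are the same up to a cyclic permutation. *)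

theory Defs
  imports "HOL-Analysis.Analysis"
begin

section \<open>The torus\<close>

text \<open>
  The torus of dimension \<open>CARD('d)\<close> is the product of \<open>CARD('d)\<close> unit circles of the complex
  plane; \<open>angle\<close> is its universal covering, so that \<open>\<phi> $ k\<close> is the \<open>k\<close>-th angle coordinate
  (modulo \<open>2 * pi\<close>) of the point \<open>angle \<phi>\<close>. The circle is the type \<open>1 torus\<close>.
\<close>

typedef (overloaded) ('d::finite) torus = "{z :: complex ^ 'd. \<forall>k. cmod (z $ k) = 1}"
proof
  show "(\<chi> k. 1) \<in> {z :: complex ^ 'd. \<forall>k. cmod (z $ k) = 1}" by simp
qed

definition angle :: "real ^ 'd \<Rightarrow> ('d::finite) torus" where
  "angle \<phi> = Abs_torus (\<chi> k. cis (\<phi> $ k))"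

lemma Rep_torus_angle: "Rep_torus (angle \<phi>) = (\<chi> k. cis (\<phi> $ k))"
  by (simp add: angle_def Abs_torus_inverse)

lemma surj_angle: "surj (angle :: real ^ 'd \<Rightarrow> ('d::finite) torus)"
proof -
  have "\<exists>\<phi>. p = angle \<phi>" for p :: "'d torus"
  proof -
    have "\<forall>k. cmod (Rep_torus p $ k) = 1"
      using Rep_torus[of p] by simp
    then have "cis (Arg (Rep_torus p $ k)) = Rep_torus p $ k" for k
      by (metis cis_Arg div_by_1 norm_zero of_real_1 sgn_eq zero_neq_one)
    then have "Rep_torus (angle (\<chi> k. Arg (Rep_torus p $ k))) = Rep_torus p"
      by (simp add: Rep_torus_angle vec_eq_iff)
    then show ?thesis
      by (metis Rep_torus_inject)
  qed
  then show ?thesis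
    by (simp add: surj_def)
qed

text \<open>The distance of the flat metric.\<close>

definition torus_dist :: "('d::finite) torus \<Rightarrow> 'd torus \<Rightarrow> real" where
  "torus_dist p q = Inf {norm (a - b) | a b. angle a = p \<and> angle b = q}"

section \<open>Diffeomorphisms of the torus\<close>

primrec iter_partial ::
  "('d::finite) list \<Rightarrow> (real ^ 'd \<Rightarrow> 'b::real_normed_vector) \<Rightarrow> real ^ 'd \<Rightarrow> 'b" where
  "iter_partial [] f = f"
| "iter_partial (i # is) f =
     (\<lambda>x. frechet_derivative (iter_partial is f) (at x) (axis i 1))"

definition smooth :: "(real ^ ('d::finite) \<Rightarrow> 'b::real_normed_vector) \<Rightarrow> bool" where
  "smooth f \<longleftrightarrow> (\<forall>is x. iter_partial is f differentiable (at x))"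

text \<open>
  The torus is an embedded submanifold of \<open>complex ^ 'd\<close> and \<open>angle\<close> is a surjective local
  diffeomorphism. Hence a self-map \<open>F\<close> of the torus is described, as far as its smooth structure
  is concerned, by the following function of the angle coordinates.
\<close>

definition in_angles :: "(('d::finite) torus \<Rightarrow> 'd torus) \<Rightarrow> real ^ 'd \<Rightarrow> complex ^ 'd" where
  "in_angles F = Rep_torus \<circ> F \<circ> angle"

definition Diff :: "(('d::finite) torus \<Rightarrow> 'd torus) set" where
  "Diff = {F. bij F \<and> smooth (in_angles F) \<and> smooth (in_angles (inv F))}"

text \<open>
  The \<open>C\<close>-infinity topology on \<open>Diff\<close>: a neighbourhood base of \<open>F\<close> is formed by the sets of all
  \<open>G\<close> whose partial derivatives of orders \<open>0, \<dots>, r\<close> are uniformly \<open>e\<close>-close to those of \<open>F\<close>.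
\<close>

definition Cr_close ::
  "nat \<Rightarrow> real \<Rightarrow> (('d::finite) torus \<Rightarrow> 'd torus) \<Rightarrow> ('d torus \<Rightarrow> 'd torus) \<Rightarrow> bool" where
  "Cr_close r e F G \<longleftrightarrow>
     (\<forall>is \<phi>. length is \<le> r \<longrightarrow>
        norm (iter_partial is (in_angles G) \<phi> - iter_partial is (in_angles F) \<phi>) < e)"

definition Diff_open :: "(('d::finite) torus \<Rightarrow> 'd torus) set \<Rightarrow> bool" where
  "Diff_open U \<longleftrightarrow>
     U \<subseteq> Diff \<and> (\<forall>F\<in>U. \<exists>r. \<exists>e>0. \<forall>G\<in>Diff. Cr_close r e F G \<longrightarrow> G \<in> U)"

definition Diff_topology :: "(('d::finite) torus \<Rightarrow> 'd torus) topology" where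
  "Diff_topology = topology Diff_open"

lemma Cr_close_mono: "Cr_close r e F G \<Longrightarrow> r' \<le> r \<Longrightarrow> e \<le> e' \<Longrightarrow> Cr_close r' e' F G"
  unfolding Cr_close_def by (meson le_trans less_le_trans)

lemma istopology_Diff_open: "istopology Diff_open"
  unfolding istopology_def
proof (intro conjI allI impI)
  fix S T :: "('d::finite torus \<Rightarrow> 'd torus) set"
  assume S: "Diff_open S" and T: "Diff_open T"
  show "Diff_open (S \<inter> T)"
    unfolding Diff_open_def
  proof (intro conjI ballI)
    show "S \<inter> T \<subseteq> Diff"
      using S by (auto simp: Diff_open_def)
    fix F assume F: "F \<in> S \<inter> T"
    obtain r e where 1: "e > 0" "\<forall>G\<in>Diff. Cr_close r e F G \<longrightarrow> G \<in> S"
      using S F unfolding Diff_open_def by blast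
    obtain r' e' where 2: "e' > 0" "\<forall>G\<in>Diff. Cr_close r' e' F G \<longrightarrow> G \<in> T"
      using T F unfolding Diff_open_def by blast
    have "\<forall>G\<in>Diff. Cr_close (max r r') (min e e') F G \<longrightarrow> G \<in> S \<inter> T"
      using 1 2 by (meson Cr_close_mono IntI max.cobounded1 max.cobounded2
          min.cobounded1 min.cobounded2)
    moreover have "min e e' > 0"
      using 1 2 by simp
    ultimately show "\<exists>r. \<exists>e>0. \<forall>G\<in>Diff. Cr_close r e F G \<longrightarrow> G \<in> S \<inter> T"
      by blast
  qed
next
  fix K :: "('d::finite torus \<Rightarrow> 'd torus) set set"
  assume K: "\<forall>S\<in>K. Diff_open S"
  show "Diff_open (\<Union>K)"
    unfolding Diff_open_def
  proof (intro conjI ballI)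
    show "\<Union>K \<subseteq> Diff"
      using K by (auto simp: Diff_open_def)
    fix F assume "F \<in> \<Union>K"
    then obtain S where S: "S \<in> K" "F \<in> S" by blast
    then show "\<exists>r. \<exists>e>0. \<forall>G\<in>Diff. Cr_close r e F G \<longrightarrow> G \<in> \<Union>K"
      using K unfolding Diff_open_def by (meson UnionI)
  qed
qed

lemma openin_Diff_topology: "openin Diff_topology U \<longleftrightarrow> Diff_open U"
  by (simp add: Diff_topology_def topology_inverse'[OF istopology_Diff_open])

lemma topspace_Diff_topology: "topspace Diff_topology = Diff"
proof -
  have "Diff_open Diff"
    unfolding Diff_open_def by (auto intro: exI[of _ 1])
  then show ?thesis
    unfolding topspace_def openin_Diff_topology by (auto simp: Diff_open_def)
qed

definition Diff0 :: "(('d::finite) torus \<Rightarrow> 'd torus) set" where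
  "Diff0 = connected_component_of_set Diff_topology id"

section \<open>Control systems on the torus\<close>

text \<open>
  A control system is given in angle coordinates by its right-hand side \<open>f\<close>, where \<open>f w \<phi>\<close> is the
  velocity at \<open>\<phi>\<close> for the control value \<open>w\<close>. Controls are Lebesgue integrable functions of time,
  solutions are understood in the sense of Caratheodory, that is, as (absolutely continuous)
  solutions of the integral equation.
\<close>

definition control :: "real \<Rightarrow> (real \<Rightarrow> 'c::euclidean_space) \<Rightarrow> bool" where
  "control T u \<longleftrightarrow> u absolutely_integrable_on {0..T}"

definition solution ::
  "('c \<Rightarrow> real ^ 'd \<Rightarrow> real ^ ('d::finite)) \<Rightarrow> real \<Rightarrow> (real \<Rightarrow> 'c) \<Rightarrow> (real \<Rightarrow> real ^ 'd) \<Rightarrow> bool" where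
  "solution f T u \<phi> \<longleftrightarrow>
     continuous_on {0..T} \<phi> \<and>
     (\<forall>t\<in>{0..T}. (\<lambda>s. f (u s) (\<phi> s)) absolutely_integrable_on {0..t} \<and>
                  ((\<lambda>s. f (u s) (\<phi> s)) has_integral (\<phi> t - \<phi> 0)) {0..t})"

definition trajectory ::
  "('c \<Rightarrow> real ^ 'd \<Rightarrow> real ^ ('d::finite)) \<Rightarrow> real \<Rightarrow> (real \<Rightarrow> 'c) \<Rightarrow> (real \<Rightarrow> 'd torus) \<Rightarrow> bool" where
  "trajectory f T u \<gamma> \<longleftrightarrow> (\<exists>\<phi>. solution f T u \<phi> \<and> (\<forall>t\<in>{0..T}. \<gamma> t = angle (\<phi> t)))"

definition is_flow ::
  "('c \<Rightarrow> real ^ 'd \<Rightarrow> real ^ ('d::finite)) \<Rightarrow> real \<Rightarrow> (real \<Rightarrow> 'c) \<Rightarrow>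
   (real \<Rightarrow> 'd torus \<Rightarrow> 'd torus) \<Rightarrow> bool" where
  "is_flow f T u P \<longleftrightarrow> (\<forall>x. trajectory f T u (\<lambda>t. P t x) \<and> P 0 x = x)"

definition steerable ::
  "('c::euclidean_space \<Rightarrow> real ^ 'd \<Rightarrow> real ^ ('d::finite)) \<Rightarrow> real \<Rightarrow> nat \<Rightarrow>
   (nat \<Rightarrow> 'd torus) \<Rightarrow> (nat \<Rightarrow> 'd torus) \<Rightarrow> bool" where
  "steerable f T N x y \<longleftrightarrow>
     (\<exists>u. control T u \<and>
        (\<forall>k\<in>{1..N}. \<exists>\<gamma>. trajectory f T u \<gamma> \<and> \<gamma> 0 = x k \<and> \<gamma> T = y k))"

definition C0_approx_controllable ::
  "('c::euclidean_space \<Rightarrow> real ^ 'd \<Rightarrow> real ^ ('d::finite)) \<Rightarrow> real \<Rightarrow> bool" where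
  "C0_approx_controllable f T \<longleftrightarrow>
     (\<forall>Q\<in>Diff0. \<forall>\<epsilon>>0. \<exists>u P. control T u \<and> is_flow f T u P \<and>
        (SUP x. torus_dist (Q x) (P T x)) < \<epsilon>)"

definition system_A ::
  "(real ^ 'd) \<times> (real ^ 'd) \<times> (real ^ 'd) \<times> (real ^ 'd) \<Rightarrow> real ^ 'd \<Rightarrow> real ^ ('d::finite)" where
  "system_A = (\<lambda>(u0, u1, u2, v) \<phi>.
     \<chi> k. u0 $ k + sin (\<phi> $ k) * u1 $ k + sin (2 * \<phi> $ k) * u2 $ k
          + (\<Sum>j\<in>UNIV. sin (\<phi> $ j)) * v $ k)"

definition system_B :: "real \<times> real \<times> real \<Rightarrow> real ^ 1 \<Rightarrow> real ^ 1" where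
  "system_B = (\<lambda>(u0, u1, u2) \<phi>. \<chi> k. u0 + u1 * sin (\<phi> $ k) + u2 * sin (2 * \<phi> $ k))"

section \<open>Cyclic order on the circle\<close>

text \<open>
  The orientation is that of increasing angle. The list \<open>\<sigma>\<close> is the sequence of the indices of the
  points \<open>x 1, \<dots>, x N\<close> as met during a single turn that starts at one of the points.
\<close>

definition listed_along :: "nat \<Rightarrow> (nat \<Rightarrow> 1 torus) \<Rightarrow> nat list \<Rightarrow> bool" where
  "listed_along N x \<sigma> \<longleftrightarrow>
     distinct \<sigma> \<and> set \<sigma> = {1..N} \<and>
     (\<exists>\<theta> :: nat \<Rightarrow> real.
        (\<forall>i<N. x (\<sigma> ! i) = angle (vec (\<theta> i))) \<and>
        (\<forall>i<N. \<forall>j<N. i < j \<longrightarrow> \<theta> i < \<theta> j \<and> \<theta> j < \<theta> i + 2 * pi))"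

definition equally_ordered :: "nat \<Rightarrow> (nat \<Rightarrow> 1 torus) \<Rightarrow> (nat \<Rightarrow> 1 torus) \<Rightarrow> bool" where
  "equally_ordered N x y \<longleftrightarrow>
     (\<exists>\<sigma> \<tau> n. listed_along N x \<sigma> \<and> listed_along N y \<tau> \<and> \<tau> = rotate n \<sigma>)"

end

theory Submission
  imports Defs
begin

text \<open>
  Both systems are driftless and symmetric, and flows may be concatenated, so the maps reached by
  explicitly solvable controls (translations, flows of \<open>sin\<close> and \<open>sin 2\<close> in one angle, shears)
  form a group \<open>G\<close> of maps of the universal covering. Call a field \<open>X\<close> tangent to \<open>G\<close> if for
  every \<open>\<epsilon>\<close> there is a family \<open>\<Phi> h\<close> in \<open>G\<close> with \<open>\<Phi> h = id + h * X\<close> up to an error which is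
  \<open>\<epsilon>\<close>-small in the strict (Lipschitz) sense. With this notion tangent fields are closed under sums
  and uniform limits, and conjugating \<open>\<Phi> h\<close> by the flow of an explicit generator at a small time
  gives closure under brackets with that generator. Brackets with \<open>sin\<close> fields move the frequency
  vectors of trigonometric fields by unit steps, so all trigonometric fields are tangent, and by
  Stone-Weierstrass so are all Lipschitz periodic fields.

  Approximation: a map \<open>id + h\<close> with \<open>h\<close> periodic and Lipschitz-small is a product of maps
  \<open>id + X / n\<close> with tangent \<open>X\<close>, hence a uniform limit of elements of \<open>G\<close>. Therefore the set of
  diffeomorphisms that are uniform limits of elements of \<open>G\<close> is open and closed.

  Exact steering: bump fields concentrated at the points of a configuration give families in \<open>G\<close>
  with as many parameters as the configuration space has dimensions, whose strict derivative is
  the identity; so the orbits of \<open>G\<close> on configurations are open. It remains to connect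
  configurations: one point at a time in the complement of a countable set when the dimension
  exceeds one, and along a segment of ordered configurations on the circle. Conversely, uniqueness
  of solutions preserves the cyclic order.
\<close>

section \<open>The flow of the sine field on the line\<close>

text \<open>Tangency is only asked for up to \<open>\<epsilon>\<close> because exact families need
  not survive uniform limits, and limits are unavoidable: brackets reach the trigonometric fields,
  density all others. The price is paid at brackets. Conjugation by a time-\<open>s\<close> map adds
  \<open>s\<close> times the bracket to the field, so isolating the bracket means dividing by
  \<open>s\<close>, and all errors must be of order \<open>s^2\<close>. This works because
  \<open>s\<close> is fixed first and the conjugated family is then taken with tolerance
  \<open>s^2\<close>. The conjugating map must agree with \<open>id + s * Y\<close> up to order
  \<open>s^2\<close>, also in the Lipschitz sense, which the closed-form flows of the generators
  provide. Errors compare two parameters \<open>h\<close> and \<open>k\<close>, since compositions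
  have to control differences and exact steering ends in a contraction. The algebraic obstacle is
  that 1, cos and sin of one angle are closed under brackets (a copy of sl(2)), so in one angle
  brackets with sin alone never leave frequency one; the field sin 2 opens the way to higher
  frequencies, and the controls \<open>v\<close> couple different angles.\<close>

lemma flow_lipschitz_nonneg:
  fixes y z f :: "real \<Rightarrow> real"
  assumes y: "\<And>t. (y has_real_derivative f (y t)) (at t)"
    and z: "\<And>t. (z has_real_derivative f (z t)) (at t)"
    and f: "\<And>a b. \<bar>f a - f b\<bar> \<le> \<bar>a - b\<bar>" and t: "t \<ge> 0"
  shows "\<bar>y t - z t\<bar> \<le> exp t * \<bar>y 0 - z 0\<bar>"
proof -
  \<comment> \<open>The squared distance is differentiable also where the solutions meet, and the
    factor \<open>exp (-2 * t)\<close> absorbs the growth rate 2 that the Lipschitz constant 1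
    allows for it.\<close>
  define g where "g t = (y t - z t)\<^sup>2 * exp (-2 * t)" for t
  have "g t \<le> g 0"
  proof (rule DERIV_nonpos_imp_nonincreasing[OF t])
    fix s
    have "(g has_real_derivative (2 * (y s - z s) * (f (y s) - f (z s)) - 2 * (y s - z s)\<^sup>2) * exp (-2 * s)) (at s)"
      unfolding g_def
      by (rule DERIV_cong[OF DERIV_mult[OF DERIV_power[OF DERIV_diff[OF y z]] DERIV_fun_exp[OF DERIV_cmult[OF DERIV_ident]]]])
         (simp add: algebra_simps power2_eq_square)
    moreover have "(y s - z s) * (f (y s) - f (z s)) \<le> \<bar>y s - z s\<bar> * \<bar>y s - z s\<bar>"
      using abs_ge_self[of "(y s - z s) * (f (y s) - f (z s))"]
        mult_left_mono[OF f[of "y s" "z s"] abs_ge_zero[of "y s - z s"]] unfolding abs_mult by linarith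
    then have "2 * (y s - z s) * (f (y s) - f (z s)) - 2 * (y s - z s)\<^sup>2 \<le> 0"
      by (simp add: power2_eq_square algebra_simps)
    ultimately show "\<exists>d. (g has_real_derivative d) (at s) \<and> d \<le> 0"
      using mult_nonpos_nonneg[OF _ exp_ge_zero] by blast
  qed
  then have "(y t - z t)\<^sup>2 * exp (-2 * t) * exp (2 * t) \<le> (y 0 - z 0)\<^sup>2 * exp (2 * t)"
    unfolding g_def by (simp add: mult_right_mono)
  also have "(y t - z t)\<^sup>2 * exp (-2 * t) * exp (2 * t) = (y t - z t)\<^sup>2"
    by (simp add: exp_minus)
  finally have "(y t - z t)\<^sup>2 \<le> (exp t * \<bar>y 0 - z 0\<bar>)\<^sup>2"
    unfolding power_mult_distrib exp_double power2_abs by (simp only: mult.commute)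
  then show ?thesis
    by (simp add: abs_le_square_iff[symmetric])
qed

lemma flow_lipschitz:
  fixes y z f :: "real \<Rightarrow> real"
  assumes y: "\<And>t. (y has_real_derivative f (y t)) (at t)"
    and z: "\<And>t. (z has_real_derivative f (z t)) (at t)"
    and f: "\<And>a b. \<bar>f a - f b\<bar> \<le> \<bar>a - b\<bar>"
  shows "\<bar>y t - z t\<bar> \<le> exp \<bar>t\<bar> * \<bar>y 0 - z 0\<bar>"
proof (cases "t \<ge> 0")
  case True
  then show ?thesis using flow_lipschitz_nonneg[OF y z f] by simp
next
  case False
  have rev: "((\<lambda>t. w (- t)) has_real_derivative - f (w (- t))) (at t)"
    if "\<And>t. (w has_real_derivative f (w t)) (at t)" for w t
    using DERIV_chain2[OF that DERIV_minus[OF DERIV_ident], of t] by simp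
  have "\<bar>y (- (- t)) - z (- (- t))\<bar> \<le> exp (- t) * \<bar>y (- 0) - z (- 0)\<bar>"
    by (rule flow_lipschitz_nonneg[where f = "\<lambda>x. - f x"])
       (use rev y z f False in \<open>auto simp: abs_minus_commute\<close>)
  then show ?thesis using False by simp
qed

text \<open>The equation x' = sin x makes \<open>tan (x / 2)\<close> grow like \<open>exp s\<close>.
  Applying the tangent subtraction formula to half the displacement and clearing
  \<open>1 + cos x\<close> gives this quotient, whose denominator never vanishes; thus one branch of
  \<open>arctan\<close> serves for all \<open>x\<close>.\<close>

definition sine_flow :: "real \<Rightarrow> real \<Rightarrow> real" where
  "sine_flow s x = x + 2 * arctan ((exp s - 1) * sin x / ((1 + cos x) + exp s * (1 - cos x)))"

lemma sine_flow_0 [simp]: "sine_flow 0 x = x"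
  by (simp add: sine_flow_def)

lemma sine_flow_denominator: "(1 + cos x) + exp s * (1 - cos x) > 0" for x s :: real
proof (cases "cos x = 1")
  case False
  then have "cos x < 1" using cos_le_one[of x] by linarith
  then have "exp s * (1 - cos x) > 0" by simp
  moreover have "1 + cos x \<ge> 0" using cos_ge_minus_one[of x] by linarith
  ultimately show ?thesis by linarith
qed simp

lemma sin_double_arctan: "sin (x + 2 * arctan w) = (sin x * (1 - w\<^sup>2) + 2 * w * cos x) / (1 + w\<^sup>2)" for x w :: real
proof -
  have p: "1 + w\<^sup>2 > 0" by (smt (verit) zero_le_power2)
  have c: "cos (2 * arctan w) = (1 - w\<^sup>2) / (1 + w\<^sup>2)"
    using p unfolding cos_double cos_arctan sin_arctan by (simp add: power_divide diff_divide_distrib)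
  have s: "sin (2 * arctan w) = 2 * w / (1 + w\<^sup>2)"
    using p unfolding sin_double cos_arctan sin_arctan by (simp add: power2_eq_square[symmetric])
  show ?thesis unfolding sin_add c s times_divide_eq_right add_divide_distrib[symmetric]
    by (simp add: mult.commute)
qed

lemma sine_flow_deriv: "((\<lambda>s. sine_flow s x) has_real_derivative sin (sine_flow s x)) (at s)"
proof -
  define S C e D where "S = sin x" and "C = cos x" and "e = exp s" and "D = (1 + C) + e * (1 - C)"
  have D: "D > 0" unfolding D_def C_def e_def by (rule sine_flow_denominator)
  define w where "w = (e - 1) * S / D"
  have SC: "S\<^sup>2 = 1 - C\<^sup>2" unfolding S_def C_def by (simp add: sin_squared_eq)
  have pw: "1 + w\<^sup>2 > 0" by (smt (verit) zero_le_power2)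
  have dw: "((\<lambda>s. (exp s - 1) * sin x / ((1 + cos x) + exp s * (1 - cos x)))
       has_real_derivative 2 * e * S / D\<^sup>2) (at s)"
    using D unfolding S_def C_def e_def D_def
    by (auto intro!: derivative_eq_intros simp: field_simps power2_eq_square)
  have "((\<lambda>s. sine_flow s x) has_real_derivative 2 * ((2 * e * S / D\<^sup>2) / (1 + w\<^sup>2))) (at s)"
    unfolding sine_flow_def
    by (rule derivative_eq_intros dw refl)+ (simp add: w_def S_def D_def C_def e_def field_simps)
  moreover have "sin (sine_flow s x) = 2 * ((2 * e * S / D\<^sup>2) / (1 + w\<^sup>2))"
  proof -
    have "sin (sine_flow s x) = (S * (1 - w\<^sup>2) + 2 * w * C) / (1 + w\<^sup>2)"
      using sin_double_arctan[of x w] by (simp add: sine_flow_def w_def S_def D_def C_def e_def)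
    moreover have "S * (1 - w\<^sup>2) + 2 * w * C = 4 * e * S / D\<^sup>2"
    proof -
      have "(S * (1 - w\<^sup>2) + 2 * w * C) * D\<^sup>2 = S * (D\<^sup>2 - (e - 1)\<^sup>2 * S\<^sup>2 + 2 * (e - 1) * C * D)"
        using D by (simp add: w_def field_simps power2_eq_square)
      also have "D\<^sup>2 - (e - 1)\<^sup>2 * S\<^sup>2 + 2 * (e - 1) * C * D = 4 * e"
        unfolding D_def SC by (simp add: power2_eq_square algebra_simps)
      finally show ?thesis using D by (simp add: field_simps)
    qed
    ultimately show ?thesis by simp
  qed
  ultimately show ?thesis by simp
qed

lemma abs_sin_diff_le: "\<bar>sin a - sin b\<bar> \<le> \<bar>a - b\<bar>" for a b :: real
proof -
  have "norm (sin a - sin b) \<le> 1 * norm (a - b)"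
    by (rule field_differentiable_bound[where S = UNIV and f' = cos]) (auto intro!: derivative_eq_intros)
  then show ?thesis by simp
qed

lemma sine_flow_lipschitz: "\<bar>sine_flow s x - sine_flow s y\<bar> \<le> exp \<bar>s\<bar> * \<bar>x - y\<bar>"
  using flow_lipschitz[of "\<lambda>s. sine_flow s x" sin "\<lambda>s. sine_flow s y" s] sine_flow_deriv abs_sin_diff_le
  by simp

text \<open>As functions of \<open>t\<close>, \<open>sine_flow t (sine_flow (- s) x)\<close> and
  \<open>sine_flow (t - s) x\<close> solve the same equation with the same value at
  \<open>t = 0\<close>; \<open>flow_lipschitz\<close> with initial distance zero identifies
  them.\<close>

lemma sine_flow_inverse: "sine_flow s (sine_flow (- s) x) = x"
proof -
  have "((\<lambda>t. sine_flow (t + - s) x) has_real_derivative sin (sine_flow (t + - s) x)) (at t)" for t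
    using sine_flow_deriv[of x "t + - s"] unfolding DERIV_shift .
  then have "\<bar>sine_flow s (sine_flow (- s) x) - sine_flow (s + - s) x\<bar> \<le> exp \<bar>s\<bar> * \<bar>sine_flow 0 (sine_flow (- s) x) - sine_flow (0 + - s) x\<bar>"
    by (intro flow_lipschitz[where f = sin] sine_flow_deriv abs_sin_diff_le)
  then show ?thesis by simp
qed

section \<open>Lipschitz and Taylor estimates for the sine flow\<close>

lemma abs_le_of_deriv_bound:
  fixes g :: "real \<Rightarrow> real"
  assumes "\<And>r. \<bar>r\<bar> \<le> d \<Longrightarrow> (g has_real_derivative g' r) (at r)"
    and "\<And>r. \<bar>r\<bar> \<le> d \<Longrightarrow> \<bar>g' r\<bar> \<le> K" and "\<bar>s\<bar> \<le> d" "\<bar>t\<bar> \<le> d"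
  shows "\<bar>g s - g t\<bar> \<le> K * \<bar>s - t\<bar>"
proof -
  have "norm (g s - g t) \<le> K * norm (s - t)"
    by (rule field_differentiable_bound[where S = "cball 0 d" and f' = g'])
       (use assms in \<open>auto intro: DERIV_subset[of _ _ _ UNIV] simp: dist_norm\<close>)
  then show ?thesis by simp
qed

lemma sine_flow_displacement:
  assumes "\<bar>s\<bar> \<le> d" "\<bar>t\<bar> \<le> d"
  shows "\<bar>sine_flow s x - sine_flow t x\<bar> \<le> \<bar>s - t\<bar>"
  using abs_le_of_deriv_bound[of d "\<lambda>s. sine_flow s x" "\<lambda>s. sin (sine_flow s x)" 1 s t] assms sine_flow_deriv
  by simp

text \<open>Two times are compared, instead of \<open>s\<close> with 0, because
  \<open>tangent_family\<close> will ask for this. The derivative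
  \<open>sin (sine_flow r x) - sin x\<close> is at most \<open>\<bar>r\<bar> \<le> d\<close>, as
  points move with speed at most one.\<close>

lemma sine_flow_taylor:
  assumes "\<bar>s\<bar> \<le> d" "\<bar>t\<bar> \<le> d"
  shows "\<bar>sine_flow s x - sine_flow t x - (s - t) * sin x\<bar> \<le> d * \<bar>s - t\<bar>"
proof -
  have "\<bar>(sine_flow s x - s * sin x) - (sine_flow t x - t * sin x)\<bar> \<le> d * \<bar>s - t\<bar>"
  proof (rule abs_le_of_deriv_bound[where d = d and g' = "\<lambda>r. sin (sine_flow r x) - sin x"])
    fix r :: real assume r: "\<bar>r\<bar> \<le> d"
    show "((\<lambda>s. sine_flow s x - s * sin x) has_real_derivative sin (sine_flow r x) - sin x) (at r)"
      by (rule derivative_eq_intros sine_flow_deriv refl)+ simp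
    show "\<bar>sin (sine_flow r x) - sin x\<bar> \<le> d"
      using abs_sin_diff_le[of "sine_flow r x" x] sine_flow_displacement[of r "\<bar>r\<bar>" 0 x] r by simp
  qed (use assms in auto)
  then show ?thesis by (simp add: algebra_simps)
qed

lemma sine_flow_lipschitz_displacement:
  assumes "\<bar>s\<bar> \<le> d" "d \<le> 1"
  shows "\<bar>(sine_flow s x - x) - (sine_flow s y - y)\<bar> \<le> 3 * d * \<bar>x - y\<bar>"
proof -
  have "\<bar>(sine_flow s x - sine_flow s y) - (sine_flow 0 x - sine_flow 0 y)\<bar> \<le> (3 * \<bar>x - y\<bar>) * \<bar>s - 0\<bar>"
  proof (rule abs_le_of_deriv_bound[where d = d and g' = "\<lambda>r. sin (sine_flow r x) - sin (sine_flow r y)"])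
    fix r :: real assume r: "\<bar>r\<bar> \<le> d"
    show "((\<lambda>s. sine_flow s x - sine_flow s y) has_real_derivative sin (sine_flow r x) - sin (sine_flow r y)) (at r)"
      by (rule derivative_eq_intros sine_flow_deriv refl)+
    have "exp \<bar>r\<bar> \<le> exp 1" using r assms(2) by simp
    then have "exp \<bar>r\<bar> \<le> 3" using exp_le by linarith
    then have "exp \<bar>r\<bar> * \<bar>x - y\<bar> \<le> 3 * \<bar>x - y\<bar>" by (simp add: mult_right_mono)
    then show "\<bar>sin (sine_flow r x) - sin (sine_flow r y)\<bar> \<le> 3 * \<bar>x - y\<bar>"
      using abs_sin_diff_le[of "sine_flow r x" "sine_flow r y"] sine_flow_lipschitz[of r x y] by linarith
  qed (use assms in auto)
  also have "(3 * \<bar>x - y\<bar>) * \<bar>s - 0\<bar> \<le> (3 * \<bar>x - y\<bar>) * d" using assms by (intro mult_left_mono) auto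
  finally show ?thesis by (simp add: algebra_simps)
qed

text \<open>Splitting \<open>sin (x + a)\<close> at \<open>x + b\<close> leaves a second difference
  with the common increment \<open>b\<close>; its derivative in the base point is a difference of
  cosines, bounded by \<open>\<bar>b\<bar>\<close>.\<close>

lemma sin_difference_lipschitz:
  fixes x y a b :: real
  shows "\<bar>(sin (x + a) - sin x) - (sin (y + b) - sin y)\<bar> \<le> \<bar>a - b\<bar> + \<bar>b\<bar> * \<bar>x - y\<bar>"
proof -
  have "\<bar>(\<lambda>z. sin (z + x + b) - sin (z + x)) 0 - (\<lambda>z. sin (z + x + b) - sin (z + x)) (y - x)\<bar> \<le> \<bar>b\<bar> * \<bar>0 - (y - x)\<bar>"
  proof (rule abs_le_of_deriv_bound[where d = "\<bar>y - x\<bar>" and g' = "\<lambda>z. cos (z + x + b) - cos (z + x)"])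
    fix r
    have "\<bar>cos (r + x + b) - cos (r + x)\<bar> \<le> \<bar>b\<bar>"
      using abs_sin_diff_le[of "pi/2 - (r + x + b)" "pi/2 - (r + x)"] by (simp only: cos_sin_eq) simp
    then show "\<bar>cos (r + x + b) - cos (r + x)\<bar> \<le> \<bar>b\<bar>" .
  qed (auto intro!: derivative_eq_intros)
  moreover have "\<bar>sin (x + a) - sin (x + b)\<bar> \<le> \<bar>a - b\<bar>"
    using abs_sin_diff_le[of "x + a" "x + b"] by simp
  ultimately show ?thesis by simp
qed

text \<open>Conjugation in the bracket argument needs the remainder after the linear term to be of
  order \<open>s^2\<close> as a Lipschitz map, not just pointwise. The factor 4 is 3 from the
  Lipschitz constant of the displacement plus 1 from its size.\<close>

lemma sine_flow_remainder_lipschitz: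
  assumes "\<bar>s\<bar> \<le> 1"
  shows "\<bar>(sine_flow s x - x - s * sin x) - (sine_flow s y - y - s * sin y)\<bar> \<le> 4 * s\<^sup>2 * \<bar>x - y\<bar>"
proof -
  define g where "g r = (sine_flow r x - x - r * sin x) - (sine_flow r y - y - r * sin y)" for r
  have "\<bar>g s - g 0\<bar> \<le> (4 * \<bar>s\<bar> * \<bar>x - y\<bar>) * \<bar>s - 0\<bar>"
  proof (rule abs_le_of_deriv_bound[where d = "\<bar>s\<bar>" and g' = "\<lambda>r. (sin (sine_flow r x) - sin x) - (sin (sine_flow r y) - sin y)"])
    fix r :: real assume r: "\<bar>r\<bar> \<le> \<bar>s\<bar>"
    show "(g has_real_derivative (sin (sine_flow r x) - sin x) - (sin (sine_flow r y) - sin y)) (at r)"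
      unfolding g_def by (rule derivative_eq_intros sine_flow_deriv refl)+ simp
    have "\<bar>(sin (sine_flow r x) - sin x) - (sin (sine_flow r y) - sin y)\<bar> \<le>
       \<bar>(sine_flow r x - x) - (sine_flow r y - y)\<bar> + \<bar>sine_flow r y - y\<bar> * \<bar>x - y\<bar>"
      using sin_difference_lipschitz[of x "sine_flow r x - x" y "sine_flow r y - y"] by simp
    also have "\<dots> \<le> 3 * \<bar>s\<bar> * \<bar>x - y\<bar> + \<bar>s\<bar> * \<bar>x - y\<bar>"
      using sine_flow_lipschitz_displacement[OF r assms, of x y] sine_flow_displacement[of r "\<bar>r\<bar>" 0 y] r
      by (intro add_mono mult_right_mono) auto
    finally show "\<bar>(sin (sine_flow r x) - sin x) - (sin (sine_flow r y) - sin y)\<bar> \<le> 4 * \<bar>s\<bar> * \<bar>x - y\<bar>"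
      by simp
  qed auto
  then show ?thesis by (simp add: g_def power2_eq_square mult.commute mult.left_commute abs_mult_self_eq)
qed

section \<open>Fields tangent to a monoid of maps\<close>

locale map_monoid =
  fixes G :: "('a::real_normed_vector \<Rightarrow> 'a) set"
  assumes id_in: "id \<in> G" and comp_in: "f \<in> G \<Longrightarrow> g \<in> G \<Longrightarrow> f \<circ> g \<in> G"
begin

text \<open>The two constants act differently: \<open>a\<close> bounds the Lipschitz constant of the
  displacement for all small \<open>h\<close>, without a factor \<open>h\<close>, so that another
  map can be inserted into \<open>\<Phi> h\<close>; \<open>b\<close> is the strict derivative error
  in the parameter. Keeping them apart matters because scaling and perturbing the field change only
  \<open>b\<close>.\<close>

definition tangent_family :: "real \<Rightarrow> real \<Rightarrow> ('a \<Rightarrow> 'a) \<Rightarrow> real \<Rightarrow> (real \<Rightarrow> 'a \<Rightarrow> 'a) \<Rightarrow> bool" where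
  "tangent_family a b X d \<Phi> \<longleftrightarrow> (\<forall>h. \<bar>h\<bar> \<le> d \<longrightarrow> \<Phi> h \<in> G) \<and> \<Phi> 0 = id \<and>
     (\<forall>h x y. \<bar>h\<bar> \<le> d \<longrightarrow> norm ((\<Phi> h x - x) - (\<Phi> h y - y)) \<le> a * norm (x - y)) \<and>
     (\<forall>h k x. \<bar>h\<bar> \<le> d \<longrightarrow> \<bar>k\<bar> \<le> d \<longrightarrow> norm (\<Phi> h x - \<Phi> k x - (h - k) *\<^sub>R X x) \<le> b * \<bar>h - k\<bar>)"

definition almost_tangent :: "real \<Rightarrow> real \<Rightarrow> ('a \<Rightarrow> 'a) \<Rightarrow> bool" where
  "almost_tangent a b X \<longleftrightarrow> (\<exists>d>0. \<exists>\<Phi>. tangent_family a b X d \<Phi>)"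

text \<open>The family may depend on \<open>e\<close>. Boundedness and uniform continuity of the
  field are carried along because composing families evaluates it at displaced points.\<close>

definition tangent :: "('a \<Rightarrow> 'a) \<Rightarrow> bool" where
  "tangent X \<longleftrightarrow> bounded (range X) \<and> uniformly_continuous_on UNIV X \<and> (\<forall>e>0. almost_tangent e e X)"

lemma tangent_familyD:
  assumes "tangent_family a b X d \<Phi>"
  shows "\<And>h. \<bar>h\<bar> \<le> d \<Longrightarrow> \<Phi> h \<in> G" "\<And>x. \<Phi> 0 x = x"
    "\<And>h x y. \<bar>h\<bar> \<le> d \<Longrightarrow> norm ((\<Phi> h x - x) - (\<Phi> h y - y)) \<le> a * norm (x - y)"
    "\<And>h k x. \<bar>h\<bar> \<le> d \<Longrightarrow> \<bar>k\<bar> \<le> d \<Longrightarrow> norm (\<Phi> h x - \<Phi> k x - (h - k) *\<^sub>R X x) \<le> b * \<bar>h - k\<bar>"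
  using assms unfolding tangent_family_def by auto

lemma tangent_family_shrink: "tangent_family a b X d \<Phi> \<Longrightarrow> d' \<le> d \<Longrightarrow> tangent_family a b X d' \<Phi>"
  unfolding tangent_family_def by (meson order_trans)

lemma tangent_family_displacement:
  assumes "tangent_family a b X d \<Phi>" "\<bar>h\<bar> \<le> d" "\<bar>k\<bar> \<le> d" "norm (X x) \<le> K"
  shows "norm (\<Phi> h x - \<Phi> k x) \<le> (K + b) * \<bar>h - k\<bar>"
proof -
  have "norm (\<Phi> h x - \<Phi> k x) \<le> norm (\<Phi> h x - \<Phi> k x - (h - k) *\<^sub>R X x) + norm ((h - k) *\<^sub>R X x)"
    by (metis diff_add_cancel norm_triangle_ineq)
  moreover have "norm ((h - k) *\<^sub>R X x) \<le> \<bar>h - k\<bar> * K"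
    using assms(4) by (simp add: mult_left_mono)
  ultimately show ?thesis
    using tangent_familyD(4)[OF assms(1-3), of x] by (simp add: algebra_simps)
qed

section \<open>Operations on almost tangent fields\<close>

lemma almost_tangent_mono:
  assumes "almost_tangent a b X" "a \<le> a'" "b \<le> b'"
  shows "almost_tangent a' b' X"
proof -
  have "a * norm v \<le> a' * norm v" "b * \<bar>r\<bar> \<le> b' * \<bar>r\<bar>" for v :: 'a and r
    using assms by (auto intro: mult_right_mono)
  then have "tangent_family a b X d \<Phi> \<Longrightarrow> tangent_family a' b' X d \<Phi>" for d \<Phi>
    unfolding tangent_family_def by (elim conjE, intro conjI allI impI) (simp, simp, (blast intro: order_trans)+)
  then show ?thesis using assms(1) unfolding almost_tangent_def by blast
qed

text \<open>The family is kept and only its error against the field is recounted. As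
  \<open>a\<close> does not mention the field, uniform closeness of \<open>X\<close> and
  \<open>Y\<close> suffices, without any comparison of derivatives.\<close>

lemma almost_tangent_perturb:
  assumes "almost_tangent a b X" "\<And>x. norm (X x - Y x) \<le> e"
  shows "almost_tangent a (b + e) Y"
proof -
  have "norm (v - r *\<^sub>R Y x) \<le> (b + e) * \<bar>r\<bar>" if "norm (v - r *\<^sub>R X x) \<le> b * \<bar>r\<bar>" for v r x
  proof -
    have "v - r *\<^sub>R Y x = (v - r *\<^sub>R X x) + r *\<^sub>R (X x - Y x)" by (simp add: algebra_simps)
    then have "norm (v - r *\<^sub>R Y x) \<le> norm (v - r *\<^sub>R X x) + \<bar>r\<bar> * norm (X x - Y x)"
      by (metis norm_scaleR norm_triangle_ineq)
    moreover have "\<bar>r\<bar> * norm (X x - Y x) \<le> \<bar>r\<bar> * e" using assms(2) by (simp add: mult_left_mono)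
    ultimately show ?thesis using that by (simp add: algebra_simps)
  qed
  then have "tangent_family a b X d \<Phi> \<Longrightarrow> tangent_family a (b + e) Y d \<Phi>" for d \<Phi>
    unfolding tangent_family_def by simp
  then show ?thesis using assms(1) unfolding almost_tangent_def by blast
qed

text \<open>The parameter is rescaled to \<open>c * h\<close>, on the interval of radius
  \<open>d / \<bar>c\<bar>\<close>. That \<open>a\<close> stays the same even for large
  \<open>c\<close> makes the later division by a small \<open>s\<close> possible.\<close>

lemma almost_tangent_scale:
  assumes "almost_tangent a b X" "c \<noteq> 0"
  shows "almost_tangent a (\<bar>c\<bar> * b) (\<lambda>x. c *\<^sub>R X x)"
proof -
  obtain d \<Phi> where d: "d > 0" and F: "tangent_family a b X d \<Phi>"
    using assms unfolding almost_tangent_def by auto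
  note F = tangent_familyD[OF F]
  have *: "\<bar>c * h\<bar> \<le> d" if "\<bar>h\<bar> \<le> d / \<bar>c\<bar>" for h
    using that assms(2) by (simp add: abs_mult field_simps)
  have "norm (\<Phi> (c * h) x - \<Phi> (c * k) x - (h - k) *\<^sub>R c *\<^sub>R X x) \<le> \<bar>c\<bar> * b * \<bar>h - k\<bar>"
    if "\<bar>h\<bar> \<le> d / \<bar>c\<bar>" "\<bar>k\<bar> \<le> d / \<bar>c\<bar>" for h k x
  proof -
    have "(h - k) *\<^sub>R c *\<^sub>R X x = (c * h - c * k) *\<^sub>R X x" by (simp add: algebra_simps)
    moreover have "\<bar>c\<bar> * b * \<bar>h - k\<bar> = b * \<bar>c * h - c * k\<bar>"
      by (simp add: abs_mult right_diff_distrib[symmetric])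
    ultimately show ?thesis using F(4)[OF * *, OF that, of x] by metis
  qed
  then have "tangent_family a (\<bar>c\<bar> * b) (\<lambda>x. c *\<^sub>R X x) (d / \<bar>c\<bar>) (\<lambda>h. \<Phi> (c * h))"
    unfolding tangent_family_def using F(1-3) * by (auto simp: fun_eq_iff)
  moreover have "d / \<bar>c\<bar> > 0" using d assms(2) by simp
  ultimately show ?thesis unfolding almost_tangent_def by blast
qed

lemma almost_tangent_zero: "0 \<le> a \<Longrightarrow> 0 \<le> b \<Longrightarrow> almost_tangent a b (\<lambda>x. 0)"
  unfolding almost_tangent_def tangent_family_def
  by (rule exI[of _ 1], simp, rule exI[of _ "\<lambda>h. id"]) (auto simp: id_in)

text \<open>The family is the composition \<open>\<Phi> h \<circ> \<Psi> h\<close>. The term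
  \<open>a * (K + d)\<close> arises because the inner maps at parameters \<open>h\<close> and
  \<open>k\<close> differ by up to \<open>(K + d) * \<bar>h - k\<bar>\<close>, and \<open>e\<close>
  because \<open>X\<close> is read off at the moved point \<open>\<Psi> k x\<close> instead of
  \<open>x\<close>.\<close>

lemma almost_tangent_add:
  assumes X: "almost_tangent a b X" "uniformly_continuous_on UNIV X" "a \<ge> 0"
    and Y: "almost_tangent c d Y" "\<And>x. norm (Y x) \<le> K" "d \<ge> 0" and e: "e > 0"
  shows "almost_tangent (a + c + a * c) (b + d + a * (K + d) + e) (\<lambda>x. X x + Y x)"
proof -
  have K: "K \<ge> 0" using Y(2) norm_ge_zero order_trans by blast
  obtain r1 \<Phi> where r1: "r1 > 0" "tangent_family a b X r1 \<Phi>" using X(1) unfolding almost_tangent_def by auto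
  obtain r2 \<Psi> where r2: "r2 > 0" "tangent_family c d Y r2 \<Psi>" using Y(1) unfolding almost_tangent_def by auto
  obtain r3 where "r3 > 0" and "\<forall>u\<in>UNIV. \<forall>v\<in>UNIV. dist v u < r3 \<longrightarrow> dist (X v) (X u) < e"
    using X(2)[unfolded uniformly_continuous_on_def, rule_format, OF e] by (elim exE conjE) (rule that)
  then have r3: "r3 > 0" "\<And>u v. norm (u - v) < r3 \<Longrightarrow> norm (X u - X v) < e"
    by (simp_all add: dist_norm)
  \<comment> \<open>The last bound keeps \<open>\<Psi> k x\<close> within \<open>r3\<close> of
    \<open>x\<close>; the summand 1 makes the denominator positive.\<close>
  define r where "r = min (min r1 r2) (r3 / (K + d + 1))"
  have r: "r > 0" "r \<le> r1" "r \<le> r2" "r * (K + d) < r3"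
  proof -
    show "r > 0" using r1 r2 r3 K Y(3) by (simp add: r_def)
    show "r \<le> r1" "r \<le> r2" by (auto simp: r_def)
    have "r \<le> r3 / (K + d + 1)" by (simp add: r_def)
    then have "r * (K + d + 1) \<le> r3" using K Y(3) by (simp add: field_simps)
    then show "r * (K + d) < r3" using \<open>r > 0\<close> by (simp add: algebra_simps)
  qed
  have P: "tangent_family a b X r \<Phi>" and Q: "tangent_family c d Y r \<Psi>"
    using tangent_family_shrink r1(2) r2(2) r by blast+
  note F = tangent_familyD[OF P] and H = tangent_familyD[OF Q]
  have "tangent_family (a + c + a * c) (b + d + a * (K + d) + e) (\<lambda>x. X x + Y x) r (\<lambda>h. \<Phi> h \<circ> \<Psi> h)"
    unfolding tangent_family_def
  proof (intro conjI allI impI)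
    show "\<Phi> 0 \<circ> \<Psi> 0 = id" using F(2) H(2) by auto
  next
    fix h :: real assume "\<bar>h\<bar> \<le> r"
    then show "\<Phi> h \<circ> \<Psi> h \<in> G" using F(1) H(1) comp_in by auto
  next
    fix h :: real and x y assume h: "\<bar>h\<bar> \<le> r"
    let ?u = "\<Psi> h x" and ?v = "\<Psi> h y"
    have 1: "norm ((?u - x) - (?v - y)) \<le> c * norm (x - y)" using H(3) h by blast
    have "?u - ?v = ((?u - x) - (?v - y)) + (x - y)" by simp
    then have "norm (?u - ?v) \<le> c * norm (x - y) + norm (x - y)"
      using 1 norm_triangle_ineq[of "(?u - x) - (?v - y)" "x - y"] by simp
    then have 2: "a * norm (?u - ?v) \<le> a * (c * norm (x - y) + norm (x - y))" using X(3) by (rule mult_left_mono)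
    have "(\<Phi> h ?u - x) - (\<Phi> h ?v - y) = ((\<Phi> h ?u - ?u) - (\<Phi> h ?v - ?v)) + ((?u - x) - (?v - y))" by simp
    then have "norm ((\<Phi> h ?u - x) - (\<Phi> h ?v - y)) \<le> a * norm (?u - ?v) + c * norm (x - y)"
      by (simp only:) (intro norm_triangle_mono F(3) h 1)
    with 2 show "norm (((\<Phi> h \<circ> \<Psi> h) x - x) - ((\<Phi> h \<circ> \<Psi> h) y - y)) \<le> (a + c + a * c) * norm (x - y)"
      by (simp add: algebra_simps)
  next
    fix h k :: real and x assume h: "\<bar>h\<bar> \<le> r" and k: "\<bar>k\<bar> \<le> r"
    let ?u = "\<Psi> h x" and ?v = "\<Psi> k x"
    have 1: "norm (?u - ?v) \<le> (K + d) * \<bar>h - k\<bar>" by (rule tangent_family_displacement[OF Q h k Y(2)])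
    have "norm (?v - \<Psi> 0 x) \<le> (K + d) * \<bar>k - 0\<bar>"
      by (rule tangent_family_displacement[OF Q k _ Y(2)]) (use r in auto)
    also have "\<dots> \<le> (K + d) * r" using k K Y(3) by (intro mult_left_mono) auto
    finally have "norm (?v - x) < r3" using r(4) H(2) by (simp add: mult.commute)
    then have 2: "norm ((h - k) *\<^sub>R (X ?v - X x)) \<le> \<bar>h - k\<bar> * e"
      using r3(2)[of ?v x] by (simp add: mult_left_mono)
    have 3: "a * norm (?u - ?v) \<le> a * ((K + d) * \<bar>h - k\<bar>)" using 1 X(3) by (rule mult_left_mono)
    have "\<Phi> h ?u - \<Phi> k ?v - (h - k) *\<^sub>R (X x + Y x) = ((\<Phi> h ?u - ?u) - (\<Phi> h ?v - ?v))
        + (?u - ?v - (h - k) *\<^sub>R Y x) + (\<Phi> h ?v - \<Phi> k ?v - (h - k) *\<^sub>R X ?v) + (h - k) *\<^sub>R (X ?v - X x)"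
      by (simp add: algebra_simps)
    then have "norm (\<Phi> h ?u - \<Phi> k ?v - (h - k) *\<^sub>R (X x + Y x)) \<le> norm ((\<Phi> h ?u - ?u) - (\<Phi> h ?v - ?v))
        + norm (?u - ?v - (h - k) *\<^sub>R Y x) + norm (\<Phi> h ?v - \<Phi> k ?v - (h - k) *\<^sub>R X ?v) + norm ((h - k) *\<^sub>R (X ?v - X x))"
      by (simp only:) (intro norm_triangle_mono order_refl)
    also have "\<dots> \<le> a * norm (?u - ?v) + d * \<bar>h - k\<bar> + b * \<bar>h - k\<bar> + \<bar>h - k\<bar> * e"
      by (intro add_mono F(3) F(4) H(4) h k 2)
    finally show "norm ((\<Phi> h \<circ> \<Psi> h) x - (\<Phi> k \<circ> \<Psi> k) x - (h - k) *\<^sub>R (X x + Y x))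
        \<le> (b + d + a * (K + d) + e) * \<bar>h - k\<bar>"
      using 3 by (simp add: algebra_simps)
  qed
  then show ?thesis using r(1) unfolding almost_tangent_def by blast
qed

text \<open>Conjugating by the time-\<open>s\<close> map of \<open>Y\<close> transports
  \<open>X\<close> to \<open>X + s * (DY X - DX Y)\<close> up to order \<open>s^2\<close>. Here
  \<open>s\<close> is fixed before the range of \<open>h\<close>, and \<open>X\<close> itself is
  known to tolerance \<open>s^2\<close>. \<open>DX\<close> and \<open>DY\<close> enter through
  linearity and Taylor and Lipschitz bounds, all with one constant \<open>C\<close>.\<close>

lemma almost_tangent_conj:
  fixes Y X R R' :: "'a \<Rightarrow> 'a"
  assumes s: "0 < s" "s \<le> 1" and C: "C \<ge> 1"
    and \<psi>: "\<psi> \<in> G" "\<psi>' \<in> G" "\<And>x. \<psi> (\<psi>' x) = x"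
    and \<psi>_eq: "\<And>x. \<psi> x = x + s *\<^sub>R Y x + R x" and R: "\<And>x y. norm (R x - R y) \<le> C * s\<^sup>2 * norm (x - y)"
    and \<psi>'_eq: "\<And>x. \<psi>' x = x - s *\<^sub>R Y x + R' x" and R': "\<And>x. norm (R' x) \<le> C * s\<^sup>2"
    and \<psi>'_lip: "\<And>x y. norm (\<psi>' x - \<psi>' y) \<le> C * norm (x - y)"
    and Y: "\<And>x. norm (Y x) \<le> C" "\<And>x y. norm (Y x - Y y) \<le> C * norm (x - y)"
      "\<And>x y. norm (Y y - Y x - DY x (y - x)) \<le> C * (norm (y - x))\<^sup>2"
      "\<And>x. linear (DY x)" "\<And>x v. norm (DY x v) \<le> C * norm v"
      "\<And>x y v. norm (DY x v - DY y v) \<le> C * norm (x - y) * norm v"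
    and X: "\<And>x. norm (X x) \<le> C" "\<And>x y. norm (X x - X y) \<le> C * norm (x - y)"
      "\<And>x y. norm (X y - X x - DX x (y - x)) \<le> C * (norm (y - x))\<^sup>2"
      "\<And>x. linear (DX x)" "\<And>x v. norm (DX x v) \<le> C * norm v"
    and tan: "almost_tangent (s\<^sup>2) (s\<^sup>2) X"
  shows "almost_tangent (7 * C\<^sup>2 * s) (21 * C^3 * s\<^sup>2) (\<lambda>x. X x + s *\<^sub>R (DY x (X x) - DX x (Y x)))"
proof -
  obtain r0 \<Phi> where r0: "r0 > 0" "tangent_family (s\<^sup>2) (s\<^sup>2) X r0 \<Phi>" using tan unfolding almost_tangent_def by auto
  define r where "r = min r0 (s / (2 * C))"
  have r: "r > 0" "r \<le> r0" "2 * C * r \<le> s"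
  proof -
    show "r > 0" "r \<le> r0" using r0 s C by (auto simp: r_def)
    have "r \<le> s / (2 * C)" by (simp add: r_def)
    then show "2 * C * r \<le> s" using C by (simp add: field_simps)
  qed
  have P: "tangent_family (s\<^sup>2) (s\<^sup>2) X r \<Phi>" using tangent_family_shrink r0(2) r by blast
  note F = tangent_familyD[OF P]
  have s2: "s\<^sup>2 \<le> s" "s\<^sup>2 \<le> 1" using s by (auto simp: power2_eq_square mult_le_one mult_left_le)
  have CC: "C \<le> C\<^sup>2" "C\<^sup>2 \<le> C^3" "1 \<le> C\<^sup>2" "1 \<le> C^3"
    using C by (auto intro: power_increasing[of 1 2 C, simplified] power_increasing)
  have C0: "C \<ge> 0" "C * s\<^sup>2 \<ge> 0" using C by auto
  have disp: "norm (\<psi>' x - x) \<le> 2 * C * s" for x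
  proof -
    have "norm (\<psi>' x - x) = norm (R' x - s *\<^sub>R Y x)" by (simp add: \<psi>'_eq)
    also have "\<dots> \<le> norm (R' x) + s * norm (Y x)" using norm_triangle_ineq4[of "R' x" "s *\<^sub>R Y x"] s by simp
    also have "\<dots> \<le> C * s + s * C"
      using R'[of x] Y(1)[of x] s s2 C by (intro add_mono order_trans[OF R' mult_left_mono] mult_left_mono) auto
    finally show ?thesis by simp
  qed
  have "tangent_family (7 * C\<^sup>2 * s) (21 * C^3 * s\<^sup>2) (\<lambda>x. X x + s *\<^sub>R (DY x (X x) - DX x (Y x))) r (\<lambda>h. \<psi> \<circ> \<Phi> h \<circ> \<psi>')"
    unfolding tangent_family_def
  proof (intro conjI allI impI)
    show "\<psi> \<circ> \<Phi> 0 \<circ> \<psi>' = id" using F(2) \<psi>(3) by auto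
  next
    fix h :: real assume "\<bar>h\<bar> \<le> r"
    then show "\<psi> \<circ> \<Phi> h \<circ> \<psi>' \<in> G" using F(1) \<psi> comp_in by auto
  next
    fix h :: real and x x' assume h: "\<bar>h\<bar> \<le> r"
    define y y' u w n where "y = \<psi>' x" and "y' = \<psi>' x'" and "u = \<Phi> h y" and "w = \<Phi> h y'" and "n = norm (y - y')"
    have n: "n \<ge> 0" "n \<le> C * norm (x - x')" unfolding n_def y_def y'_def using \<psi>'_lip by auto
    have 1: "norm ((u - y) - (w - y')) \<le> s\<^sup>2 * n" unfolding u_def w_def n_def using F(3) h by blast
    also have "\<dots> \<le> n" using s2 n mult_right_mono by fastforce
    finally have "norm ((u - y) - (w - y')) \<le> n" .
    moreover have "u - w = ((u - y) - (w - y')) + (y - y')" by simp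
    ultimately have uw: "norm (u - w) \<le> 2 * n"
      using norm_triangle_ineq[of "(u - y) - (w - y')" "y - y'"] unfolding n_def by simp
    have lipY: "norm (Y u - Y w) \<le> C * (2 * n)" "norm (Y y - Y y') \<le> C * n"
      using order_trans[OF Y(2)[of u w] mult_left_mono[OF uw C0(1)]] Y(2)[of y y'] by (simp_all add: n_def)
    have lipR: "norm (R u - R w) \<le> C * s\<^sup>2 * (2 * n)" "norm (R y - R y') \<le> C * s\<^sup>2 * n"
      using order_trans[OF R[of u w] mult_left_mono[OF uw C0(2)]] R[of y y'] by (simp_all add: n_def)
    have "(\<psi> u - \<psi> y) - (\<psi> w - \<psi> y') = ((u - y) - (w - y')) + s *\<^sub>R (Y u - Y w) + s *\<^sub>R (Y y' - Y y) + (R u - R w) + (R y' - R y)"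
      by (simp add: \<psi>_eq algebra_simps)
    then have "norm ((\<psi> u - \<psi> y) - (\<psi> w - \<psi> y')) \<le> norm ((u - y) - (w - y')) + s * norm (Y u - Y w) + s * norm (Y y - Y y') + norm (R u - R w) + norm (R y - R y')"
      using s by (simp only:) (intro norm_triangle_mono; simp add: norm_minus_commute)
    also have "\<dots> \<le> s\<^sup>2 * n + s * (C * (2 * n)) + s * (C * n) + C * s\<^sup>2 * (2 * n) + C * s\<^sup>2 * n"
      using s by (intro add_mono 1 lipY lipR mult_left_mono) auto
    also have "\<dots> = s\<^sup>2 * n + 3 * (C * (s * n)) + 3 * (C * (s\<^sup>2 * n))" by (simp add: algebra_simps)
    also have "\<dots> \<le> C * (s * n) + 3 * (C * (s * n)) + 3 * (C * (s * n))"
    proof (intro add_mono mult_left_mono mult_right_mono order_refl)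
      have "s\<^sup>2 * n \<le> s * n" using s2 n by (simp add: mult_right_mono)
      also have "\<dots> \<le> C * (s * n)" using C s n mult_right_mono[of 1 C "s * n"] by simp
      finally show "s\<^sup>2 * n \<le> C * (s * n)" .
    qed (use C s s2 n in auto)
    also have "\<dots> = 7 * C * s * n" by simp
    also have "\<dots> \<le> 7 * C * s * (C * norm (x - x'))" using n C s by (intro mult_left_mono) auto
    also have "\<dots> = 7 * C\<^sup>2 * s * norm (x - x')" by (simp add: power2_eq_square)
    finally show "norm (((\<psi> \<circ> \<Phi> h \<circ> \<psi>') x - x) - ((\<psi> \<circ> \<Phi> h \<circ> \<psi>') x' - x')) \<le> 7 * C\<^sup>2 * s * norm (x - x')"
      by (simp add: u_def w_def y_def y'_def \<psi>(3))
  next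
    fix h k :: real and x assume h: "\<bar>h\<bar> \<le> r" and k: "\<bar>k\<bar> \<le> r"
    define y u w A e where "y = \<psi>' x" and "u = \<Phi> h y" and "w = \<Phi> k y" and "A = \<bar>h - k\<bar>" and "e = u - w - (h - k) *\<^sub>R X y"
    have A: "A \<ge> 0" "A \<le> 2 * r" using h k by (auto simp: A_def)
    have e: "norm e \<le> s\<^sup>2 * A" unfolding e_def u_def w_def A_def using F(4)[OF h k] .
    have "C + s\<^sup>2 \<le> 2 * C" using s2 C by simp
    then have *: "(C + s\<^sup>2) * t \<le> 2 * C * t" if "t \<ge> 0" for t using that by (simp add: mult_right_mono)
    have uw: "norm (u - w) \<le> 2 * C * A"
      using tangent_family_displacement[OF P h k X(1), of y] *[OF A(1)] unfolding u_def w_def A_def by simp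
    have uw': "norm (u - w) \<le> 2 * s"
    proof -
      have "2 * C * A \<le> 2 * C * (2 * r)" using A C by (intro mult_left_mono) auto
      then show ?thesis using uw r(3) by (simp only: mult.assoc)
    qed
    have "norm (w - \<Phi> 0 y) \<le> 2 * C * \<bar>k - 0\<bar>"
      using tangent_family_displacement[OF P k _ X(1), of 0 y] *[of "\<bar>k\<bar>"] r(1) unfolding w_def by simp
    also have "\<dots> \<le> 2 * C * r" using k C by (intro mult_left_mono) auto
    finally have wy: "norm (w - y) \<le> s" using r(3) F(2) by simp
    have yx: "norm (y - x) \<le> 2 * C * s" unfolding y_def by (rule disp)
    have "s \<le> C * s" using C s by simp
    then have wx: "norm (w - x) \<le> 3 * C * s"
      using norm_triangle_ineq[of "w - y" "y - x"] wy yx by simp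
    have T1: "norm (Y u - Y w - DY w (u - w)) \<le> 4 * C^3 * (s * A)"
    proof -
      have "(norm (u - w))\<^sup>2 \<le> (2 * s) * (2 * C * A)" unfolding power2_eq_square
        using uw uw' s C A by (intro mult_mono) auto
      then have "C * (norm (u - w))\<^sup>2 \<le> C * ((2 * s) * (2 * C * A))" using C by (intro mult_left_mono) auto
      also have "\<dots> = 4 * C\<^sup>2 * (s * A)" by (simp add: power2_eq_square)
      also have "\<dots> \<le> 4 * C^3 * (s * A)" using CC s A by (intro mult_right_mono mult_left_mono) auto
      finally show ?thesis using Y(3)[of u w] by linarith
    qed
    have T2: "norm (DY w (u - w) - DY x (u - w)) \<le> 6 * C^3 * (s * A)"
    proof -
      have "C * norm (w - x) * norm (u - w) \<le> C * (3 * C * s) * (2 * C * A)"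
        using wx uw C s A by (intro mult_mono) auto
      also have "\<dots> = 6 * C^3 * (s * A)" by (simp add: power3_eq_cube)
      finally show ?thesis using Y(6)[of w "u - w" x] by linarith
    qed
    have XX: "norm (X y - X x) \<le> C * (2 * C * s)" using order_trans[OF X(2)[of y x] mult_left_mono[OF yx C0(1)]] .
    have sC: "s \<le> C\<^sup>2 * s" using CC s mult_right_mono[of 1 "C\<^sup>2" s] by simp
    have T3: "norm (DY x (u - w) - (h - k) *\<^sub>R DY x (X x)) \<le> 3 * C^3 * (s * A)"
    proof -
      have "u - w - (h - k) *\<^sub>R X x = e + (h - k) *\<^sub>R (X y - X x)" by (simp add: e_def algebra_simps)
      then have "norm (u - w - (h - k) *\<^sub>R X x) \<le> s\<^sup>2 * A + A * (C * (2 * C * s))"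
        using e mult_left_mono[OF XX A(1)]
        by (simp only:) (intro norm_triangle_mono; simp add: A_def)
      also have "\<dots> \<le> (C\<^sup>2 * s) * A + A * (C * (2 * C * s))"
        using mult_right_mono[OF order_trans[OF s2(1) sC] A(1)] by simp
      also have "\<dots> = 3 * C\<^sup>2 * (s * A)" by (simp add: power2_eq_square)
      finally have "C * norm (u - w - (h - k) *\<^sub>R X x) \<le> C * (3 * C\<^sup>2 * (s * A))" using C by (intro mult_left_mono) auto
      then have "norm (DY x (u - w - (h - k) *\<^sub>R X x)) \<le> 3 * C^3 * (s * A)"
        using Y(5)[of x "u - w - (h - k) *\<^sub>R X x"] by (simp add: power2_eq_square power3_eq_cube mult.assoc)
      then show ?thesis using Y(4)[of x] by (simp add: linear_diff linear_scale)
    qed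
    have T4: "norm (R u - R w) \<le> 2 * C^3 * (s\<^sup>2 * A)"
    proof -
      have "C * s\<^sup>2 * norm (u - w) \<le> C * s\<^sup>2 * (2 * C * A)" using uw C by (intro mult_left_mono) auto
      also have "\<dots> = 2 * C\<^sup>2 * (s\<^sup>2 * A)" by (simp add: power2_eq_square)
      also have "\<dots> \<le> 2 * C^3 * (s\<^sup>2 * A)" using CC A by (intro mult_right_mono mult_left_mono) auto
      finally show ?thesis using R[of u w] by linarith
    qed
    have T5: "norm (X y - X x + s *\<^sub>R DX x (Y x)) \<le> 5 * C^3 * s\<^sup>2"
    proof -
      have "(norm (y - x))\<^sup>2 \<le> (2 * C * s) * (2 * C * s)" unfolding power2_eq_square using yx s C by (intro mult_mono) auto
      then have "C * (norm (y - x))\<^sup>2 \<le> C * ((2 * C * s) * (2 * C * s))" using C by (intro mult_left_mono) auto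
      then have 1: "norm (X y - X x - DX x (y - x)) \<le> 4 * C^3 * s\<^sup>2"
        using X(3)[of y x] by (simp add: power3_eq_cube power2_eq_square algebra_simps)
      have "y - x + s *\<^sub>R Y x = R' x" by (simp add: y_def \<psi>'_eq)
      then have "DX x (y - x) + s *\<^sub>R DX x (Y x) = DX x (R' x)"
        using X(4)[of x] by (metis linear_add linear_scale)
      moreover have "norm (DX x (R' x)) \<le> C * (C * s\<^sup>2)"
        using order_trans[OF X(5)[of x "R' x"] mult_left_mono[OF R'[of x] C0(1)]] .
      moreover have "C * (C * s\<^sup>2) \<le> C^3 * s\<^sup>2"
        using CC by (simp add: power2_eq_square[symmetric] mult.assoc[symmetric] mult_right_mono del: mult.assoc)
      ultimately have 2: "norm (DX x (y - x) + s *\<^sub>R DX x (Y x)) \<le> C^3 * s\<^sup>2" by simp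
      have "X y - X x + s *\<^sub>R DX x (Y x) = (X y - X x - DX x (y - x)) + (DX x (y - x) + s *\<^sub>R DX x (Y x))" by simp
      then show ?thesis using norm_triangle_mono[OF 1 2] by simp
    qed
    \<comment> \<open>Six error terms: the error of the family, the Taylor error of \<open>X\<close>
      from \<open>x\<close> to \<open>y\<close>, the Taylor error of \<open>Y\<close> between
      \<open>u\<close> and \<open>w\<close>, the change of \<open>DY\<close> from \<open>w\<close>
      to \<open>x\<close>, the replacement of \<open>u - w\<close> by
      \<open>(h - k) *\<^sub>R X x\<close>, and the remainder \<open>R\<close>. Their coefficients
      1, 5, 4, 6, 3, 2 add up to 21.\<close>
    have "\<psi> u - \<psi> w - (h - k) *\<^sub>R (X x + s *\<^sub>R (DY x (X x) - DX x (Y x)))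
        = e + (h - k) *\<^sub>R (X y - X x + s *\<^sub>R DX x (Y x)) + s *\<^sub>R (Y u - Y w - DY w (u - w))
          + s *\<^sub>R (DY w (u - w) - DY x (u - w)) + s *\<^sub>R (DY x (u - w) - (h - k) *\<^sub>R DY x (X x)) + (R u - R w)"
      by (simp add: \<psi>_eq e_def algebra_simps)
    then have "norm (\<psi> u - \<psi> w - (h - k) *\<^sub>R (X x + s *\<^sub>R (DY x (X x) - DX x (Y x))))
        \<le> norm e + A * norm (X y - X x + s *\<^sub>R DX x (Y x)) + s * norm (Y u - Y w - DY w (u - w))
          + s * norm (DY w (u - w) - DY x (u - w)) + s * norm (DY x (u - w) - (h - k) *\<^sub>R DY x (X x)) + norm (R u - R w)"
      using s by (simp only:) (intro norm_triangle_mono; simp add: A_def)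
    also have "\<dots> \<le> C^3 * (s\<^sup>2 * A) + A * (5 * C^3 * s\<^sup>2) + s * (4 * C^3 * (s * A)) + s * (6 * C^3 * (s * A))
          + s * (3 * C^3 * (s * A)) + 2 * C^3 * (s\<^sup>2 * A)"
    proof (intro add_mono mult_left_mono T1 T2 T3 T4 T5)
      show "norm e \<le> C^3 * (s\<^sup>2 * A)" using e CC A mult_right_mono[of 1 "C^3" "s\<^sup>2 * A"] by simp
    qed (use s A in auto)
    also have "\<dots> = 21 * C^3 * s\<^sup>2 * A" by (simp add: power2_eq_square algebra_simps)
    finally show "norm ((\<psi> \<circ> \<Phi> h \<circ> \<psi>') x - (\<psi> \<circ> \<Phi> k \<circ> \<psi>') x - (h - k) *\<^sub>R (X x + s *\<^sub>R (DY x (X x) - DX x (Y x))))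
        \<le> 21 * C^3 * s\<^sup>2 * \<bar>h - k\<bar>"
      by (simp add: u_def w_def y_def A_def)
  qed
  then show ?thesis using r(1) unfolding almost_tangent_def by blast
qed

section \<open>Linear combinations, limits and brackets of tangent fields\<close>

lemma tangent_add:
  assumes X: "tangent X" and Y: "tangent Y"
  shows "tangent (\<lambda>x. X x + Y x)"
  unfolding tangent_def
proof (intro conjI allI impI)
  show "bounded (range (\<lambda>x. X x + Y x))"
    using X Y unfolding tangent_def by (auto intro: bounded_plus_comp)
  show "uniformly_continuous_on UNIV (\<lambda>x. X x + Y x)"
    using X Y unfolding tangent_def by (auto intro: uniformly_continuous_on_add)
  fix e :: real assume e: "e > 0"
  obtain K where K: "K > 0" "\<And>x. norm (Y x) \<le> K"
    using Y unfolding tangent_def bounded_pos by auto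
  define t where "t = min 1 (e / (K + 4))"
  have t: "t > 0" "t \<le> 1" "t * (K + 4) \<le> e"
  proof -
    show "t > 0" "t \<le> 1" using e K by (auto simp: t_def)
    have "t \<le> e / (K + 4)" by (simp add: t_def)
    then show "t * (K + 4) \<le> e" using K by (simp add: field_simps)
  qed
  have tt: "t * t \<le> t" using t by (simp add: mult_left_le)
  have tK: "t * K \<ge> 0" using t K by simp
  have "almost_tangent (t + t + t * t) (t + t + t * (K + t) + t) (\<lambda>x. X x + Y x)"
    using X Y t K by (intro almost_tangent_add) (auto simp: tangent_def)
  then show "almost_tangent e e (\<lambda>x. X x + Y x)"
    by (rule almost_tangent_mono) (use t(1,3) tt tK in \<open>unfold distrib_left, linarith+\<close>)
qed

lemma tangent_zero: "tangent (\<lambda>x. 0)"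
  unfolding tangent_def by (auto intro: almost_tangent_zero uniformly_continuous_on_const)

lemma tangent_scale:
  assumes X: "tangent X"
  shows "tangent (\<lambda>x. c *\<^sub>R X x)"
proof (cases "c = 0")
  case True
  then show ?thesis by (simp add: tangent_zero)
next
  case False
  have "almost_tangent e e (\<lambda>x. c *\<^sub>R X x)" if e: "e > 0" for e
  proof -
    define t where "t = min e (e / \<bar>c\<bar>)"
    have t: "t > 0" "t \<le> e" "\<bar>c\<bar> * t \<le> e"
      using e False by (auto simp: t_def min_def field_simps)
    have "almost_tangent t (\<bar>c\<bar> * t) (\<lambda>x. c *\<^sub>R X x)"
      using X t False by (intro almost_tangent_scale) (auto simp: tangent_def)
    then show ?thesis by (rule almost_tangent_mono) (use t in auto)
  qed
  moreover have "bounded (range (\<lambda>x. c *\<^sub>R X x))"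
    using X unfolding tangent_def by (auto intro: bounded_scaleR_comp)
  moreover have "uniformly_continuous_on UNIV (\<lambda>x. c *\<^sub>R X x)"
    using X unfolding tangent_def by (auto intro: uniformly_continuous_on_cmul)
  ultimately show ?thesis unfolding tangent_def by blast
qed

lemma tangent_sum:
  assumes "\<And>i. i \<in> I \<Longrightarrow> tangent (X i)"
  shows "tangent (\<lambda>x. \<Sum>i\<in>I. X i x)"
  using assms by (induction I rule: infinite_finite_induct) (auto intro: tangent_zero tangent_add)

lemma tangent_limit:
  assumes X: "bounded (range X)" "uniformly_continuous_on UNIV X"
    and Y: "\<And>e. e > 0 \<Longrightarrow> \<exists>Y. tangent Y \<and> (\<forall>x. norm (Y x - X x) \<le> e)"
  shows "tangent X"
  unfolding tangent_def
proof (intro conjI allI impI X)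
  fix e :: real assume e: "e > 0"
  obtain Y where Y: "tangent Y" "\<And>x. norm (Y x - X x) \<le> e / 2" using Y[of "e / 2"] e by auto
  have "almost_tangent (e / 2) (e / 2 + e / 2) X"
    using Y e by (intro almost_tangent_perturb[of _ _ Y]) (auto simp: tangent_def)
  then show "almost_tangent e e X" by (rule almost_tangent_mono) (use e in auto)
qed

text \<open>Composing a family for \<open>- X\<close> with the conjugated family of \<open>X\<close>
  leaves \<open>s\<close> times the bracket with an error of order \<open>s^2\<close>; rescaling the
  parameter by \<open>1 / s\<close> then leaves an error of order \<open>s\<close>. The bracket is
  itself bounded and Lipschitz by the product rule.\<close>

lemma tangent_bracket:
  fixes Y X :: "'a \<Rightarrow> 'a"
  assumes C: "C \<ge> 1"
    and \<psi>: "\<And>s. \<bar>s\<bar> \<le> 1 \<Longrightarrow> \<psi> s \<in> G" "\<And>s x. \<psi> s (\<psi> (- s) x) = x"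
      "\<And>s x. \<bar>s\<bar> \<le> 1 \<Longrightarrow> norm (\<psi> s x - x - s *\<^sub>R Y x) \<le> C * s\<^sup>2"
      "\<And>s x y. \<bar>s\<bar> \<le> 1 \<Longrightarrow> norm ((\<psi> s x - x - s *\<^sub>R Y x) - (\<psi> s y - y - s *\<^sub>R Y y)) \<le> C * s\<^sup>2 * norm (x - y)"
    and Y: "\<And>x. norm (Y x) \<le> C" "\<And>x y. norm (Y x - Y y) \<le> C * norm (x - y)"
      "\<And>x y. norm (Y y - Y x - DY x (y - x)) \<le> C * (norm (y - x))\<^sup>2"
      "\<And>x. linear (DY x)" "\<And>x v. norm (DY x v) \<le> C * norm v"
      "\<And>x y v. norm (DY x v - DY y v) \<le> C * norm (x - y) * norm v"
    and X: "\<And>x. norm (X x) \<le> C" "\<And>x y. norm (X x - X y) \<le> C * norm (x - y)"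
      "\<And>x y. norm (X y - X x - DX x (y - x)) \<le> C * (norm (y - x))\<^sup>2"
      "\<And>x. linear (DX x)" "\<And>x v. norm (DX x v) \<le> C * norm v"
      "\<And>x y v. norm (DX x v - DX y v) \<le> C * norm (x - y) * norm v"
    and tan: "tangent X"
  shows "tangent (\<lambda>x. DY x (X x) - DX x (Y x))" (is "tangent ?B")
proof -
  have term_bound: "norm (D x (Z x)) \<le> C * C"
    if "\<And>x v. norm (D x v) \<le> C * norm v" "\<And>x. norm (Z x) \<le> C" for D :: "'a \<Rightarrow> 'a \<Rightarrow> 'a" and Z x
    using order_trans[OF that(1)[of x "Z x"] mult_left_mono[OF that(2)[of x], of C]] C by simp
  have B_bound: "norm (?B x) \<le> 2 * C\<^sup>2" for x
    using norm_triangle_ineq4[of "DY x (X x)" "DX x (Y x)"] term_bound[of DY X x] term_bound[of DX Y x] Y X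
    by (simp add: power2_eq_square)
  have term_lip: "norm (D x (Z x) - D y (Z y)) \<le> 2 * C\<^sup>2 * norm (x - y)"
    if lin: "\<And>x. linear (D x)" and D: "\<And>x v. norm (D x v) \<le> C * norm v"
      and DD: "\<And>x y v. norm (D x v - D y v) \<le> C * norm (x - y) * norm v"
      and Z: "\<And>x. norm (Z x) \<le> C" "\<And>x y. norm (Z x - Z y) \<le> C * norm (x - y)"
    for D :: "'a \<Rightarrow> 'a \<Rightarrow> 'a" and Z x y
  proof -
    have eq: "D x (Z x) - D y (Z y) = (D x (Z x) - D y (Z x)) + D y (Z x - Z y)"
      by (simp add: linear_diff[OF lin])
    have "norm (D x (Z x) - D y (Z x)) \<le> C * norm (x - y) * C"
      using order_trans[OF DD mult_left_mono[OF Z(1)]] C by simp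
    moreover have "norm (D y (Z x - Z y)) \<le> C * (C * norm (x - y))"
      using order_trans[OF D mult_left_mono[OF Z(2)]] C by simp
    moreover have "2 * C\<^sup>2 * norm (x - y) = C * norm (x - y) * C + C * (C * norm (x - y))"
      by (simp add: power2_eq_square)
    ultimately show ?thesis
      unfolding eq by (simp only:) (intro norm_triangle_mono)
  qed
  have B_lip: "norm (?B x - ?B y) \<le> 4 * C\<^sup>2 * norm (x - y)" for x y
  proof -
    have eq: "?B x - ?B y = (DY x (X x) - DY y (X y)) - (DX x (Y x) - DX y (Y y))" by simp
    show ?thesis
      unfolding eq using norm_triangle_ineq4[of "DY x (X x) - DY y (X y)" "DX x (Y x) - DX y (Y y)"]
        term_lip[OF Y(4,5,6) X(1,2), of x y] term_lip[OF X(4,5,6) Y(1,2), of x y] by linarith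
  qed
  have B_uc: "uniformly_continuous_on UNIV ?B"
  proof -
    have "(4 * C\<^sup>2)-lipschitz_on UNIV ?B"
      by (rule lipschitz_onI) (use B_lip in \<open>auto simp: dist_norm\<close>)
    then show ?thesis by (rule lipschitz_on_uniformly_continuous)
  qed
  have "almost_tangent e e ?B" if e: "e > 0" for e
  proof -
    \<comment> \<open>\<open>\<psi> (- s)\<close> has Lipschitz constant
      \<open>C * s^2 + 1 + s * C \<le> 3 * C\<close>, and the conjugation lemma takes a single
      constant.\<close>
    define M where "M = 3 * C"
    have M: "M \<ge> 1" "C \<le> M" using C by (auto simp: M_def)
    have MM: "M\<^sup>2 \<le> M^3" "1 \<le> M\<^sup>2" "1 \<le> M^3" using M by (auto intro: power_increasing)
    \<comment> \<open>The number 50 covers both sums below: 1 + 7 + 7 for the Lipschitz part and 1 +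
      21 + 3 + 21 + 1 for the derivative error.\<close>
    define s where "s = min 1 (e / (50 * M^3))"
    have s: "0 < s" "s \<le> 1" "50 * M^3 * s \<le> e"
    proof -
      show "0 < s" "s \<le> 1" using e M by (auto simp: s_def)
      have "s \<le> e / (50 * M^3)" by (simp add: s_def)
      then show "50 * M^3 * s \<le> e" using M by (simp add: field_simps)
    qed
    have up: "t \<le> M * q" if "t \<le> C * q" "q \<ge> 0" for t q
      using order_trans[OF that(1) mult_right_mono[OF M(2) that(2)]] .
    have lip': "norm (\<psi> (- s) x - \<psi> (- s) y) \<le> M * norm (x - y)" for x y
    proof -
      have "\<psi> (- s) x - \<psi> (- s) y = ((\<psi> (- s) x - x - (- s) *\<^sub>R Y x) - (\<psi> (- s) y - y - (- s) *\<^sub>R Y y)) + (x - y) + (- s) *\<^sub>R (Y x - Y y)"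
        by (simp add: algebra_simps)
      then have "norm (\<psi> (- s) x - \<psi> (- s) y) \<le> C * (- s)\<^sup>2 * norm (x - y) + norm (x - y) + s * norm (Y x - Y y)"
        using s by (simp only:) (intro norm_triangle_mono \<psi>(4); simp)
      also have "\<dots> \<le> C * norm (x - y) + C * norm (x - y) + C * norm (x - y)"
      proof (intro add_mono)
        have "C * (- s)\<^sup>2 \<le> C * 1" using C s by (intro mult_left_mono) (auto simp: power_le_one)
        then show "C * (- s)\<^sup>2 * norm (x - y) \<le> C * norm (x - y)" by (simp add: mult_right_mono)
        show "norm (x - y) \<le> C * norm (x - y)" using C mult_right_mono[of 1 C "norm (x - y)"] by simp
        have "s * norm (Y x - Y y) \<le> 1 * norm (Y x - Y y)" using s by (intro mult_right_mono) auto
        then show "s * norm (Y x - Y y) \<le> C * norm (x - y)" using Y(2)[of x y] by simp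
      qed
      finally show ?thesis by (simp add: M_def)
    qed
    have "almost_tangent (7 * M\<^sup>2 * s) (21 * M^3 * s\<^sup>2) (\<lambda>x. X x + s *\<^sub>R ?B x)"
    proof (rule almost_tangent_conj[where \<psi> = "\<psi> s" and \<psi>' = "\<psi> (- s)" and Y = Y and C = M
          and R = "\<lambda>x. \<psi> s x - x - s *\<^sub>R Y x" and R' = "\<lambda>x. \<psi> (- s) x - x - (- s) *\<^sub>R Y x"])
      show "norm ((\<psi> s x - x - s *\<^sub>R Y x) - (\<psi> s y - y - s *\<^sub>R Y y)) \<le> M * s\<^sup>2 * norm (x - y)" for x y
        using up[of "norm ((\<psi> s x - x - s *\<^sub>R Y x) - (\<psi> s y - y - s *\<^sub>R Y y))" "s\<^sup>2 * norm (x - y)"] \<psi>(4)[of s x y] s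
        by (simp add: mult.assoc)
      show "norm (\<psi> (- s) x - x - (- s) *\<^sub>R Y x) \<le> M * s\<^sup>2" for x
        using up[OF \<psi>(3)[of "- s" x]] s by simp
      show "norm (Y x) \<le> M" "norm (X x) \<le> M" for x
        using Y(1)[of x] X(1)[of x] M by auto
      show "almost_tangent (s\<^sup>2) (s\<^sup>2) X" using tan s unfolding tangent_def by simp
      show "norm (DY x v - DY y v) \<le> M * norm (x - y) * norm v" for x y v
        using up[of _ "norm (x - y) * norm v"] Y(6)[of x v y] by (simp add: mult.assoc)
    qed (use s M \<psi> lip' Y X up in \<open>auto intro: up\<close>)
    moreover have "norm (X x + s *\<^sub>R ?B x) \<le> 3 * M\<^sup>2" for x
    proof -
      have "norm (X x + s *\<^sub>R ?B x) \<le> norm (X x) + s * norm (?B x)"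
        using s norm_triangle_ineq[of "X x" "s *\<^sub>R ?B x"] by simp
      also have "\<dots> \<le> C + 1 * (2 * C\<^sup>2)" using s C by (intro add_mono mult_mono X(1) B_bound) auto
      also have "\<dots> \<le> 3 * C\<^sup>2" using C by (simp add: power2_eq_square)
      also have "\<dots> \<le> 3 * M\<^sup>2" using C M by (intro mult_left_mono power_mono) auto
      finally show ?thesis .
    qed
    moreover have "tangent (\<lambda>x. - X x)" using tangent_scale[OF tan, of "-1"] by simp
    ultimately have "almost_tangent (s\<^sup>2 + 7 * M\<^sup>2 * s + s\<^sup>2 * (7 * M\<^sup>2 * s))
        (s\<^sup>2 + 21 * M^3 * s\<^sup>2 + s\<^sup>2 * (3 * M\<^sup>2 + 21 * M^3 * s\<^sup>2) + s\<^sup>2) (\<lambda>x. - X x + (X x + s *\<^sub>R ?B x))"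
      using s M by (intro almost_tangent_add) (auto simp: tangent_def)
    then have *: "almost_tangent (50 * M^3 * s) (50 * M^3 * s\<^sup>2) (\<lambda>x. s *\<^sub>R ?B x)"
      unfolding add.assoc[symmetric] left_minus add_0_left
    proof (rule almost_tangent_mono)
      have s2: "s\<^sup>2 \<le> s" "s\<^sup>2 \<le> 1" using s by (auto simp: power2_eq_square mult_le_one mult_left_le)
      have le1: "s\<^sup>2 * q \<le> q" if "q \<ge> 0" for q
        using mult_right_mono[OF s2(2) that] by simp
      have le: "a * q \<le> b * M^3 * q" if "a \<le> b * M^3" "q \<ge> 0" for a b q
        using mult_right_mono[OF that] by simp
      have "s\<^sup>2 \<le> 1 * M^3 * s" using order_trans[OF s2(1), of "1 * M^3 * s"] le[of 1 1 s] MM s by simp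
      moreover have "7 * M\<^sup>2 * s \<le> 7 * M^3 * s" using le[of "7 * M\<^sup>2" 7 s] MM s by simp
      moreover have "s\<^sup>2 * (7 * M\<^sup>2 * s) \<le> 7 * M^3 * s"
        by (rule order_trans[OF le1 calculation(2)]) (use s in simp)
      moreover have "M^3 * s \<ge> 0" using M s by simp
      ultimately show "s\<^sup>2 + 7 * M\<^sup>2 * s + s\<^sup>2 * (7 * M\<^sup>2 * s) \<le> 50 * M^3 * s" by linarith
      have "s\<^sup>2 \<le> 1 * M^3 * s\<^sup>2" using le[of 1 1 "s\<^sup>2"] MM by simp
      moreover have "s\<^sup>2 * (3 * M\<^sup>2) \<le> 3 * M^3 * s\<^sup>2" using le[of "3 * M\<^sup>2" 3 "s\<^sup>2"] MM by (simp add: mult.commute)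
      moreover have "s\<^sup>2 * (21 * M^3 * s\<^sup>2) \<le> 21 * M^3 * s\<^sup>2"
        by (rule le1) (use M in simp)
      moreover have "M^3 * s\<^sup>2 \<ge> 0" using M by simp
      ultimately show "s\<^sup>2 + 21 * M^3 * s\<^sup>2 + s\<^sup>2 * (3 * M\<^sup>2 + 21 * M^3 * s\<^sup>2) + s\<^sup>2 \<le> 50 * M^3 * s\<^sup>2"
        unfolding distrib_left[of "s\<^sup>2"] by linarith
    qed
    have "almost_tangent (50 * M^3 * s) (\<bar>1 / s\<bar> * (50 * M^3 * s\<^sup>2)) (\<lambda>x. (1 / s) *\<^sub>R s *\<^sub>R ?B x)"
      using almost_tangent_scale[OF *, of "1 / s"] s by simp
    then have "almost_tangent (50 * M^3 * s) (50 * M^3 * s) ?B"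
      using s by (simp add: power2_eq_square mult.assoc)
    then show ?thesis by (rule almost_tangent_mono) (use s in auto)
  qed
  moreover have "bounded (range ?B)" using B_bound unfolding bounded_iff by auto
  ultimately show ?thesis using B_uc unfolding tangent_def by blast
qed

section \<open>Families with several parameters\<close>

lemma sum_list_field_bound:
  assumes "\<And>a. a \<in> set L \<Longrightarrow> tangent (Z a)"
  shows "\<exists>B\<ge>0. \<forall>s M x. M \<ge> 0 \<longrightarrow> (\<forall>a\<in>set L. \<bar>s a\<bar> \<le> M) \<longrightarrow> norm (\<Sum>a\<leftarrow>L. s a *\<^sub>R Z a x) \<le> B * M"
  using assms
proof (induction L)
  case Nil
  then show ?case by (intro exI[of _ 0]) auto
next
  case (Cons a L)
  then obtain B where B: "B \<ge> 0" "\<And>s M x. M \<ge> 0 \<Longrightarrow> (\<forall>a\<in>set L. \<bar>s a\<bar> \<le> M) \<Longrightarrow> norm (\<Sum>a\<leftarrow>L. s a *\<^sub>R Z a x) \<le> B * M"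
    by auto
  obtain K where K: "K > 0" "\<And>x. norm (Z a x) \<le> K" using Cons.prems[of a] unfolding tangent_def bounded_pos by auto
  have "norm (\<Sum>a\<leftarrow>a # L. s a *\<^sub>R Z a x) \<le> (K + B) * M" if M: "M \<ge> 0" "\<forall>a\<in>set (a # L). \<bar>s a\<bar> \<le> M" for s M x
  proof -
    have "norm (s a *\<^sub>R Z a x) \<le> M * K" unfolding norm_scaleR using M K by (intro mult_mono) auto
    moreover have "norm (\<Sum>a\<leftarrow>L. s a *\<^sub>R Z a x) \<le> B * M" using B(2)[of M s x] M by simp
    ultimately show ?thesis
      using norm_triangle_ineq[of "s a *\<^sub>R Z a x" "\<Sum>a\<leftarrow>L. s a *\<^sub>R Z a x"] by (simp add: algebra_simps)
  qed
  then show ?case using K(1) B(1) by (intro exI[of _ "K + B"]) auto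
qed

text \<open>An approximate strict derivative in the maximum norm over the list: \<open>M\<close>
  stands for the distance of \<open>s\<close> and \<open>s'\<close> there. A list fixes the order of
  composition, which matters since the maps need not commute.\<close>

definition parameter_family ::
  "real \<Rightarrow> 'b list \<Rightarrow> ('b \<Rightarrow> 'a \<Rightarrow> 'a) \<Rightarrow> real \<Rightarrow> (('b \<Rightarrow> real) \<Rightarrow> 'a \<Rightarrow> 'a) \<Rightarrow> bool" where
  "parameter_family e L Z d \<Psi> \<longleftrightarrow> (\<forall>s. (\<forall>a\<in>set L. \<bar>s a\<bar> \<le> d) \<longrightarrow> \<Psi> s \<in> G) \<and> (\<forall>x. \<Psi> (\<lambda>a. 0) x = x) \<and>
     (\<forall>s s' M x. M \<ge> 0 \<longrightarrow> (\<forall>a\<in>set L. \<bar>s a\<bar> \<le> d \<and> \<bar>s' a\<bar> \<le> d \<and> \<bar>s a - s' a\<bar> \<le> M) \<longrightarrow>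
        norm (\<Psi> s x - \<Psi> s' x - (\<Sum>a\<leftarrow>L. (s a - s' a) *\<^sub>R Z a x)) \<le> e * M)"

lemma parameter_familyD:
  assumes "parameter_family e L Z d \<Psi>"
  shows "(\<forall>a\<in>set L. \<bar>s a\<bar> \<le> d) \<Longrightarrow> \<Psi> s \<in> G" "\<Psi> (\<lambda>a. 0) x = x"
    "M \<ge> 0 \<Longrightarrow> (\<forall>a\<in>set L. \<bar>s a\<bar> \<le> d \<and> \<bar>s' a\<bar> \<le> d \<and> \<bar>s a - s' a\<bar> \<le> M) \<Longrightarrow>
        norm (\<Psi> s x - \<Psi> s' x - (\<Sum>a\<leftarrow>L. (s a - s' a) *\<^sub>R Z a x)) \<le> e * M"
  using assms unfolding parameter_family_def by simp_all

text \<open>One factor \<open>\<Phi> (s a)\<close> is added at a time, and a quarter of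
  \<open>e\<close> is spent on each of four errors: inserting the inner family into
  \<open>\<Phi>\<close>, the inner family itself, the error of \<open>\<Phi>\<close>, and evaluating
  \<open>Z a\<close> at the moved point.\<close>

lemma parameter_family_exists:
  assumes "\<And>a. a \<in> set L \<Longrightarrow> tangent (Z a)" "e > 0"
  shows "\<exists>d>0. \<exists>\<Psi>. parameter_family e L Z d \<Psi>"
  using assms
proof (induction L arbitrary: e)
  case Nil
  have "parameter_family e [] Z 1 (\<lambda>s. id)" using Nil unfolding parameter_family_def by (auto simp: id_in)
  then show ?case using zero_less_one by blast
next
  case (Cons a L)
  obtain B where B: "B \<ge> 0" "\<And>s M x. M \<ge> 0 \<Longrightarrow> (\<forall>a\<in>set L. \<bar>s a\<bar> \<le> M) \<Longrightarrow> norm (\<Sum>a\<leftarrow>L. s a *\<^sub>R Z a x) \<le> B * M"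
    using sum_list_field_bound[of L Z] Cons.prems(1) by auto
  have e4: "e / 4 > 0" using Cons.prems by simp
  obtain d1 \<Psi> where d1: "d1 > 0" and \<Psi>: "parameter_family (e / 4) L Z d1 \<Psi>"
    using Cons.IH[OF Cons.prems(1)[OF list.set_intros(2)] e4] by blast
  note d1 = d1 parameter_familyD[OF \<Psi>]
  define C where "C = e / 4 + B"
  have C: "C > 0" using Cons.prems B by (simp add: C_def)
  define e2 where "e2 = min (e / 4) (e / (4 * C))"
  have e2: "e2 > 0" "e2 \<le> e / 4" "e2 * C \<le> e / 4"
  proof -
    show "e2 > 0" "e2 \<le> e / 4" using Cons.prems C by (auto simp: e2_def)
    have "e2 \<le> e / (4 * C)" by (simp add: e2_def)
    then show "e2 * C \<le> e / 4" using C by (simp add: field_simps)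
  qed
  obtain d2 \<Phi> where d2: "d2 > 0" "tangent_family e2 e2 (Z a) d2 \<Phi>"
    using Cons.prems(1)[of a] e2(1) unfolding tangent_def almost_tangent_def by auto
  note F = tangent_familyD[OF d2(2)]
  have "uniformly_continuous_on UNIV (Z a)" using Cons.prems(1)[of a] unfolding tangent_def by simp
  then obtain \<eta> where "\<eta> > 0" and "\<forall>u\<in>UNIV. \<forall>v\<in>UNIV. dist v u < \<eta> \<longrightarrow> dist (Z a v) (Z a u) < e / 4"
    using e4 unfolding uniformly_continuous_on_def by (elim allE[of _ "e / 4"] impE exE conjE) (assumption, rule that)
  then have \<eta>: "\<eta> > 0" "\<And>u v. norm (v - u) < \<eta> \<Longrightarrow> norm (Z a v - Z a u) \<le> e / 4"
    by (simp_all add: dist_norm less_imp_le)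
  define d where "d = min (min d1 d2) (\<eta> / (2 * C))"
  have d: "d > 0" "d \<le> d1" "d \<le> d2" "C * d < \<eta>"
  proof -
    show "d > 0" "d \<le> d1" "d \<le> d2" using d1(1) d2(1) \<eta>(1) C by (auto simp: d_def)
    have "d \<le> \<eta> / (2 * C)" by (simp add: d_def)
    then have "C * d \<le> \<eta> / 2" using C by (simp add: field_simps)
    then show "C * d < \<eta>" using \<eta>(1) by simp
  qed
  have disp: "norm (\<Psi> s x - \<Psi> s' x) \<le> C * M"
    if "M \<ge> 0" "\<forall>a\<in>set L. \<bar>s a\<bar> \<le> d1 \<and> \<bar>s' a\<bar> \<le> d1 \<and> \<bar>s a - s' a\<bar> \<le> M" for s s' M x
  proof -
    have "norm (\<Sum>a\<leftarrow>L. (s a - s' a) *\<^sub>R Z a x) \<le> B * M" using B(2)[of M "\<lambda>a. s a - s' a"] that by blast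
    then show ?thesis
      using d1(4)[OF that, of x] norm_triangle_sub[of "\<Psi> s x - \<Psi> s' x" "\<Sum>a\<leftarrow>L. (s a - s' a) *\<^sub>R Z a x"]
      by (simp add: C_def algebra_simps)
  qed
  have "parameter_family e (a # L) Z d (\<lambda>s. \<Phi> (s a) \<circ> \<Psi> s)"
    unfolding parameter_family_def
  proof (intro conjI allI impI)
    fix s assume "\<forall>b\<in>set (a # L). \<bar>s b\<bar> \<le> d"
    then show "\<Phi> (s a) \<circ> \<Psi> s \<in> G" using d by (intro comp_in F(1) d1(2)) auto
  next
    fix x show "(\<Phi> 0 \<circ> \<Psi> (\<lambda>a. 0)) x = x" using F(2) d1(3) by simp
  next
    fix s s' :: "'b \<Rightarrow> real" and M x
    assume M: "0 \<le> M" and s: "\<forall>b\<in>set (a # L). \<bar>s b\<bar> \<le> d \<and> \<bar>s' b\<bar> \<le> d \<and> \<bar>s b - s' b\<bar> \<le> M"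
    define u v D where "u = \<Psi> s x" and "v = \<Psi> s' x" and "D = s a - s' a"
    have sL: "\<forall>b\<in>set L. \<bar>s b\<bar> \<le> d1 \<and> \<bar>s' b\<bar> \<le> d1 \<and> \<bar>s b - s' b\<bar> \<le> M" using s d by force
    have sa: "\<bar>s a\<bar> \<le> d2" "\<bar>s' a\<bar> \<le> d2" "\<bar>D\<bar> \<le> M" using s d by (auto simp: D_def)
    have uv: "norm (u - v) \<le> C * M" unfolding u_def v_def by (rule disp[OF M sL])
    have "norm (\<Psi> s' x - \<Psi> (\<lambda>a. 0) x) \<le> C * d" by (rule disp) (use s d in force)+
    then have "norm (v - x) < \<eta>" using d(4) d1(3) by (simp add: v_def)
    then have 4: "norm (D *\<^sub>R (Z a v - Z a x)) \<le> M * (e / 4)"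
      unfolding norm_scaleR using \<eta>(2) sa(3) by (intro mult_mono) auto
    have 1: "norm ((\<Phi> (s a) u - u) - (\<Phi> (s a) v - v)) \<le> e / 4 * M"
    proof -
      have "norm ((\<Phi> (s a) u - u) - (\<Phi> (s a) v - v)) \<le> e2 * norm (u - v)" by (rule F(3)[OF sa(1)])
      also have "\<dots> \<le> e2 * (C * M)" using uv e2 by (intro mult_left_mono) auto
      also have "\<dots> = (e2 * C) * M" by simp
      also have "\<dots> \<le> e / 4 * M" using e2(3) M by (rule mult_right_mono)
      finally show ?thesis .
    qed
    have 3: "norm (\<Phi> (s a) v - \<Phi> (s' a) v - D *\<^sub>R Z a v) \<le> e / 4 * M"
    proof -
      have "norm (\<Phi> (s a) v - \<Phi> (s' a) v - D *\<^sub>R Z a v) \<le> e2 * \<bar>D\<bar>" unfolding D_def by (rule F(4)[OF sa(1,2)])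
      also have "\<dots> \<le> e / 4 * M" using e2 sa(3) by (intro mult_mono) auto
      finally show ?thesis .
    qed
    have 2: "norm (u - v - (\<Sum>a\<leftarrow>L. (s a - s' a) *\<^sub>R Z a x)) \<le> e / 4 * M" unfolding u_def v_def by (rule d1(4)[OF M sL])
    have "\<Phi> (s a) u - \<Phi> (s' a) v - (D *\<^sub>R Z a x + (\<Sum>a\<leftarrow>L. (s a - s' a) *\<^sub>R Z a x)) =
       ((\<Phi> (s a) u - u) - (\<Phi> (s a) v - v)) + (u - v - (\<Sum>a\<leftarrow>L. (s a - s' a) *\<^sub>R Z a x))
        + (\<Phi> (s a) v - \<Phi> (s' a) v - D *\<^sub>R Z a v) + D *\<^sub>R (Z a v - Z a x)"
      by (simp add: algebra_simps)
    then have "norm (\<Phi> (s a) u - \<Phi> (s' a) v - (D *\<^sub>R Z a x + (\<Sum>a\<leftarrow>L. (s a - s' a) *\<^sub>R Z a x)))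
       \<le> e / 4 * M + e / 4 * M + e / 4 * M + M * (e / 4)"
      by (simp only:) (intro norm_triangle_mono 1 2 3 4)
    then show "norm ((\<Phi> (s a) \<circ> \<Psi> s) x - (\<Phi> (s' a) \<circ> \<Psi> s') x - (\<Sum>a\<leftarrow>a # L. (s a - s' a) *\<^sub>R Z a x)) \<le> e * M"
      by (simp add: u_def v_def D_def mult.commute[of M])
  qed
  then show ?case using d(1) by blast
qed

end

section \<open>Attainable maps\<close>

text \<open>Putting v = w u turns u' = sin (w u) into v' = w sin v, whence the time
  \<open>w * s\<close>. The displacement is taken instead of the map so that it can be handed to
  \<open>push\<close>.\<close>

definition sine_flow_shift :: "real \<Rightarrow> real \<Rightarrow> real \<Rightarrow> real" where
  "sine_flow_shift w s u = sine_flow (w * s) (w * u) / w - u"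

definition push :: "'d \<Rightarrow> (real ^ 'd \<Rightarrow> real) \<Rightarrow> real ^ 'd \<Rightarrow> real ^ ('d::finite)" where
  "push l a \<phi> = \<phi> + a \<phi> *\<^sub>R axis l 1"

text \<open>These maps act on the universal covering. In the shear the summand of the angle
  \<open>l\<close> itself is left out: the velocity of that angle is then constant along a
  trajectory, and the flow is explicit. In dimension one the sum is empty and the shear is the
  identity.\<close>

inductive_set attainable :: "(real ^ ('d::finite) \<Rightarrow> real ^ 'd) set" where
  translation: "(\<lambda>\<phi>. \<phi> + b) \<in> attainable"
| sine: "w \<in> {1, 2} \<Longrightarrow> push l (\<lambda>\<phi>. sine_flow_shift w s (\<phi> $ l)) \<in> attainable"
| shear: "push l (\<lambda>\<phi>. s * (\<Sum>j\<in>- {l}. sin (\<phi> $ j))) \<in> attainable"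
| comp: "F \<in> attainable \<Longrightarrow> H \<in> attainable \<Longrightarrow> F \<circ> H \<in> attainable"

lemma push_nth: "push l a \<phi> $ i = \<phi> $ i + (if i = l then a \<phi> else 0)"
  by (simp add: push_def axis_def)

lemma id_attainable: "(id :: real ^ ('d::finite) \<Rightarrow> real ^ 'd) \<in> attainable"
proof -
  have eq: "id = (\<lambda>\<phi>. \<phi> + 0 :: real ^ 'd)" by (rule ext) simp
  show ?thesis unfolding eq by (rule attainable.translation)
qed

interpretation att: map_monoid attainable
  by unfold_locales (auto intro: id_attainable attainable.comp)

lemma sine_flow_shift_inverse:
  assumes "w \<noteq> 0"
  shows "sine_flow_shift w (- s) u + sine_flow_shift w s (u + sine_flow_shift w (- s) u) = 0"
  using assms sine_flow_inverse[of "w * s" "w * u"] by (simp add: sine_flow_shift_def)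

lemma attainable_inverse:
  fixes F :: "real ^ ('d::finite) \<Rightarrow> real ^ 'd"
  assumes "F \<in> attainable"
  shows "\<exists>H\<in>attainable. (\<forall>x. F (H x) = x) \<and> (\<forall>x. H (F x) = x)"
  using assms
proof induction
  case (translation b)
  have "(\<lambda>\<phi>. \<phi> + - b) \<in> attainable" by (rule attainable.translation)
  then show ?case by (rule rev_bexI) simp
next
  case (sine w l s)
  have *: "push l (\<lambda>\<phi>. sine_flow_shift w s (\<phi> $ l)) (push l (\<lambda>\<phi>. sine_flow_shift w (- s) (\<phi> $ l)) x) = x" for s and x :: "real ^ 'd"
    using sine_flow_shift_inverse[of w s "x $ l"] sine by (simp add: vec_eq_iff push_nth) auto
  from sine have "push l (\<lambda>\<phi>. sine_flow_shift w (- s) (\<phi> $ l)) \<in> attainable" by (rule attainable.sine)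
  then show ?case using *[of s] *[of "- s", unfolded minus_minus] by blast
next
  case (shear l s)
  have *: "push l (\<lambda>\<phi>. s * (\<Sum>j\<in>- {l}. sin (\<phi> $ j))) (push l (\<lambda>\<phi>. - s * (\<Sum>j\<in>- {l}. sin (\<phi> $ j))) x) = x" for s and x :: "real ^ 'd"
    by (simp add: vec_eq_iff push_nth)
  have "push l (\<lambda>\<phi>. - s * (\<Sum>j\<in>- {l}. sin (\<phi> $ j))) \<in> attainable" by (rule attainable.shear)
  then show ?case using *[of s] *[of "- s", unfolded minus_minus] by blast
next
  case (comp F H)
  then obtain F' H' where "F' \<in> attainable" "\<forall>x. F (F' x) = x" "\<forall>x. F' (F x) = x"
     "H' \<in> attainable" "\<forall>x. H (H' x) = x" "\<forall>x. H' (H x) = x" by auto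
  then have "H' \<circ> F' \<in> attainable" "\<forall>x. (F \<circ> H) ((H' \<circ> F') x) = x" "\<forall>x. (H' \<circ> F') ((F \<circ> H) x) = x"
    by (auto intro: attainable.comp)
  then show ?case by blast
qed

text \<open>Conjugating by the half turn of the angle \<open>j\<close> changes the sign of one summand only.\<close>

lemma attainable_shear_single:
  fixes j l :: "'d::finite"
  assumes "j \<noteq> l"
  shows "push l (\<lambda>\<phi>. s * sin (\<phi> $ j)) \<in> attainable"
proof -
  let ?S = "\<lambda>s. push l (\<lambda>\<phi>. s * (\<Sum>i\<in>- {l}. sin (\<phi> $ i))) :: real ^ 'd \<Rightarrow> real ^ 'd"
  let ?T = "\<lambda>b. (\<lambda>\<phi>. \<phi> + b) :: real ^ 'd \<Rightarrow> real ^ 'd"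
  have "?S (s / 2) \<circ> (?T (- axis j pi) \<circ> (?S (- s / 2) \<circ> ?T (axis j pi))) \<in> attainable"
    by (intro attainable.comp attainable.shear attainable.translation)
  also have "?S (s / 2) \<circ> (?T (- axis j pi) \<circ> (?S (- s / 2) \<circ> ?T (axis j pi))) = push l (\<lambda>\<phi>. s * sin (\<phi> $ j))"
  proof
    fix \<phi> :: "real ^ 'd"
    have split: "(\<Sum>i\<in>- {l}. f i) = f j + (\<Sum>i\<in>- {l} - {j}. f i)" for f :: "'d \<Rightarrow> real"
      using assms by (intro sum.remove) auto
    have "(\<Sum>i\<in>- {l} - {j}. sin ((\<phi> + axis j pi) $ i)) = (\<Sum>i\<in>- {l} - {j}. sin (\<phi> $ i))"
      by (intro sum.cong) (auto simp: axis_def)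
    then have 1: "(\<Sum>i\<in>- {l}. sin ((\<phi> + axis j pi) $ i)) = - sin (\<phi> $ j) + (\<Sum>i\<in>- {l} - {j}. sin (\<phi> $ i))"
      unfolding split by (simp add: axis_def)
    let ?\<psi> = "(?T (- axis j pi) \<circ> (?S (- s / 2) \<circ> ?T (axis j pi))) \<phi>"
    have \<psi>: "?\<psi> $ i = \<phi> $ i + (if i = l then - s / 2 * (\<Sum>i\<in>- {l}. sin ((\<phi> + axis j pi) $ i)) else 0)" for i
      by (simp add: push_nth del: vector_add_component) (simp add: axis_def)
    have "(\<Sum>i\<in>- {l}. sin (?\<psi> $ i)) = (\<Sum>i\<in>- {l}. sin (\<phi> $ i))"
    proof (intro sum.cong refl)
      fix i assume "i \<in> - {l}"
      then show "sin (?\<psi> $ i) = sin (\<phi> $ i)" unfolding \<psi> by simp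
    qed
    then show "(?S (s / 2) \<circ> (?T (- axis j pi) \<circ> (?S (- s / 2) \<circ> ?T (axis j pi)))) \<phi> = push l (\<lambda>\<phi>. s * sin (\<phi> $ j)) \<phi>"
      unfolding o_def[of "?S (s / 2)"] vec_eq_iff
      using 1 split[of "\<lambda>i. sin (\<phi> $ i)"] by (simp only: push_nth \<psi>) (simp add: algebra_simps)
  qed
  finally show ?thesis .
qed

text \<open>Common form of the two kinds of displacement, the sine flows of frequency
  \<open>w\<close> and the shears by a single sine (\<open>w = 1\<close>), so that tangency is
  proved once for both.\<close>

definition sine_push :: "real \<Rightarrow> (real \<Rightarrow> real \<Rightarrow> real) \<Rightarrow> bool" where
  "sine_push w D \<longleftrightarrow> (\<forall>u. D 0 u = 0) \<and> (\<forall>h d u v. \<bar>w * h\<bar> \<le> d \<longrightarrow> d \<le> 1 \<longrightarrow> \<bar>D h u - D h v\<bar> \<le> 3 * d * \<bar>u - v\<bar>) \<and>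
     (\<forall>h k d u. \<bar>w * h\<bar> \<le> d \<longrightarrow> \<bar>w * k\<bar> \<le> d \<longrightarrow> d \<le> 1 \<longrightarrow> \<bar>D h u - D k u - (h - k) * sin (w * u)\<bar> \<le> d * \<bar>h - k\<bar>)"

lemma sine_push_sine_flow_shift:
  assumes "w > 0"
  shows "sine_push w (sine_flow_shift w)"
  unfolding sine_push_def
proof (intro conjI allI impI)
  fix h d u v assume h: "\<bar>w * h\<bar> \<le> d" "d \<le> 1"
  have "w * \<bar>sine_flow_shift w h u - sine_flow_shift w h v\<bar> = \<bar>w * (sine_flow_shift w h u - sine_flow_shift w h v)\<bar>"
    using assms by (simp add: abs_mult)
  also have "w * (sine_flow_shift w h u - sine_flow_shift w h v) =
     (sine_flow (w * h) (w * u) - w * u) - (sine_flow (w * h) (w * v) - w * v)"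
    using assms by (simp add: sine_flow_shift_def right_diff_distrib)
  also have "\<bar>\<dots>\<bar> \<le> 3 * d * \<bar>w * u - w * v\<bar>" by (rule sine_flow_lipschitz_displacement[OF h])
  also have "\<dots> = w * (3 * d * \<bar>u - v\<bar>)" using assms by (simp add: right_diff_distrib[symmetric] abs_mult)
  finally show "\<bar>sine_flow_shift w h u - sine_flow_shift w h v\<bar> \<le> 3 * d * \<bar>u - v\<bar>" using assms by simp
next
  fix h k d u assume h: "\<bar>w * h\<bar> \<le> d" and k: "\<bar>w * k\<bar> \<le> d"
  let ?t = "sine_flow_shift w h u - sine_flow_shift w k u - (h - k) * sin (w * u)"
  have "w * \<bar>?t\<bar> = \<bar>w * ?t\<bar>"
    using assms by (simp add: abs_mult)
  also have "w * ?t = sine_flow (w * h) (w * u) - sine_flow (w * k) (w * u) - (w * h - w * k) * sin (w * u)"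
    using assms by (simp add: sine_flow_shift_def right_diff_distrib left_diff_distrib)
  also have "\<bar>\<dots>\<bar> \<le> d * \<bar>w * h - w * k\<bar>" by (rule sine_flow_taylor[OF h k])
  also have "\<dots> = w * (d * \<bar>h - k\<bar>)" using assms by (simp add: right_diff_distrib[symmetric] abs_mult)
  finally show "\<bar>?t\<bar> \<le> d * \<bar>h - k\<bar>" using assms by simp
qed (use assms in \<open>auto simp: sine_flow_shift_def\<close>)

lemma sine_push_shear: "sine_push 1 (\<lambda>h u. h * sin u)"
  unfolding sine_push_def
proof (intro conjI allI impI)
  fix h d u v :: real assume h: "\<bar>1 * h\<bar> \<le> d"
  have "\<bar>h * sin u - h * sin v\<bar> = \<bar>h\<bar> * \<bar>sin u - sin v\<bar>" by (simp add: right_diff_distrib[symmetric] abs_mult)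
  also have "\<dots> \<le> d * \<bar>u - v\<bar>" using h by (intro mult_mono abs_sin_diff_le) auto
  also have "\<dots> \<le> 3 * d * \<bar>u - v\<bar>" using h by (intro mult_right_mono) auto
  finally show "\<bar>h * sin u - h * sin v\<bar> \<le> 3 * d * \<bar>u - v\<bar>" .
qed (auto simp: algebra_simps)

lemma norm_scaleR_axis [simp]: "norm (c *\<^sub>R axis l (1::real)) = \<bar>c\<bar>"
  by (simp add: norm_axis_1)

lemma uniformly_continuous_if_lipschitz:
  fixes f :: "'a::real_normed_vector \<Rightarrow> 'b::real_normed_vector"
  assumes "\<And>x y. norm (f x - f y) \<le> L * norm (x - y)" "L \<ge> 0"
  shows "uniformly_continuous_on UNIV f"
  using lipschitz_on_uniformly_continuous[OF lipschitz_onI[of UNIV f L]] assms by (simp add: dist_norm)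

text \<open>The map pushes the angle \<open>l\<close> by an amount that depends on the angle
  \<open>j\<close>: a sine flow if \<open>j = l\<close>, a shear otherwise. Restricting
  \<open>h\<close> to \<open>d / w\<close> with \<open>3 * d \<le> e\<close> meets both
  tolerances.\<close>

lemma tangent_sine_push:
  fixes j l :: "'d::finite"
  assumes D: "sine_push w D" and att: "\<And>h. push l (\<lambda>\<phi>. D h (\<phi> $ j)) \<in> attainable" and w: "w > 0"
  shows "att.tangent (\<lambda>\<phi>. sin (w * \<phi> $ j) *\<^sub>R axis l 1)"
  unfolding att.tangent_def
proof (intro conjI allI impI)
  show "bounded (range (\<lambda>\<phi>. sin (w * \<phi> $ j) *\<^sub>R axis l (1::real)))"
    unfolding bounded_iff by (intro exI[of _ 1]) auto
  show "uniformly_continuous_on UNIV (\<lambda>\<phi>. sin (w * \<phi> $ j) *\<^sub>R axis l (1::real))"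
  proof (rule uniformly_continuous_if_lipschitz[where L = w])
    fix x y :: "real ^ 'd"
    have "norm (sin (w * x $ j) *\<^sub>R axis l (1::real) - sin (w * y $ j) *\<^sub>R axis l 1) \<le> \<bar>w * x $ j - w * y $ j\<bar>"
      unfolding scaleR_left_diff_distrib[symmetric] norm_scaleR_axis by (rule abs_sin_diff_le)
    also have "\<dots> = w * \<bar>(x - y) $ j\<bar>" using w by (simp add: right_diff_distrib[symmetric] abs_mult)
    also have "\<dots> \<le> w * norm (x - y)" using w by (intro mult_left_mono component_le_norm_cart) auto
    finally show "norm (sin (w * x $ j) *\<^sub>R axis l (1::real) - sin (w * y $ j) *\<^sub>R axis l 1) \<le> w * norm (x - y)" .
  qed (use w in simp)
  fix e :: real assume e: "e > 0"
  define d where "d = min 1 (e / 3)"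
  have d: "d > 0" "d \<le> 1" "3 * d \<le> e" using e by (auto simp: d_def)
  have "att.tangent_family (3 * d) d (\<lambda>\<phi>. sin (w * \<phi> $ j) *\<^sub>R axis l 1) (d / w) (\<lambda>h. push l (\<lambda>\<phi>. D h (\<phi> $ j)))"
    unfolding att.tangent_family_def
  proof (intro conjI allI impI att)
    show "push l (\<lambda>\<phi>. D 0 (\<phi> $ j)) = id" using D unfolding sine_push_def by (auto simp: push_def)
  next
    fix h and x y :: "real ^ 'd" assume "\<bar>h\<bar> \<le> d / w"
    then have "\<bar>w * h\<bar> \<le> d" using w by (simp add: abs_mult field_simps)
    then have "\<bar>D h (x $ j) - D h (y $ j)\<bar> \<le> 3 * d * \<bar>(x - y) $ j\<bar>"
      using D d(2) unfolding sine_push_def by simp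
    also have "\<dots> \<le> 3 * d * norm (x - y)" using d by (intro mult_left_mono component_le_norm_cart) auto
    finally have 1: "\<bar>D h (x $ j) - D h (y $ j)\<bar> \<le> 3 * d * norm (x - y)" .
    have "(push l (\<lambda>\<phi>. D h (\<phi> $ j)) x - x) - (push l (\<lambda>\<phi>. D h (\<phi> $ j)) y - y) = (D h (x $ j) - D h (y $ j)) *\<^sub>R axis l 1"
      by (simp add: push_def algebra_simps)
    with 1 show "norm ((push l (\<lambda>\<phi>. D h (\<phi> $ j)) x - x) - (push l (\<lambda>\<phi>. D h (\<phi> $ j)) y - y)) \<le> 3 * d * norm (x - y)"
      by (simp only: norm_scaleR_axis)
  next
    fix h k and x :: "real ^ 'd" assume "\<bar>h\<bar> \<le> d / w" "\<bar>k\<bar> \<le> d / w"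
    then have "\<bar>w * h\<bar> \<le> d" "\<bar>w * k\<bar> \<le> d" using w by (auto simp add: abs_mult field_simps)
    then have 1: "\<bar>D h (x $ j) - D k (x $ j) - (h - k) * sin (w * x $ j)\<bar> \<le> d * \<bar>h - k\<bar>"
      using D d(2) unfolding sine_push_def by simp
    have "push l (\<lambda>\<phi>. D h (\<phi> $ j)) x - push l (\<lambda>\<phi>. D k (\<phi> $ j)) x - (h - k) *\<^sub>R sin (w * x $ j) *\<^sub>R axis l 1 =
       (D h (x $ j) - D k (x $ j) - (h - k) * sin (w * x $ j)) *\<^sub>R axis l 1"
      by (simp add: push_def algebra_simps)
    with 1 show "norm (push l (\<lambda>\<phi>. D h (\<phi> $ j)) x - push l (\<lambda>\<phi>. D k (\<phi> $ j)) x - (h - k) *\<^sub>R sin (w * x $ j) *\<^sub>R axis l 1) \<le> d * \<bar>h - k\<bar>"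
      by (simp only: norm_scaleR_axis)
  qed
  then have "att.almost_tangent (3 * d) d (\<lambda>\<phi>. sin (w * \<phi> $ j) *\<^sub>R axis l 1)"
    unfolding att.almost_tangent_def using d w by (intro exI[of _ "d / w"]) auto
  then show "att.almost_tangent e e (\<lambda>\<phi>. sin (w * \<phi> $ j) *\<^sub>R axis l 1)"
    by (rule att.almost_tangent_mono) (use d in auto)
qed

lemma tangent_const: "att.tangent (\<lambda>\<phi>. b)"
  unfolding att.tangent_def
proof (intro conjI allI impI)
  fix e :: real assume e: "e > 0"
  have "att.tangent_family e e (\<lambda>\<phi>. b) 1 (\<lambda>h \<phi>. \<phi> + h *\<^sub>R b)"
    unfolding att.tangent_family_def using e by (auto intro: attainable.translation simp: algebra_simps)
  then show "att.almost_tangent e e (\<lambda>\<phi>. b)" unfolding att.almost_tangent_def by (intro exI[of _ 1]) auto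
qed (auto simp: bounded_iff uniformly_continuous_on_const)

text \<open>Conjugating a family by a translation keeps both constants. This supplies arbitrary
  phases.\<close>

lemma tangent_shift:
  assumes "att.tangent X"
  shows "att.tangent (\<lambda>\<phi>. X (\<phi> + b))"
  unfolding att.tangent_def
proof (intro conjI allI impI)
  show "bounded (range (\<lambda>\<phi>. X (\<phi> + b)))"
    using assms unfolding att.tangent_def bounded_iff by auto
  show "uniformly_continuous_on UNIV (\<lambda>\<phi>. X (\<phi> + b))"
  proof -
    have "uniformly_continuous_on UNIV (\<lambda>\<phi>. \<phi> + b)"
      by (intro uniformly_continuous_on_add uniformly_continuous_on_id uniformly_continuous_on_const)
    moreover have "range (\<lambda>\<phi>. \<phi> + b) = UNIV" using surjI[of "\<lambda>\<phi>. \<phi> + b" "\<lambda>\<phi>. \<phi> - b"] by simp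
    ultimately show ?thesis
      using uniformly_continuous_on_compose[of UNIV "\<lambda>\<phi>. \<phi> + b" X] assms unfolding att.tangent_def by simp
  qed
  fix e :: real assume e: "e > 0"
  obtain d \<Phi> where d: "d > 0" "att.tangent_family e e X d \<Phi>"
    using assms e unfolding att.tangent_def att.almost_tangent_def by blast
  note F = att.tangent_familyD[OF d(2)]
  have "att.tangent_family e e (\<lambda>\<phi>. X (\<phi> + b)) d (\<lambda>h. (\<lambda>\<phi>. \<phi> + - b) \<circ> (\<Phi> h \<circ> (\<lambda>\<phi>. \<phi> + b)))"
    unfolding att.tangent_family_def
  proof (intro conjI allI impI)
    fix h :: real assume "\<bar>h\<bar> \<le> d"
    then show "(\<lambda>\<phi>. \<phi> + - b) \<circ> (\<Phi> h \<circ> (\<lambda>\<phi>. \<phi> + b)) \<in> attainable"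
      by (intro attainable.comp attainable.translation F(1))
  next
    fix h :: real and x y assume h: "\<bar>h\<bar> \<le> d"
    show "norm ((((\<lambda>\<phi>. \<phi> + - b) \<circ> (\<Phi> h \<circ> (\<lambda>\<phi>. \<phi> + b))) x - x) - (((\<lambda>\<phi>. \<phi> + - b) \<circ> (\<Phi> h \<circ> (\<lambda>\<phi>. \<phi> + b))) y - y)) \<le> e * norm (x - y)"
      using F(3)[OF h, of "x + b" "y + b"] by (simp add: algebra_simps)
  next
    fix h k :: real and x assume h: "\<bar>h\<bar> \<le> d" "\<bar>k\<bar> \<le> d"
    show "norm (((\<lambda>\<phi>. \<phi> + - b) \<circ> (\<Phi> h \<circ> (\<lambda>\<phi>. \<phi> + b))) x - ((\<lambda>\<phi>. \<phi> + - b) \<circ> (\<Phi> k \<circ> (\<lambda>\<phi>. \<phi> + b))) x - (h - k) *\<^sub>R X (x + b)) \<le> e * \<bar>h - k\<bar>"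
      using F(4)[OF h, of "x + b"] by simp
  qed (use F(2) in auto)
  then show "att.almost_tangent e e (\<lambda>\<phi>. X (\<phi> + b))" using d(1) unfolding att.almost_tangent_def by blast
qed

section \<open>Trigonometric fields are tangent\<close>

definition wave :: "real ^ 'd \<Rightarrow> real \<Rightarrow> real ^ ('d::finite) \<Rightarrow> real" where
  "wave n a \<phi> = cos (a + n \<bullet> \<phi>)"

definition tangent_waves :: "'d \<Rightarrow> real ^ ('d::finite) \<Rightarrow> bool" where
  "tangent_waves k n \<longleftrightarrow> (\<forall>a. att.tangent (\<lambda>\<phi>. wave n a \<phi> *\<^sub>R axis k 1))"

lemma abs_cos_diff_le: "\<bar>cos a - cos b\<bar> \<le> \<bar>a - b\<bar>" for a b :: real
  using abs_sin_diff_le[of "pi / 2 - a" "pi / 2 - b"] by (simp add: cos_sin_eq abs_minus_commute)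

lemma cos_taylor: "\<bar>cos (u + t) - cos u + t * sin u\<bar> \<le> t\<^sup>2" for t u :: real
proof -
  have "\<bar>(cos (u + t) + t * sin u) - (cos (u + 0) + 0 * sin u)\<bar> \<le> \<bar>t\<bar> * \<bar>t - 0\<bar>"
  proof (rule abs_le_of_deriv_bound[where d = "\<bar>t\<bar>" and g' = "\<lambda>r. - sin (u + r) + sin u"])
    fix r assume "\<bar>r\<bar> \<le> \<bar>t\<bar>"
    then show "\<bar>- sin (u + r) + sin u\<bar> \<le> \<bar>t\<bar>" using abs_sin_diff_le[of u "u + r"] by simp
  qed (auto intro!: derivative_eq_intros)
  then show ?thesis by (simp add: power2_eq_square abs_mult_self_eq algebra_simps)
qed

lemma sin_taylor: "\<bar>sin (u + t) - sin u - t * cos u\<bar> \<le> t\<^sup>2" for t u :: real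
  using cos_taylor[of "u - pi / 2" t] by (simp add: cos_diff sin_diff algebra_simps cos_add sin_add)

text \<open>Bracket of \<open>sin (\<phi> $ j)\<close> along \<open>l\<close> with a wave along
  \<open>k\<close>. The first summand, the derivative of the sine in direction \<open>k\<close>, is
  there only for \<open>j = k\<close>; the second differentiates the wave in direction
  \<open>l\<close>, whence the factor \<open>n $ l\<close>.\<close>

lemma tangent_wave_bracket:
  fixes k l j :: "'d::finite"
  assumes n: "tangent_waves k n"
    and D: "sine_push 1 D" "\<And>s. push l (\<lambda>\<phi>. D s (\<phi> $ j)) \<in> attainable"
      "\<And>s x. push l (\<lambda>\<phi>. D s (\<phi> $ j)) (push l (\<lambda>\<phi>. D (- s) (\<phi> $ j)) x) = x"
      "\<And>s u v. \<bar>s\<bar> \<le> 1 \<Longrightarrow> \<bar>(D s u - s * sin u) - (D s v - s * sin v)\<bar> \<le> 4 * s\<^sup>2 * \<bar>u - v\<bar>"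
  shows "att.tangent (\<lambda>\<phi>. (if j = k then cos (\<phi> $ j) * wave n a \<phi> else 0) *\<^sub>R axis l 1
      + (n $ l * sin (\<phi> $ j) * sin (a + n \<bullet> \<phi>)) *\<^sub>R axis k 1)"
proof -
  let ?Y = "\<lambda>\<phi>. sin (\<phi> $ j) *\<^sub>R axis l 1 :: real ^ 'd" and ?DY = "\<lambda>\<phi> v. (cos (\<phi> $ j) * v $ j) *\<^sub>R axis l 1 :: real ^ 'd"
  let ?X = "\<lambda>\<phi>. wave n a \<phi> *\<^sub>R axis k 1 :: real ^ 'd" and ?DX = "\<lambda>\<phi> v. (- sin (a + n \<bullet> \<phi>) * (n \<bullet> v)) *\<^sub>R axis k 1 :: real ^ 'd"
  \<comment> \<open>One constant for all hypotheses of the bracket lemma: 4 for the remainder of the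
    generator, \<open>N\<close> and \<open>N^2\<close> for the first and second derivatives of the
    wave.\<close>
  define N C where "N = norm n" and "C = 4 + N + N\<^sup>2"
  have C: "C \<ge> 4" "C \<ge> N" "C \<ge> N\<^sup>2" "N \<ge> 0" by (auto simp: C_def N_def)
  have cs: "\<bar>x $ j\<bar> \<le> norm x" "\<bar>n \<bullet> x\<bar> \<le> N * norm x" for x :: "real ^ 'd"
    unfolding N_def by (rule component_le_norm_cart Cauchy_Schwarz_ineq2)+
  have up: "t \<le> C * q" if "t \<le> c * q" "c \<le> C" "q \<ge> 0" for t c q
    using order_trans[OF that(1) mult_right_mono[OF that(2,3)]] .
  have "att.tangent (\<lambda>x. ?DY x (?X x) - ?DX x (?Y x))"
  proof (rule att.tangent_bracket[where C = C and \<psi> = "\<lambda>s. push l (\<lambda>\<phi>. D s (\<phi> $ j))"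
        and Y = ?Y and DY = ?DY and X = ?X and DX = ?DX])
    show "att.tangent ?X" using n unfolding tangent_waves_def by blast
    show "norm (?Y x) \<le> C" "norm (?X x) \<le> C" for x
      using C abs_sin_le_one[of "x $ j"] abs_cos_le_one[of "a + n \<bullet> x"] unfolding norm_scaleR_axis wave_def by linarith+
    show "linear (?DY x)" "linear (?DX x)" for x
      by (rule linearI; simp add: algebra_simps)+
    show "norm (?Y x - ?Y y) \<le> C * norm (x - y)" for x y
      unfolding scaleR_left_diff_distrib[symmetric] norm_scaleR_axis
      using up[of _ 1 "norm (x - y)"] abs_sin_diff_le[of "x $ j" "y $ j"] cs(1)[of "x - y"] C by simp
    show "norm (?X x - ?X y) \<le> C * norm (x - y)" for x y
      unfolding scaleR_left_diff_distrib[symmetric] norm_scaleR_axis wave_def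
      using up[of _ N "norm (x - y)"] abs_cos_diff_le[of "a + n \<bullet> x" "a + n \<bullet> y"] cs(2)[of "x - y"] C
      by (simp add: inner_diff_right)
    show "norm (?Y y - ?Y x - ?DY x (y - x)) \<le> C * (norm (y - x))\<^sup>2" for x y
    proof -
      have "\<bar>sin (y $ j) - sin (x $ j) - cos (x $ j) * (y - x) $ j\<bar> \<le> ((y - x) $ j)\<^sup>2"
        using sin_taylor[of "x $ j" "(y - x) $ j"] by (simp add: mult.commute)
      also have "\<dots> \<le> (norm (y - x))\<^sup>2" using cs(1)[of "y - x"] by (metis abs_norm_cancel power2_le_iff_abs_le norm_ge_zero)
      finally have "\<bar>sin (y $ j) - sin (x $ j) - cos (x $ j) * (y - x) $ j\<bar> \<le> 1 * (norm (y - x))\<^sup>2" by simp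
      then show ?thesis
        unfolding scaleR_left_diff_distrib[symmetric] norm_scaleR_axis by (rule up) (use C in auto)
    qed
    show "norm (?X y - ?X x - ?DX x (y - x)) \<le> C * (norm (y - x))\<^sup>2" for x y
    proof -
      have "\<bar>cos (a + n \<bullet> y) - cos (a + n \<bullet> x) - - sin (a + n \<bullet> x) * (n \<bullet> (y - x))\<bar> \<le> (n \<bullet> (y - x))\<^sup>2"
        using cos_taylor[of "a + n \<bullet> x" "n \<bullet> (y - x)"] by (simp add: mult.commute inner_diff_right)
      also have "\<dots> \<le> (N * norm (y - x))\<^sup>2" using cs(2)[of "y - x"] power_mono[OF cs(2)[of "y - x"], of 2] by simp
      finally have "\<bar>cos (a + n \<bullet> y) - cos (a + n \<bullet> x) - - sin (a + n \<bullet> x) * (n \<bullet> (y - x))\<bar> \<le> N\<^sup>2 * (norm (y - x))\<^sup>2"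
        by (simp add: power_mult_distrib)
      then show ?thesis
        unfolding scaleR_left_diff_distrib[symmetric] norm_scaleR_axis wave_def by (rule up) (use C in auto)
    qed
    show "norm (?DY x v) \<le> C * norm v" for x v
    proof -
      have "\<bar>cos (x $ j) * v $ j\<bar> \<le> 1 * norm v" unfolding abs_mult by (intro mult_mono cs) auto
      then show ?thesis unfolding norm_scaleR_axis by (rule up) (use C in auto)
    qed
    show "norm (?DX x v) \<le> C * norm v" for x v
    proof -
      have "\<bar>- sin (a + n \<bullet> x) * (n \<bullet> v)\<bar> \<le> 1 * (N * norm v)" unfolding abs_mult by (intro mult_mono cs) auto
      then show ?thesis unfolding norm_scaleR_axis using up[of _ N "norm v"] C by simp
    qed
    show "norm (?DY x v - ?DY y v) \<le> C * norm (x - y) * norm v" for x y v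
    proof -
      have "\<bar>(cos (x $ j) - cos (y $ j)) * v $ j\<bar> \<le> norm (x - y) * norm v"
        unfolding abs_mult using abs_cos_diff_le[of "x $ j" "y $ j"] cs(1)[of "x - y"] by (intro mult_mono cs) auto
      then show ?thesis
        unfolding scaleR_left_diff_distrib[symmetric] norm_scaleR_axis
        using up[of _ 1 "norm (x - y) * norm v"] C by (simp add: left_diff_distrib mult.assoc)
    qed
    show "norm (?DX x v - ?DX y v) \<le> C * norm (x - y) * norm v" for x y v
    proof -
      have "\<bar>sin (a + n \<bullet> y) - sin (a + n \<bullet> x)\<bar> \<le> N * norm (x - y)"
        using abs_sin_diff_le[of "a + n \<bullet> x" "a + n \<bullet> y"] cs(2)[of "x - y"]
        by (simp add: inner_diff_right abs_minus_commute)
      then have "\<bar>(sin (a + n \<bullet> y) - sin (a + n \<bullet> x)) * (n \<bullet> v)\<bar> \<le> (N * norm (x - y)) * (N * norm v)"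
        unfolding abs_mult using C by (intro mult_mono cs) auto
      then have "\<bar>- sin (a + n \<bullet> x) * (n \<bullet> v) - - sin (a + n \<bullet> y) * (n \<bullet> v)\<bar> \<le> N\<^sup>2 * (norm (x - y) * norm v)"
        by (simp add: left_diff_distrib power2_eq_square algebra_simps)
      then show ?thesis
        unfolding scaleR_left_diff_distrib[symmetric] norm_scaleR_axis mult.assoc by (rule up) (use C in auto)
    qed
  next
    fix s :: real and x assume s: "\<bar>s\<bar> \<le> 1"
    have "\<bar>D s (x $ j) - D 0 (x $ j) - (s - 0) * sin (1 * x $ j)\<bar> \<le> \<bar>s\<bar> * \<bar>s - 0\<bar>"
      using D(1) s unfolding sine_push_def by (metis abs_ge_zero abs_zero mult_1 order_refl)
    then have "\<bar>D s (x $ j) - s * sin (x $ j)\<bar> \<le> 1 * s\<^sup>2"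
      using D(1) by (simp add: sine_push_def power2_eq_square abs_mult_self_eq)
    moreover have "push l (\<lambda>\<phi>. D s (\<phi> $ j)) x - x - s *\<^sub>R ?Y x = (D s (x $ j) - s * sin (x $ j)) *\<^sub>R axis l 1"
      by (simp add: push_def algebra_simps)
    ultimately show "norm (push l (\<lambda>\<phi>. D s (\<phi> $ j)) x - x - s *\<^sub>R ?Y x) \<le> C * s\<^sup>2"
      using up[of _ 1 "s\<^sup>2"] C by (simp only: norm_scaleR_axis)
    fix y
    have "\<bar>(D s (x $ j) - s * sin (x $ j)) - (D s (y $ j) - s * sin (y $ j))\<bar> \<le> 4 * s\<^sup>2 * \<bar>(x - y) $ j\<bar>"
      using D(4)[OF s] by simp
    also have "\<dots> \<le> 4 * s\<^sup>2 * norm (x - y)" by (intro mult_left_mono cs) auto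
    finally have "\<bar>(D s (x $ j) - s * sin (x $ j)) - (D s (y $ j) - s * sin (y $ j))\<bar> \<le> 4 * (s\<^sup>2 * norm (x - y))" by simp
    moreover have "(push l (\<lambda>\<phi>. D s (\<phi> $ j)) x - x - s *\<^sub>R ?Y x) - (push l (\<lambda>\<phi>. D s (\<phi> $ j)) y - y - s *\<^sub>R ?Y y)
        = ((D s (x $ j) - s * sin (x $ j)) - (D s (y $ j) - s * sin (y $ j))) *\<^sub>R axis l 1"
      by (simp add: push_def algebra_simps)
    ultimately show "norm ((push l (\<lambda>\<phi>. D s (\<phi> $ j)) x - x - s *\<^sub>R ?Y x) - (push l (\<lambda>\<phi>. D s (\<phi> $ j)) y - y - s *\<^sub>R ?Y y)) \<le> C * s\<^sup>2 * norm (x - y)"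
      using up[of _ 4 "s\<^sup>2 * norm (x - y)"] C by (simp only: norm_scaleR_axis mult.assoc)
  qed (use C D in auto)
  moreover have "?DY x (?X x) - ?DX x (?Y x) = (if j = k then cos (x $ j) * wave n a x else 0) *\<^sub>R axis l 1
      + (n $ l * sin (x $ j) * sin (a + n \<bullet> x)) *\<^sub>R axis k 1" for x
  proof -
    have "axis k (1::real) $ j = (if j = k then 1 else 0)" by (simp add: axis_def)
    then show ?thesis by (simp add: inner_axis)
  qed
  ultimately show ?thesis by simp
qed

lemma tangent_wave_bracket_shear:
  fixes k l j :: "'d::finite"
  assumes "tangent_waves k n" "j \<noteq> l"
  shows "att.tangent (\<lambda>\<phi>. (if j = k then cos (\<phi> $ j) * wave n a \<phi> else 0) *\<^sub>R axis l 1
      + (n $ l * sin (\<phi> $ j) * sin (a + n \<bullet> \<phi>)) *\<^sub>R axis k 1)"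
  by (rule tangent_wave_bracket[where D = "\<lambda>s u. s * sin u"])
     (use assms in \<open>auto intro: sine_push_shear attainable_shear_single simp: vec_eq_iff push_nth\<close>)

lemma tangent_wave_bracket_sine:
  fixes k l :: "'d::finite"
  assumes "tangent_waves k n"
  shows "att.tangent (\<lambda>\<phi>. (if l = k then cos (\<phi> $ l) * wave n a \<phi> else 0) *\<^sub>R axis l 1
      + (n $ l * sin (\<phi> $ l) * sin (a + n \<bullet> \<phi>)) *\<^sub>R axis k 1)"
proof (rule tangent_wave_bracket[where D = "sine_flow_shift 1", OF assms])
  show "push l (\<lambda>\<phi>. sine_flow_shift 1 s (\<phi> $ l)) (push l (\<lambda>\<phi>. sine_flow_shift 1 (- s) (\<phi> $ l)) x) = x" for s x
    using sine_flow_shift_inverse[of 1 s "x $ l"] by (auto simp: vec_eq_iff push_nth)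
  show "\<bar>(sine_flow_shift 1 s u - s * sin u) - (sine_flow_shift 1 s v - s * sin v)\<bar> \<le> 4 * s\<^sup>2 * \<bar>u - v\<bar>" if "\<bar>s\<bar> \<le> 1" for s u v
    using sine_flow_remainder_lipschitz[OF that, of u v] by (simp add: sine_flow_shift_def algebra_simps)
qed (auto intro: sine_push_sine_flow_shift attainable.sine)

section \<open>Reaching every frequency vector\<close>

lemma tangent_waves_uminus: "tangent_waves k n \<Longrightarrow> tangent_waves k (- n)"
proof -
  have "wave (- n) a = wave n (- a)" for a
    by (rule ext) (metis wave_def cos_minus inner_minus_left minus_add_distrib minus_minus)
  then show "tangent_waves k n \<Longrightarrow> tangent_waves k (- n)" unfolding tangent_waves_def by simp
qed

lemma tangent_waves_0: "tangent_waves k 0"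
  unfolding tangent_waves_def by (auto simp: wave_def intro: tangent_const)

lemma tangent_waves_axis:
  assumes "att.tangent (\<lambda>\<phi>. sin (w * \<phi> $ j) *\<^sub>R axis k 1)" "w \<noteq> 0"
  shows "tangent_waves k (w *\<^sub>R axis j 1)"
  unfolding tangent_waves_def
proof
  fix a
  have "att.tangent (\<lambda>\<phi>. sin (w * (\<phi> + axis j ((a + pi / 2) / w)) $ j) *\<^sub>R axis k 1)"
    by (rule tangent_shift[OF assms(1)])
  moreover have "sin (w * (\<phi> + axis j ((a + pi / 2) / w)) $ j) = wave (w *\<^sub>R axis j 1) a \<phi>" for \<phi>
  proof -
    have "axis j ((a + pi / 2) / w) $ j = (a + pi / 2) / w" by (simp add: axis_def)
    then have "w * (\<phi> + axis j ((a + pi / 2) / w)) $ j = (a + (w *\<^sub>R axis j 1) \<bullet> \<phi>) + pi / 2"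
      using assms(2) by (simp add: inner_axis' field_simps)
    then show ?thesis unfolding wave_def by (simp only: sin_add) simp
  qed
  ultimately show "att.tangent (\<lambda>\<phi>. wave (w *\<^sub>R axis j 1) a \<phi> *\<^sub>R axis k 1)" by simp
qed

text \<open>For \<open>j \<noteq> k\<close> the bracket has a single summand, along
  \<open>k\<close>, and any \<open>l\<close> with \<open>n $ l \<noteq> 0\<close> lets its factor be
  divided out. A quarter turn of the angle \<open>j\<close> turns the product of sines into one of
  cosines; sum and difference are the waves at \<open>n - axis j 1\<close> and
  \<open>n + axis j 1\<close>.\<close>

lemma tangent_waves_neighbour:
  fixes k l j :: "'d::finite"
  assumes n: "tangent_waves k n" and jk: "j \<noteq> k" and nl: "n $ l \<noteq> 0"
  shows "tangent_waves k (n - axis j 1)" "tangent_waves k (n + axis j 1)"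
proof -
  have base: "att.tangent (\<lambda>\<phi>. (sin (\<phi> $ j) * sin (a + n \<bullet> \<phi>)) *\<^sub>R axis k 1)" for a
  proof -
    have "att.tangent (\<lambda>\<phi>. (n $ l * sin (\<phi> $ j) * sin (a + n \<bullet> \<phi>)) *\<^sub>R axis k 1)"
    proof (cases "j = l")
      case True
      then show ?thesis using tangent_wave_bracket_sine[OF n, of l a] jk by simp
    next
      case False
      then show ?thesis using tangent_wave_bracket_shear[OF n False, of a] jk by simp
    qed
    from att.tangent_scale[OF this, of "1 / n $ l"] show ?thesis using nl by simp
  qed
  have shifted: "att.tangent (\<lambda>\<phi>. (cos (\<phi> $ j) * cos (a + n \<bullet> \<phi>)) *\<^sub>R axis k 1)" for a
  proof -
    have "att.tangent (\<lambda>\<phi>. (sin ((\<phi> + axis j (pi / 2)) $ j) * sin ((a + pi / 2 - n $ j * (pi / 2)) + n \<bullet> (\<phi> + axis j (pi / 2)))) *\<^sub>R axis k 1)"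
      by (rule tangent_shift[OF base])
    moreover have "sin ((\<phi> + axis j (pi / 2)) $ j) = cos (\<phi> $ j)" for \<phi> :: "real ^ 'd"
      by (simp add: axis_def sin_add)
    moreover have "sin ((a + pi / 2 - n $ j * (pi / 2)) + n \<bullet> (\<phi> + axis j (pi / 2))) = cos (a + n \<bullet> \<phi>)" for \<phi>
    proof -
      have "(a + pi / 2 - n $ j * (pi / 2)) + n \<bullet> (\<phi> + axis j (pi / 2)) = (a + n \<bullet> \<phi>) + pi / 2"
        by (simp add: inner_add_right inner_axis)
      then show ?thesis by (simp only: sin_add) simp
    qed
    ultimately show ?thesis by simp
  qed
  have eq: "wave (n - axis j 1) a \<phi> = cos (\<phi> $ j) * cos (a + n \<bullet> \<phi>) + sin (\<phi> $ j) * sin (a + n \<bullet> \<phi>)"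
    "wave (n + axis j 1) a \<phi> = cos (\<phi> $ j) * cos (a + n \<bullet> \<phi>) - sin (\<phi> $ j) * sin (a + n \<bullet> \<phi>)" for a \<phi>
  proof -
    have 1: "a + (n - axis j 1) \<bullet> \<phi> = (a + n \<bullet> \<phi>) - \<phi> $ j" "a + (n + axis j 1) \<bullet> \<phi> = (a + n \<bullet> \<phi>) + \<phi> $ j"
      by (simp_all add: inner_diff_left inner_add_left inner_axis')
    show "wave (n - axis j 1) a \<phi> = cos (\<phi> $ j) * cos (a + n \<bullet> \<phi>) + sin (\<phi> $ j) * sin (a + n \<bullet> \<phi>)"
      "wave (n + axis j 1) a \<phi> = cos (\<phi> $ j) * cos (a + n \<bullet> \<phi>) - sin (\<phi> $ j) * sin (a + n \<bullet> \<phi>)"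
      unfolding wave_def 1 cos_diff cos_add[of _ "\<phi> $ j"] by (simp_all add: mult.commute)
  qed
  show "tangent_waves k (n - axis j 1)" "tangent_waves k (n + axis j 1)"
    unfolding tangent_waves_def eq
    using att.tangent_add[OF shifted base] att.tangent_add[OF shifted att.tangent_scale[OF base, where c = "-1"]]
    by (simp_all add: scaleR_left_distrib scaleR_left_diff_distrib)
qed

text \<open>The bracket of frequency \<open>M\<close> with the sine is \<open>(1 + M) / 2\<close>
  times frequency \<open>M - 1\<close> plus \<open>(1 - M) / 2\<close> times frequency
  \<open>M + 1\<close>. The latter coefficient vanishes at \<open>M = 1\<close>, so frequency 2 is
  taken from the generator with \<open>w = 2\<close>.\<close>

lemma tangent_waves_own_axis: "tangent_waves k (real N *\<^sub>R axis k 1)"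
proof (induction N rule: less_induct)
  case (less N)
  have base: "tangent_waves k (w *\<^sub>R axis k 1)" if "w = 1 \<or> w = 2" for w
    by (rule tangent_waves_axis, rule tangent_sine_push[where D = "sine_flow_shift w"])
       (use that in \<open>auto intro: sine_push_sine_flow_shift attainable.sine\<close>)
  consider "N = 0" | "N = 1" | "N = 2" | M where "N = M + 1" "M \<ge> 2"
    by (metis One_nat_def Suc_eq_plus1 Suc_1 less_2_cases not_less not0_implies_Suc not_less_eq_eq)
  then show ?case
  proof cases
    case 4
    let ?n = "real M *\<^sub>R axis k 1 :: real ^ 'a"
    have M: "tangent_waves k ?n" "tangent_waves k (real (M - 1) *\<^sub>R axis k 1)"
      by (rule less.IH, use 4 in simp)+
    show ?thesis
      unfolding tangent_waves_def
    proof
      fix a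
      note br = tangent_wave_bracket_sine[OF M(1), of k a, unfolded simp_thms if_True]
      have "att.tangent (\<lambda>\<phi>. (2 / (1 - real M)) *\<^sub>R (((cos (\<phi> $ k) * wave ?n a \<phi>) *\<^sub>R axis k 1
         + (?n $ k * sin (\<phi> $ k) * sin (a + ?n \<bullet> \<phi>)) *\<^sub>R axis k 1)
         + (- (1 + real M) / 2) *\<^sub>R (wave (real (M - 1) *\<^sub>R axis k 1) a \<phi> *\<^sub>R axis k 1)))"
        by (rule att.tangent_scale[OF att.tangent_add[OF br att.tangent_scale[OF M(2)[unfolded tangent_waves_def, rule_format]]]])
      moreover have "(2 / (1 - real M)) *\<^sub>R (((cos (\<phi> $ k) * wave ?n a \<phi>) *\<^sub>R axis k 1
         + (?n $ k * sin (\<phi> $ k) * sin (a + ?n \<bullet> \<phi>)) *\<^sub>R axis k 1)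
         + (- (1 + real M) / 2) *\<^sub>R (wave (real (M - 1) *\<^sub>R axis k 1) a \<phi> *\<^sub>R axis k 1))
         = wave (real N *\<^sub>R axis k 1) a \<phi> *\<^sub>R axis k (1::real)" for \<phi>
      proof -
        let ?b = "a + real M * \<phi> $ k" and ?u = "\<phi> $ k"
        have e: "a + real (M - 1) * ?u = ?b - ?u" "a + real N * ?u = ?b + ?u"
          using 4 by (auto simp: of_nat_diff algebra_simps)
        have ax: "(c *\<^sub>R axis k 1) \<bullet> \<phi> = c * ?u" for c by (simp add: inner_axis')
        have w: "wave (real (M - 1) *\<^sub>R axis k 1) a \<phi> = cos ?b * cos ?u + sin ?b * sin ?u"
            "wave (real N *\<^sub>R axis k 1) a \<phi> = cos ?b * cos ?u - sin ?b * sin ?u" "wave ?n a \<phi> = cos ?b"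
            "sin (a + ?n \<bullet> \<phi>) = sin ?b"
          unfolding wave_def ax e cos_diff cos_add[of ?b ?u] by (rule refl)+
        have nk: "?n $ k = real M" by (simp add: axis_def)
        have "2 / (1 - real M) * (cos ?u * cos ?b + real M * sin ?u * sin ?b
            + - (1 + real M) / 2 * (cos ?b * cos ?u + sin ?b * sin ?u)) = cos ?b * cos ?u - sin ?b * sin ?u"
          using 4 by (simp add: field_simps)
        then show ?thesis unfolding w nk scaleR_scaleR scaleR_left_distrib[symmetric] by simp
      qed
      ultimately show "att.tangent (\<lambda>\<phi>. wave (real N *\<^sub>R axis k 1) a \<phi> *\<^sub>R axis k 1)" by simp
    qed
  qed (use base[of 1] base[of 2] tangent_waves_0 in auto)
qed

text \<open>The start is frequency one, a shear, since each step needs a nonzero component; steps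
  are taken with \<open>j = l\<close>, where the wave itself provides it.\<close>

lemma tangent_waves_other_axis:
  assumes "l \<noteq> k"
  shows "tangent_waves k (real (Suc N) *\<^sub>R axis l 1)"
proof (induction N)
  case 0
  have "tangent_waves k (1 *\<^sub>R axis l 1)"
    by (rule tangent_waves_axis, rule tangent_sine_push[where D = "\<lambda>s u. s * sin u"])
       (use assms in \<open>auto intro: sine_push_shear attainable_shear_single\<close>)
  then show ?case by simp
next
  case (Suc N)
  have "tangent_waves k (real (Suc N) *\<^sub>R axis l 1 + axis l 1)"
    by (rule tangent_waves_neighbour(2)[OF Suc assms, of l]) (simp add: axis_def)
  then show ?case by (simp only: of_nat_Suc[of "Suc N"] scaleR_left_distrib scaleR_one add.commute)
qed

lemma tangent_waves_int_axis:
  assumes "m \<in> \<int>" "l = k \<or> m \<noteq> 0"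
  shows "tangent_waves k (m *\<^sub>R axis l 1)"
proof -
  obtain z :: int where z: "m = of_int z" using assms(1) by (auto elim: Ints_cases)
  have *: "tangent_waves k (real N *\<^sub>R axis l 1)" if "l = k \<or> N \<noteq> 0" for N
    using that tangent_waves_own_axis[of k N] tangent_waves_other_axis[of l k "N - 1"] by (cases "l = k") auto
  show ?thesis
  proof (cases "z \<ge> 0")
    case True
    then show ?thesis using *[of "nat z"] assms(2) z by simp
  next
    case False
    then have "tangent_waves k (real (nat (- z)) *\<^sub>R axis l 1)" by (intro *) auto
    from tangent_waves_uminus[OF this] show ?thesis using False z by simp
  qed
qed

text \<open>The component \<open>l\<close> stays fixed and nonzero throughout, so steps in direction
  \<open>j\<close> can be taken up and down, also through zero.\<close>

lemma tangent_waves_raise: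
  fixes k l j :: "'d::finite"
  assumes n: "tangent_waves k n" and j: "j \<noteq> k" "j \<noteq> l" and nl: "n $ l \<noteq> 0"
  shows "tangent_waves k (n + of_int z *\<^sub>R axis j 1)"
proof (induction z rule: int_induct[where k = 0])
  case (step1 i)
  have "(n + of_int i *\<^sub>R axis j 1) $ l \<noteq> 0" using nl j by (simp add: axis_def)
  then have "tangent_waves k ((n + of_int i *\<^sub>R axis j 1) + axis j 1)"
    by (rule tangent_waves_neighbour(2)[OF step1(2) j(1)])
  then show ?case by (simp add: scaleR_left_distrib add.assoc)
next
  case (step2 i)
  have "(n + of_int i *\<^sub>R axis j 1) $ l \<noteq> 0" using nl j by (simp add: axis_def)
  then have "tangent_waves k ((n + of_int i *\<^sub>R axis j 1) - axis j 1)"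
    by (rule tangent_waves_neighbour(1)[OF step2(2) j(1)])
  then show ?case by (simp add: scaleR_left_diff_distrib add_diff_eq)
qed (use n in simp)

lemma tangent_waves_fill:
  fixes k l :: "'d::finite" and p :: "real ^ 'd"
  assumes n: "tangent_waves k n" and l: "n $ l \<noteq> 0" and ints: "\<And>i. n $ i \<in> \<int>" "\<And>i. p $ i \<in> \<int>"
    and J: "k \<notin> J" "l \<notin> J"
  shows "tangent_waves k (\<chi> i. if i \<in> J then p $ i else n $ i)"
  using finite_subset[OF subset_UNIV finite, of J] J
proof (induction J rule: finite_induct)
  case empty
  then show ?case using n by simp
next
  case (insert j J)
  let ?q = "\<chi> i. if i \<in> J then p $ i else n $ i"
  obtain z where z: "p $ j - n $ j = of_int z" using ints[of j] by (metis Ints_diff Ints_cases)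
  have "tangent_waves k (?q + of_int z *\<^sub>R axis j 1)"
    using insert l by (intro tangent_waves_raise[of _ _ _ l]) auto
  moreover have "?q + of_int z *\<^sub>R axis j 1 = (\<chi> i. if i \<in> insert j J then p $ i else n $ i)"
    unfolding z[symmetric] using insert.hyps by (auto simp: vec_eq_iff axis_def)
  ultimately show ?case by simp
qed

lemma tangent_waves_all:
  fixes n :: "real ^ ('d::finite)"
  assumes ints: "\<And>i. n $ i \<in> \<int>"
  shows "tangent_waves k n"
proof (cases "n = 0")
  case False
  then obtain l0 where l0: "n $ l0 \<noteq> 0" by (auto simp: vec_eq_iff)
  \<comment> \<open>Steps in direction \<open>k\<close> are excluded, hence the component
    \<open>k\<close> must be right from the start: the axis is \<open>k\<close> whenever
    \<open>n $ k \<noteq> 0\<close>.\<close>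
  define l where "l = (if n $ k \<noteq> 0 then k else l0)"
  have l: "n $ l \<noteq> 0" "n $ k \<noteq> 0 \<Longrightarrow> l = k" using l0 by (auto simp: l_def)
  have "tangent_waves k (\<chi> i. if i \<in> - {k, l} then n $ i else (n $ l *\<^sub>R axis l 1) $ i)"
  proof (rule tangent_waves_fill)
    show "tangent_waves k (n $ l *\<^sub>R axis l 1)" using l ints by (intro tangent_waves_int_axis) auto
    show "(n $ l *\<^sub>R axis l (1::real)) $ l \<noteq> 0" using l by (simp add: axis_def)
    show "(n $ l *\<^sub>R axis l (1::real)) $ i \<in> \<int>" for i using ints[of l] by (simp add: axis_def)
    show "n $ i \<in> \<int>" for i by (rule ints)
  qed simp_all
  moreover have "(if i \<in> - {k, l} then n $ i else (n $ l *\<^sub>R axis l (1::real)) $ i) = n $ i" for i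
    using l(2) by (cases "i = l"; cases "n $ k = 0") (auto simp: axis_def)
  ultimately show ?thesis by (simp only: vec_lambda_eta)
qed (simp add: tangent_waves_0)

section \<open>Lipschitz periodic fields are tangent\<close>

definition embed :: "real ^ ('d::finite) \<Rightarrow> complex ^ 'd" where
  "embed \<phi> = (\<chi> k. cis (\<phi> $ k))"

definition periodic :: "(real ^ ('d::finite) \<Rightarrow> 'b) \<Rightarrow> bool" where
  "periodic f \<longleftrightarrow> (\<forall>n \<phi>. (\<forall>i. n $ i \<in> \<int>) \<longrightarrow> f (\<phi> + (2 * pi) *\<^sub>R n) = f \<phi>)"

section \<open>Comparing angles with points of the embedded torus\<close>

lemma cmod_cis_diff: "cmod (cis a - cis b) = 2 * \<bar>sin ((a - b) / 2)\<bar>"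
proof -
  have "(cmod (cis a - cis b))\<^sup>2 = (cos a - cos b)\<^sup>2 + (sin a - sin b)\<^sup>2" by (simp add: cmod_power2)
  also have "\<dots> = (sin a)\<^sup>2 + (cos a)\<^sup>2 + ((sin b)\<^sup>2 + (cos b)\<^sup>2) - 2 * (cos a * cos b + sin a * sin b)"
    by (simp add: power2_eq_square algebra_simps)
  also have "\<dots> = 2 - 2 * cos (a - b)" by (simp add: cos_diff)
  also have "cos (a - b) = cos (2 * ((a - b) / 2))" by (rule arg_cong[of _ _ cos]) simp
  also have "2 - 2 * cos (2 * ((a - b) / 2)) = (2 * \<bar>sin ((a - b) / 2)\<bar>)\<^sup>2"
    unfolding cos_double_sin by (simp add: power_mult_distrib)
  finally show ?thesis by (rule power2_eq_imp_eq) auto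
qed

lemma cmod_cis_diff_le: "cmod (cis a - cis b) \<le> \<bar>a - b\<bar>"
  using abs_sin_x_le_abs_x[of "(a - b) / 2"] by (simp add: cmod_cis_diff)

text \<open>With \<open>y = x / 2\<close> one has \<open>sin x = 2 * tan y * (cos y)^2\<close>,
  where \<open>y \<le> tan y\<close> and \<open>(cos y)^2 \<ge> 1 / 2\<close>.\<close>

lemma half_le_sin:
  assumes "0 \<le> x" "x \<le> pi / 2"
  shows "x / 2 \<le> sin x"
proof -
  define y where "y = x / 2"
  have y: "0 \<le> y" "y \<le> pi / 4" using assms by (auto simp: y_def)
  have cy: "cos y > 0" using y pi_gt_zero by (intro cos_gt_zero_pi) linarith+
  have "cos (pi / 4) \<le> cos y" using y pi_gt_zero by (intro cos_monotone_0_pi_le) linarith+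
  then have "(cos (pi / 4))\<^sup>2 \<le> (cos y)\<^sup>2" by (intro power_mono) (auto simp: cos_45)
  then have c2: "1 / 2 \<le> (cos y)\<^sup>2" by (simp add: cos_45 power_divide)
  have "y \<le> tan y"
    using abs_tan_ge[of y] y pi_gt_zero tan_pos_pi2_le[of y] by auto
  then have "y * cos y \<le> sin y" using cy by (simp add: tan_def field_simps)
  then have "y * cos y * cos y \<le> sin y * cos y" using cy by (intro mult_right_mono) auto
  moreover have "y * (1 / 2) \<le> y * (cos y)\<^sup>2" using c2 y by (intro mult_left_mono)
  ultimately have "y \<le> 2 * sin y * cos y" by (simp add: power2_eq_square)
  also have "\<dots> = sin x" by (simp add: y_def sin_double[symmetric])
  finally show ?thesis by (simp add: y_def)
qed

lemma cis_near:
  fixes a b :: real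
  shows "\<exists>m\<in>\<int>. \<bar>a - b - 2 * pi * m\<bar> \<le> 2 * cmod (cis a - cis b)"
proof -
  \<comment> \<open>Subtracting the nearest multiple of \<open>2 * pi\<close> brings the difference
    into \<open>[-pi, pi]\<close>, where a chord is at least half its arc.\<close>
  define z r where "z = round ((a - b) / (2 * pi))" and "r = a - b - 2 * pi * of_int z"
  have "\<bar>of_int z - (a - b) / (2 * pi)\<bar> \<le> 1 / 2" unfolding z_def by (rule of_int_round_abs_le)
  then have "2 * pi * \<bar>of_int z - (a - b) / (2 * pi)\<bar> \<le> pi" by simp
  moreover have "2 * pi * \<bar>of_int z - (a - b) / (2 * pi)\<bar> = \<bar>2 * pi * (of_int z - (a - b) / (2 * pi))\<bar>"
    by (simp add: abs_mult)
  moreover have "2 * pi * (of_int z - (a - b) / (2 * pi)) = - r" by (simp add: r_def field_simps)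
  ultimately have r: "\<bar>r\<bar> \<le> pi" by simp
  have "cis b = cis (b + 2 * pi * of_int z)" by (simp add: cis_mult[symmetric] cis_multiple_2pi)
  then have "cmod (cis a - cis b) = 2 * \<bar>sin (r / 2)\<bar>" by (simp add: cmod_cis_diff r_def diff_diff_eq)
  moreover have "\<bar>sin (r / 2)\<bar> \<ge> \<bar>r\<bar> / 4"
    using half_le_sin[of "\<bar>r\<bar> / 2"] r by (cases "r \<ge> 0") auto
  ultimately show ?thesis unfolding r_def by (intro bexI[of _ "of_int z"]) auto
qed

lemma norm_vec_le_scaled:
  fixes x :: "('a::real_normed_vector) ^ 'd" and y :: "('b::real_normed_vector) ^ ('d::finite)"
  assumes "\<And>i. norm (x $ i) \<le> c * norm (y $ i)" "c \<ge> 0"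
  shows "norm x \<le> c * norm y"
  unfolding norm_vec_def L2_set_right_distrib[OF assms(2)] by (intro L2_set_mono) (use assms in auto)

lemma norm_embed_diff_le: "norm (embed a - embed b) \<le> norm (a - b)"
  using norm_vec_le_scaled[of "embed a - embed b" 1 "a - b"] cmod_cis_diff_le by (simp add: embed_def)

text \<open>Stands in for path lifting: points close on the torus have close lifts after one lattice
  translation, with a bound linear in their distance.\<close>

lemma embed_near:
  fixes a b :: "real ^ 'd"
  shows "\<exists>n. (\<forall>i. n $ i \<in> \<int>) \<and> norm (a - b - (2 * pi) *\<^sub>R n) \<le> 2 * norm (embed a - embed b)"
proof -
  have "\<forall>i. \<exists>m\<in>\<int>. \<bar>a $ i - b $ i - 2 * pi * m\<bar> \<le> 2 * cmod (cis (a $ i) - cis (b $ i))"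
    using cis_near by blast
  then obtain m where m: "\<And>i. m i \<in> \<int>" "\<And>i. \<bar>a $ i - b $ i - 2 * pi * m i\<bar> \<le> 2 * cmod (cis (a $ i) - cis (b $ i))"
    by metis
  have "norm (a - b - (2 * pi) *\<^sub>R (\<chi> i. m i)) \<le> 2 * norm (embed a - embed b)"
    by (rule norm_vec_le_scaled) (use m in \<open>auto simp: embed_def\<close>)
  then show ?thesis using m(1) by (intro exI[of _ "\<chi> i. m i"]) auto
qed

lemma periodic_minus: "periodic f \<Longrightarrow> \<forall>i. n $ i \<in> \<int> \<Longrightarrow> f (\<phi> - (2 * pi) *\<^sub>R n) = f \<phi>"
  unfolding periodic_def by (drule spec[of _ "- n"]) (auto simp: scaleR_minus_right)

lemma embed_eq_iff: "embed a = embed b \<longleftrightarrow> (\<exists>n. (\<forall>i. n $ i \<in> \<int>) \<and> a = b + (2 * pi) *\<^sub>R n)"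
proof
  assume "embed a = embed b"
  then show "\<exists>n. (\<forall>i. n $ i \<in> \<int>) \<and> a = b + (2 * pi) *\<^sub>R n" using embed_near[of a b] by (auto simp: algebra_simps)
next
  assume "\<exists>n. (\<forall>i. n $ i \<in> \<int>) \<and> a = b + (2 * pi) *\<^sub>R n"
  then show "embed a = embed b"
    by (auto simp: embed_def vec_eq_iff cis_mult[symmetric] cis_multiple_2pi)
qed

lemma embed_fundamental_cube:
  fixes \<phi> :: "real ^ ('d::finite)"
  shows "\<exists>\<psi>\<in>cbox (\<chi> i. 0) (\<chi> i. 2 * pi). embed \<phi> = embed \<psi>"
proof -
  define \<psi> :: "real ^ 'd" where "\<psi> = (\<chi> i. 2 * pi * frac (\<phi> $ i / (2 * pi)))"
  have "\<psi> = \<phi> + (2 * pi) *\<^sub>R (\<chi> i. - of_int \<lfloor>\<phi> $ i / (2 * pi)\<rfloor>)"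
    by (simp add: vec_eq_iff \<psi>_def frac_def right_diff_distrib)
  then have "embed \<psi> = embed \<phi>" unfolding embed_eq_iff by (intro exI conjI) auto
  moreover have "frac t \<le> 1" "frac t \<ge> 0" for t :: real by (auto simp: frac_lt_1 less_imp_le)
  then have "\<psi> \<in> cbox (\<chi> i. 0) (\<chi> i. 2 * pi)" by (simp add: mem_box_cart \<psi>_def)
  ultimately show ?thesis by metis
qed

lemma periodic_embed: "periodic embed"
  unfolding periodic_def by (metis embed_eq_iff)

text \<open>Periodicity allows replacing \<open>x\<close> by a lift close to \<open>y\<close>; thus
  a Lipschitz periodic function descends to a Lipschitz function on the embedded torus.\<close>

lemma periodic_lipschitz_embed:
  assumes "periodic f" "\<And>x y. norm (f x - f y) \<le> L * norm (x - y)" "L \<ge> 0"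
  shows "norm (f x - f y) \<le> 2 * L * norm (embed x - embed y)"
proof -
  obtain n where n: "\<forall>i. n $ i \<in> \<int>" "norm (x - y - (2 * pi) *\<^sub>R n) \<le> 2 * norm (embed x - embed y)"
    using embed_near by blast
  have "norm (f x - f y) = norm (f (x - (2 * pi) *\<^sub>R n) - f y)" using periodic_minus[OF assms(1) n(1)] by simp
  also have "\<dots> \<le> L * norm (x - (2 * pi) *\<^sub>R n - y)" by (rule assms(2))
  also have "\<dots> = L * norm (x - y - (2 * pi) *\<^sub>R n)" by (simp add: algebra_simps)
  also have "\<dots> \<le> L * (2 * norm (embed x - embed y))" using n assms(3) by (intro mult_left_mono)
  finally show ?thesis by simp
qed

lemma norm_embed: "norm (embed (\<phi> :: real ^ ('d::finite))) \<le> real CARD('d)"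
proof -
  have "norm (embed \<phi>) \<le> (\<Sum>i\<in>UNIV. norm (embed \<phi> $ i))" unfolding norm_vec_def by (rule L2_set_le_sum) simp
  then show ?thesis by (simp add: embed_def)
qed

section \<open>Trigonometric polynomials and Stone-Weierstrass\<close>

inductive_set trig_polys :: "(real ^ ('d::finite) \<Rightarrow> real) set" where
  wave: "(\<And>i. n $ i \<in> \<int>) \<Longrightarrow> wave n a \<in> trig_polys"
| add: "f \<in> trig_polys \<Longrightarrow> g \<in> trig_polys \<Longrightarrow> (\<lambda>x. f x + g x) \<in> trig_polys"
| scale: "f \<in> trig_polys \<Longrightarrow> (\<lambda>x. c * f x) \<in> trig_polys"

lemma trig_polys_const: "(\<lambda>x. c) \<in> trig_polys"
proof -
  have "(\<lambda>x. c * wave 0 0 x) \<in> trig_polys" by (intro trig_polys.scale trig_polys.wave) simp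
  then show ?thesis by (simp add: wave_def)
qed

lemma trig_polys_sum: "(\<And>i. i \<in> I \<Longrightarrow> f i \<in> trig_polys) \<Longrightarrow> (\<lambda>x. \<Sum>i\<in>I. f i x) \<in> trig_polys"
  by (induction I rule: infinite_finite_induct) (auto intro: trig_polys_const trig_polys.add)

text \<open>Tangency is a linear property, while Stone-Weierstrass delivers polynomials; the
  product-to-sum formula makes products of waves linear combinations of waves again.\<close>

lemma trig_polys_mult:
  assumes "f \<in> trig_polys" "g \<in> trig_polys"
  shows "(\<lambda>x. f x * g x) \<in> trig_polys"
  using assms(1)
proof induction
  case (wave n a)
  show ?case using assms(2)
  proof induction
    case (wave m b)
    have "(\<lambda>x. (1 / 2) * (wave (n - m) (a - b) x + wave (n + m) (a + b) x)) \<in> trig_polys"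
      using wave.hyps \<open>\<And>i. n $ i \<in> \<int>\<close> by (intro trig_polys.scale trig_polys.add trig_polys.wave) auto
    moreover have "(1 / 2) * (wave (n - m) (a - b) x + wave (n + m) (a + b) x) = wave n a x * wave m b x" for x
    proof -
      have "(a - b) + (n - m) \<bullet> x = (a + n \<bullet> x) - (b + m \<bullet> x)" "(a + b) + (n + m) \<bullet> x = (a + n \<bullet> x) + (b + m \<bullet> x)"
        by (simp_all add: inner_diff_left inner_add_left)
      then show ?thesis unfolding wave_def by (simp only: cos_times_cos)
    qed
    ultimately show ?case by simp
  next
    case (add f g)
    then show ?case using trig_polys.add[OF add.IH] by (simp add: distrib_left)
  next
    case (scale f c)
    then show ?case using trig_polys.scale[OF scale.IH, of c] by (simp add: mult.left_commute)
  qed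
next
  case (add f g)
  then show ?case using trig_polys.add[OF add.IH] by (simp add: distrib_right)
next
  case (scale f c)
  then show ?case using trig_polys.scale[OF scale.IH, of c] by (simp add: mult.assoc)
qed

lemma trig_polys_tangent: "m \<in> trig_polys \<Longrightarrow> att.tangent (\<lambda>\<phi>. m \<phi> *\<^sub>R axis k 1)"
proof (induction rule: trig_polys.induct)
  case (wave n a)
  then show ?case using tangent_waves_all[of n k] unfolding tangent_waves_def by blast
next
  case (add f g)
  then show ?case using att.tangent_add[OF add.IH] by (simp add: scaleR_left_distrib)
next
  case (scale f c)
  then show ?case using att.tangent_scale[OF scale.IH, of c] by simp
qed

text \<open>The real coordinates of the embedded torus are \<open>cos (\<phi> $ k)\<close> and
  \<open>sin (\<phi> $ k)\<close>, the latter a wave of phase \<open>- pi / 2\<close>; a linear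
  functional is determined by its values on \<open>axis k 1\<close> and
  \<open>axis k \<i>\<close>.\<close>

lemma polynomial_trig_poly:
  assumes "real_polynomial_function g"
  shows "(\<lambda>\<phi>. g (embed \<phi>)) \<in> trig_polys"
  using assms
proof induction
  case (linear f)
  then interpret bounded_linear f .
  have embed: "embed \<phi> = (\<Sum>k\<in>UNIV. cos (\<phi> $ k) *\<^sub>R axis k 1 + sin (\<phi> $ k) *\<^sub>R axis k \<i>)" for \<phi>
  proof (rule vec_eq_iff[THEN iffD2], rule allI)
    fix i
    have "(\<Sum>k\<in>UNIV. cos (\<phi> $ k) *\<^sub>R axis k 1 + sin (\<phi> $ k) *\<^sub>R axis k \<i>) $ i
      = (\<Sum>k\<in>UNIV. if k = i then cis (\<phi> $ i) else 0)"
      unfolding sum_component by (intro sum.cong) (auto simp: axis_def complex_eq_iff)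
    then show "embed \<phi> $ i = (\<Sum>k\<in>UNIV. cos (\<phi> $ k) *\<^sub>R axis k 1 + sin (\<phi> $ k) *\<^sub>R axis k \<i>) $ i"
      by (simp add: embed_def)
  qed
  have shift: "cos (t - pi / 2) = sin t" for t :: real by (simp only: cos_diff) simp
  have "f (embed \<phi>) = (\<Sum>k\<in>UNIV. f (axis k 1) * wave (axis k 1) 0 \<phi> + f (axis k \<i>) * wave (axis k 1) (- pi / 2) \<phi>)" for \<phi>
    unfolding embed sum
    by (intro sum.cong) (auto simp: add scale wave_def inner_axis' shift)
  moreover have "(\<lambda>\<phi>. \<Sum>k\<in>UNIV. f (axis k 1) * wave (axis k 1) 0 \<phi> + f (axis k \<i>) * wave (axis k 1) (- pi / 2) \<phi>) \<in> trig_polys"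
    by (intro trig_polys_sum trig_polys.add trig_polys.scale trig_polys.wave) (auto simp: axis_def)
  ultimately show ?case by simp
qed (auto intro: trig_polys_const trig_polys.add trig_polys_mult)

lemma periodic_lipschitz_bounded:
  fixes X :: "real ^ ('d::finite) \<Rightarrow> 'b::real_normed_vector"
  assumes "periodic X" "\<And>x y. norm (X x - X y) \<le> L * norm (x - y)" "L \<ge> 0"
  shows "bounded (range X)"
proof -
  have "norm (X \<phi>) \<le> norm (X 0) + 2 * L * (2 * real CARD('d))" for \<phi>
  proof -
    have "norm (embed \<phi> - embed 0) \<le> 2 * real CARD('d)"
      using norm_triangle_ineq4[of "embed \<phi>" "embed 0"] norm_embed[of \<phi>] norm_embed[of "0 :: real ^ 'd"] by linarith
    then have "norm (X \<phi> - X 0) \<le> 2 * L * (2 * real CARD('d))"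
      using periodic_lipschitz_embed[OF assms, of \<phi> 0] mult_left_mono[of _ _ "2 * L"] assms(3) by fastforce
    then show ?thesis using norm_triangle_ineq[of "X \<phi> - X 0" "X 0"] by simp
  qed
  then show ?thesis unfolding bounded_iff by auto
qed

lemma tangent_scalar:
  fixes m :: "real ^ ('d::finite) \<Rightarrow> real"
  assumes per: "periodic m" and lip: "\<And>x y. \<bar>m x - m y\<bar> \<le> L * norm (x - y)" "L \<ge> 0"
  shows "att.tangent (\<lambda>\<phi>. m \<phi> *\<^sub>R axis k 1)"
proof (rule att.tangent_limit)
  have lip': "norm (m x *\<^sub>R axis k (1::real) - m y *\<^sub>R axis k 1) \<le> L * norm (x - y)" for x y
    unfolding scaleR_left_diff_distrib[symmetric] norm_scaleR_axis by (rule lip)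
  have "periodic (\<lambda>\<phi>. m \<phi> *\<^sub>R axis k (1::real))" using per unfolding periodic_def by simp
  then show "bounded (range (\<lambda>\<phi>. m \<phi> *\<^sub>R axis k (1::real)))" by (rule periodic_lipschitz_bounded) (rule lip' lip(2))+
  show "uniformly_continuous_on UNIV (\<lambda>\<phi>. m \<phi> *\<^sub>R axis k (1::real))"
    by (rule uniformly_continuous_if_lipschitz) (rule lip' lip(2))+
  fix e :: real assume e: "e > 0"
  let ?K = "range (embed :: real ^ 'd \<Rightarrow> complex ^ 'd)"
  \<comment> \<open>\<open>m\<close> descends to the embedded torus: periodicity makes the value
    independent of the chosen preimage, and the Lipschitz bound makes it continuous on a compact
    set.\<close>
  define f where "f z = m (SOME \<phi>. embed \<phi> = z)" for z
  have f: "f (embed \<phi>) = m \<phi>" for \<phi>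
  proof -
    have "embed (SOME \<psi>. embed \<psi> = embed \<phi>) = embed \<phi>" by (rule someI_ex) blast
    then show ?thesis unfolding f_def using per unfolding embed_eq_iff periodic_def by metis
  qed
  have "(2 * L)-lipschitz_on ?K f"
    by (rule lipschitz_onI) (use periodic_lipschitz_embed[OF per] lip f in \<open>auto simp: dist_norm\<close>)
  then have cont: "continuous_on ?K f" by (rule lipschitz_on_continuous_on)
  have K_eq: "?K = embed ` cbox (\<chi> i. 0) (\<chi> i. 2 * pi)"
    using embed_fundamental_cube by blast
  have "continuous_on UNIV (embed :: real ^ 'd \<Rightarrow> complex ^ 'd)"
    unfolding embed_def by (intro continuous_intros)
  then have "compact ?K" unfolding K_eq by (intro compact_continuous_image compact_cbox) (rule continuous_on_subset, auto)
  then obtain g where g: "real_polynomial_function g" "\<And>z. z \<in> ?K \<Longrightarrow> \<bar>f z - g z\<bar> < e"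
    using Stone_Weierstrass_real_polynomial_function[OF _ cont e] by blast
  have "norm (g (embed \<phi>) *\<^sub>R axis k 1 - m \<phi> *\<^sub>R axis k (1::real)) \<le> e" for \<phi>
    unfolding scaleR_left_diff_distrib[symmetric] norm_scaleR_axis using g(2)[of "embed \<phi>"] f[of \<phi>] by auto
  then show "\<exists>Y. att.tangent Y \<and> (\<forall>x. norm (Y x - m x *\<^sub>R axis k (1::real)) \<le> e)"
    using trig_polys_tangent[OF polynomial_trig_poly[OF g(1)], of k] by blast
qed

theorem tangent_periodic_lipschitz:
  fixes X :: "real ^ ('d::finite) \<Rightarrow> real ^ 'd"
  assumes per: "periodic X" and lip: "\<And>x y. norm (X x - X y) \<le> L * norm (x - y)" "L \<ge> 0"
  shows "att.tangent X"
proof -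
  have "att.tangent (\<lambda>\<phi>. \<Sum>k\<in>UNIV. X \<phi> $ k *\<^sub>R axis k 1)"
  proof (intro att.tangent_sum tangent_scalar)
    fix k
    show "periodic (\<lambda>\<phi>. X \<phi> $ k)" using per unfolding periodic_def by simp
    show "\<bar>X x $ k - X y $ k\<bar> \<le> L * norm (x - y)" for x y
      using order_trans[OF component_le_norm_cart[of "X x - X y" k] lip(1)] by simp
  qed (rule lip)
  moreover have "(\<Sum>k\<in>UNIV. X \<phi> $ k *\<^sub>R axis k 1) = X \<phi>" for \<phi>
    using basis_expansion[of "X \<phi>"] by (simp add: scalar_mult_eq_scaleR)
  ultimately show ?thesis by simp
qed

section \<open>Maps close to the identity\<close>

text \<open>
  A map \<open>id + h\<close> close to the identity is reached along \<open>H t = id + t * h\<close>: the transition map from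
  time \<open>t\<close> to time \<open>t + s\<close> is exactly \<open>id + s * X t\<close> with \<open>X t = h \<circ> inverse (H t)\<close>, so that no
  differential equation has to be solved.
\<close>

lemma common_step_size:
  assumes "\<And>j. j \<le> (m::nat) \<Longrightarrow> \<exists>d>0::real. P j d" and mono: "\<And>j d d'. P j d \<Longrightarrow> d' \<le> d \<Longrightarrow> P j d'"
  shows "\<exists>d>0. \<forall>j\<le>m. P j d"
  using assms(1)
proof (induction m)
  case 0
  then show ?case by auto
next
  case (Suc m)
  then obtain d1 d2 where "d1 > 0" "\<forall>j\<le>m. P j d1" "d2 > 0" "P (Suc m) d2" by (metis le_SucI order_refl)
  then have "min d1 d2 > 0" "\<forall>j\<le>Suc m. P j (min d1 d2)"
    using mono by (auto simp: le_Suc_eq)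
  then show ?case by blast
qed

lemma near_identity_approximable:
  fixes h :: "real ^ ('d::finite) \<Rightarrow> real ^ 'd"
  assumes per: "periodic h" and lip: "\<And>x y. norm (h x - h y) \<le> 1 / 2 * norm (x - y)" and e: "e > 0"
  shows "\<exists>F\<in>attainable. \<forall>x. norm (F x - (x + h x)) \<le> e"
proof -
  define H where "H t x = x + t *\<^sub>R h x" for t x
  have tlip: "norm (t *\<^sub>R h x - t *\<^sub>R h y) \<le> 1 / 2 * norm (x - y)" if "0 \<le> t" "t \<le> 1" for t x y
  proof -
    have "norm (t *\<^sub>R h x - t *\<^sub>R h y) = t * norm (h x - h y)" using that by (simp add: scaleR_diff_right[symmetric])
    also have "\<dots> \<le> 1 * norm (h x - h y)" using that by (intro mult_right_mono) auto
    finally show ?thesis using lip[of x y] by simp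
  qed
  have "\<exists>!x. H t x = y" if t: "0 \<le> t" "t \<le> 1" for t y
  proof -
    have "\<exists>!x. (\<lambda>x. y - t *\<^sub>R h x) x = x"
    proof (rule banach_fix_type[where c = "1 / 2"], goal_cases)
      case 3
      show ?case
      proof (intro allI)
        fix x z
        have "dist (y - t *\<^sub>R h x) (y - t *\<^sub>R h z) = norm (t *\<^sub>R h x - t *\<^sub>R h z)"
          by (simp add: dist_norm norm_minus_commute)
        then show "dist (y - t *\<^sub>R h x) (y - t *\<^sub>R h z) \<le> 1 / 2 * dist x z"
          using tlip[OF t, of x z] by (simp add: dist_norm)
      qed
    qed auto
    moreover have "H t x = y \<longleftrightarrow> y - t *\<^sub>R h x = x" for x unfolding H_def by (auto simp: algebra_simps)
    ultimately show ?thesis by simp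
  qed
  then have ex: "\<exists>x. H t x = y" and inj: "H t x = H t x' \<Longrightarrow> x = x'" if "0 \<le> t" "t \<le> 1" for t x x' y
    using that by metis+
  define J where "J t y = (SOME x. H t x = y)" for t y
  have HJ: "H t (J t y) = y" if "0 \<le> t" "t \<le> 1" for t y
    unfolding J_def by (rule someI_ex) (rule ex[OF that])
  have JH: "J t (H t x) = x" if "0 \<le> t" "t \<le> 1" for t x
    by (rule inj[OF that]) (rule HJ[OF that])
  have H_lower: "norm (x - y) \<le> 2 * norm (H t x - H t y)" if "0 \<le> t" "t \<le> 1" for t x y
  proof -
    have "x - y = (H t x - H t y) - (t *\<^sub>R h x - t *\<^sub>R h y)" by (simp add: H_def)
    then have "norm (x - y) \<le> norm (H t x - H t y) + norm (t *\<^sub>R h x - t *\<^sub>R h y)" by (metis norm_triangle_ineq4)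
    then show ?thesis using tlip[OF that, of x y] by simp
  qed
  have J_lip: "norm (J t x - J t y) \<le> 2 * norm (x - y)" if "0 \<le> t" "t \<le> 1" for t x y
    using H_lower[OF that, of "J t x" "J t y"] HJ[OF that] by simp
  define X where "X t y = h (J t y)" for t y
  have X_lip: "norm (X t x - X t y) \<le> 1 * norm (x - y)" if "0 \<le> t" "t \<le> 1" for t x y
    unfolding X_def using lip[of "J t x" "J t y"] J_lip[OF that, of x y] by simp
  have X_per: "periodic (X t)" if t: "0 \<le> t" "t \<le> 1" for t
    unfolding periodic_def
  proof (intro allI impI)
    fix n :: "real ^ 'd" and y assume n: "\<forall>i. n $ i \<in> \<int>"
    have hn: "h (J t y + (2 * pi) *\<^sub>R n) = h (J t y)" using per n unfolding periodic_def by blast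
    then have "H t (J t y + (2 * pi) *\<^sub>R n) = H t (J t y) + (2 * pi) *\<^sub>R n" by (simp add: H_def algebra_simps)
    then have "J t (y + (2 * pi) *\<^sub>R n) = J t y + (2 * pi) *\<^sub>R n" using JH[OF t] HJ[OF t] by metis
    then show "X t (y + (2 * pi) *\<^sub>R n) = X t y" by (simp add: X_def hn)
  qed
  have X_tan: "att.tangent (X t)" if "0 \<le> t" "t \<le> 1" for t
    by (rule tangent_periodic_lipschitz[OF X_per[OF that] X_lip[OF that]]) auto
  obtain B where B: "B > 0" "\<And>x. norm (h x) \<le> B"
    using periodic_lipschitz_bounded[OF per, of "1 / 2"] lip unfolding bounded_pos by auto
  have X_time: "norm (X s y - X t y) \<le> B * \<bar>s - t\<bar>" if s: "0 \<le> s" "s \<le> 1" and t: "0 \<le> t" "t \<le> 1" for s t y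
  proof -
    define x z where "x = J s y" and "z = J t y"
    have "x + s *\<^sub>R h x = z + t *\<^sub>R h z" using HJ[OF s, of y] HJ[OF t, of y] by (simp add: H_def x_def z_def)
    then have "x - z = (t - s) *\<^sub>R h z - (s *\<^sub>R h x - s *\<^sub>R h z)" by (simp add: algebra_simps)
    then have "norm (x - z) \<le> norm ((t - s) *\<^sub>R h z) + norm (s *\<^sub>R h x - s *\<^sub>R h z)" by (metis norm_triangle_ineq4)
    moreover have "norm ((t - s) *\<^sub>R h z) \<le> \<bar>t - s\<bar> * B" using B by (simp add: mult_left_mono)
    ultimately have "norm (x - z) \<le> 2 * (B * \<bar>s - t\<bar>)"
      using tlip[OF s, of x z] by (simp add: abs_minus_commute mult.commute)
    then show ?thesis using lip[of x z] by (simp add: X_def x_def z_def)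
  qed
  define \<epsilon> where "\<epsilon> = e / 3"
  have \<epsilon>: "\<epsilon> > 0" using e by (simp add: \<epsilon>_def)
  \<comment> \<open>Tangency yields a step size for each single field. Since \<open>X t\<close>
    varies in \<open>t\<close> with rate \<open>B\<close>, the fields at the \<open>m + 1\<close>
    times \<open>j / m\<close> stand for all of them at the cost \<open>\<epsilon> / 2\<close>, and
    finitely many step sizes have a common lower bound.\<close>
  obtain m :: nat where m: "m > 0" "B / real m \<le> \<epsilon> / 2"
  proof -
    obtain m :: nat where "real m > 2 * B / \<epsilon>" using reals_Archimedean2 by blast
    moreover have "2 * B / \<epsilon> > 0" using B \<epsilon> by simp
    ultimately have "real m > 0" "2 * B < real m * \<epsilon>" using \<epsilon> by (linarith, simp add: field_simps)
    then show ?thesis by (intro that[of m]) (auto simp: field_simps)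
  qed
  have "\<exists>d>0. \<forall>j\<le>m. \<forall>s. 0 \<le> s \<and> s \<le> d \<longrightarrow> (\<exists>F\<in>attainable. \<forall>x. norm (F x - x - s *\<^sub>R X (real j / real m) x) \<le> \<epsilon> / 2 * s)"
  proof (rule common_step_size)
    fix j assume "j \<le> m"
    then have "att.almost_tangent (\<epsilon> / 2) (\<epsilon> / 2) (X (real j / real m))"
      using X_tan[of "real j / real m"] m(1) \<epsilon> unfolding att.tangent_def by (auto simp: field_simps)
    then obtain d \<Phi> where d: "d > 0" "att.tangent_family (\<epsilon> / 2) (\<epsilon> / 2) (X (real j / real m)) d \<Phi>"
      unfolding att.almost_tangent_def by blast
    have "\<Phi> s \<in> attainable" "norm (\<Phi> s x - x - s *\<^sub>R X (real j / real m) x) \<le> \<epsilon> / 2 * s" if "0 \<le> s" "s \<le> d" for s x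
      using att.tangent_familyD(1)[OF d(2), of s] att.tangent_familyD(4)[OF d(2), of s 0 x] att.tangent_familyD(2)[OF d(2)] that d(1) by auto
    then show "\<exists>d>0. \<forall>s. 0 \<le> s \<and> s \<le> d \<longrightarrow> (\<exists>F\<in>attainable. \<forall>x. norm (F x - x - s *\<^sub>R X (real j / real m) x) \<le> \<epsilon> / 2 * s)"
      using d(1) by blast
  qed auto
  then obtain d where d: "d > 0" and step0: "\<And>j s. j \<le> m \<Longrightarrow> 0 \<le> s \<Longrightarrow> s \<le> d \<Longrightarrow>
      \<exists>F\<in>attainable. \<forall>x. norm (F x - x - s *\<^sub>R X (real j / real m) x) \<le> \<epsilon> / 2 * s" by blast
  have step: "\<exists>F\<in>attainable. \<forall>x. norm (F x - (x + s *\<^sub>R X t x)) \<le> \<epsilon> * s"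
    if s: "0 \<le> s" "s \<le> d" and t: "0 \<le> t" "t \<le> 1" for s t
  proof -
    define j where "j = nat \<lfloor>t * real m\<rfloor>"
    have "real j \<le> t * real m" "t * real m \<le> real j + 1"
      unfolding j_def using t by (auto simp: le_nat_iff)
    moreover have "t * real m \<le> real m" using t by (simp add: mult_left_le_one_le)
    then have "real j \<le> real m" using \<open>real j \<le> t * real m\<close> by linarith
    ultimately have j: "j \<le> m" "real j / real m \<le> t" "t \<le> real j / real m + 1 / real m"
      using m(1) by (auto simp: field_simps)
    obtain F where F: "F \<in> attainable" "\<And>x. norm (F x - x - s *\<^sub>R X (real j / real m) x) \<le> \<epsilon> / 2 * s"
      using step0[OF j(1) s] by blast
    have "norm (F x - (x + s *\<^sub>R X t x)) \<le> \<epsilon> * s" for x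
    proof -
      have "norm (X (real j / real m) x - X t x) \<le> B * \<bar>real j / real m - t\<bar>"
        using j t by (intro X_time) (auto simp: field_simps)
      also have "\<dots> \<le> B * (1 / real m)" using j B by (intro mult_left_mono) auto
      also have "\<dots> \<le> \<epsilon> / 2" using m(2) by simp
      finally have "norm (s *\<^sub>R (X (real j / real m) x - X t x)) \<le> s * (\<epsilon> / 2)"
        using mult_left_mono[OF _ s(1)] s(1) by fastforce
      moreover have "F x - (x + s *\<^sub>R X t x) = (F x - x - s *\<^sub>R X (real j / real m) x) + s *\<^sub>R (X (real j / real m) x - X t x)"
        by (simp add: algebra_simps)
      ultimately have "norm (F x - (x + s *\<^sub>R X t x)) \<le> \<epsilon> / 2 * s + s * (\<epsilon> / 2)"
        using F(2)[of x] norm_triangle_mono by metis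
      then show ?thesis by simp
    qed
    then show ?thesis using F(1) by blast
  qed
  obtain n :: nat where n: "n > 0" "1 / real n \<le> d"
  proof -
    obtain n :: nat where "real n > 1 / d" using reals_Archimedean2 by blast
    moreover have "1 / d > 0" using d by simp
    ultimately have "real n > 0" "1 < real n * d" using d by (linarith, simp add: field_simps)
    then show ?thesis by (intro that[of n]) (auto simp: field_simps)
  qed
  \<comment> \<open>\<open>E t\<close> is the map still to be run from time \<open>t\<close> to time
    1. Measuring the error after it has been run makes the errors of the steps add up; its Lipschitz
    constant 3 explains \<open>\<epsilon> = e / 3\<close>.\<close>
  define E where "E t y = H 1 (J t y)" for t y
  have E_lip: "norm (E t x - E t y) \<le> 3 * norm (x - y)" if t: "0 \<le> t" "t \<le> 1" for t x y
  proof -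
    have "E t x - E t y = (J t x - J t y) + (h (J t x) - h (J t y))" by (simp add: E_def H_def)
    then have "norm (E t x - E t y) \<le> norm (J t x - J t y) + norm (h (J t x) - h (J t y))" by (metis norm_triangle_ineq)
    then show ?thesis using lip[of "J t x" "J t y"] J_lip[OF t, of x y] by simp
  qed
  have "i \<le> n \<Longrightarrow> \<exists>F\<in>attainable. \<forall>x. norm (E (real i / real n) (F x) - H 1 x) \<le> 3 * \<epsilon> * (real i / real n)" for i
  proof (induction i)
    case 0
    have "J 0 x = x" for x using JH[of 0 x] by (simp add: H_def)
    then show ?case using id_attainable by (intro bexI[of _ id]) (auto simp: E_def)
  next
    case (Suc i)
    define t s where "t = real i / real n" and "s = 1 / real n"
    have ts: "0 \<le> t" "t \<le> 1" "0 \<le> t + s" "t + s \<le> 1" "t + s = real (Suc i) / real n" "0 \<le> s" "s \<le> d"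
      using Suc.prems n by (auto simp: t_def s_def field_simps)
    obtain F where F: "F \<in> attainable" "\<And>x. norm (E t (F x) - H 1 x) \<le> 3 * \<epsilon> * t"
      using Suc unfolding t_def by auto
    obtain K where K: "K \<in> attainable" "\<And>x. norm (K x - (x + s *\<^sub>R X t x)) \<le> \<epsilon> * s"
      using step[of s t] ts by blast
    have "norm (E (t + s) (K y) - E t y) \<le> 3 * (\<epsilon> * s)" for y
    proof -
      have "H (t + s) (J t y) = H t (J t y) + s *\<^sub>R X t y" by (simp add: H_def X_def algebra_simps)
      then have "y + s *\<^sub>R X t y = H (t + s) (J t y)" using HJ[OF ts(1,2)] by simp
      then have "E (t + s) (y + s *\<^sub>R X t y) = E t y" unfolding E_def using JH[OF ts(3,4)] by simp
      then show ?thesis using E_lip[OF ts(3,4), of "K y" "y + s *\<^sub>R X t y"] K(2)[of y] by simp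
    qed
    then have "norm (E (t + s) (K (F x)) - H 1 x) \<le> 3 * (\<epsilon> * s) + 3 * \<epsilon> * t" for x
      using norm_triangle_mono[OF _ F(2), of "E (t + s) (K (F x)) - E t (F x)" _ x] by fastforce
    then have "norm (E (t + s) ((K \<circ> F) x) - H 1 x) \<le> 3 * \<epsilon> * (t + s)" for x
      by (simp add: algebra_simps)
    then show ?case unfolding ts(5) using attainable.comp[OF K(1) F(1)] by blast
  qed
  from this[of n] obtain F where F: "F \<in> attainable" "\<And>x. norm (E 1 (F x) - H 1 x) \<le> 3 * \<epsilon>" using n by auto
  have "E 1 y = y" for y unfolding E_def by (rule HJ) auto
  then have "norm (F x - (x + h x)) \<le> e" for x using F(2)[of x] by (simp add: H_def \<epsilon>_def)
  then show ?thesis using F(1) by blast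
qed

section \<open>Diffeomorphisms isotopic to the identity\<close>

lemma Rep_torus_angle_embed: "Rep_torus (angle \<phi>) = embed \<phi>"
  by (simp add: Rep_torus_angle embed_def)

lemma angle_eq_iff: "angle a = angle b \<longleftrightarrow> embed a = embed b"
  by (metis Rep_torus_angle_embed Rep_torus_inject)

lemma obtain_angle: obtains \<phi> where "angle \<phi> = p"
  using surj_angle by (metis surjD)

lemma in_angles_apply: "in_angles F \<phi> = Rep_torus (F (angle \<phi>))"
  by (simp add: in_angles_def)

lemma periodic_in_angles: "periodic (in_angles F)"
  using periodic_embed unfolding periodic_def in_angles_apply by (metis angle_eq_iff)

section \<open>Lipschitz bounds and lifts for smooth maps of the torus\<close>

lemma lipschitz_if_partials_bounded:
  fixes f :: "real ^ ('d::finite) \<Rightarrow> 'b::real_normed_vector"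
  assumes diff: "\<And>x. f differentiable (at x)"
    and M: "\<And>i x. norm (frechet_derivative f (at x) (axis i 1)) \<le> M i"
  shows "norm (f x - f y) \<le> (\<Sum>i\<in>UNIV. M i) * norm (x - y)"
proof (rule differentiable_bound[where S = UNIV and f' = "\<lambda>x. frechet_derivative f (at x)"])
  have der: "(f has_derivative frechet_derivative f (at x)) (at x)" for x
    using diff frechet_derivative_works by blast
  then show "(f has_derivative frechet_derivative f (at x)) (at x within UNIV)" for x by simp
  fix x
  interpret D: bounded_linear "frechet_derivative f (at x)" using der has_derivative_bounded_linear by blast
  show "onorm (frechet_derivative f (at x)) \<le> (\<Sum>i\<in>UNIV. M i)"
  proof (rule onorm_le)
    fix v :: "real ^ 'd"
    have "v = (\<Sum>i\<in>UNIV. v $ i *\<^sub>R axis i 1)" using basis_expansion[of v] by (simp add: scalar_mult_eq_scaleR)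
    then have "frechet_derivative f (at x) v = (\<Sum>i\<in>UNIV. v $ i *\<^sub>R frechet_derivative f (at x) (axis i 1))"
      by (metis (no_types, lifting) D.scale D.sum sum.cong)
    then have "norm (frechet_derivative f (at x) v) \<le> (\<Sum>i\<in>UNIV. norm (v $ i *\<^sub>R frechet_derivative f (at x) (axis i 1)))"
      by (simp only: norm_sum)
    also have "\<dots> \<le> (\<Sum>i\<in>UNIV. norm v * M i)"
      unfolding norm_scaleR by (intro sum_mono mult_mono component_le_norm_cart M) auto
    finally show "norm (frechet_derivative f (at x) v) \<le> (\<Sum>i\<in>UNIV. M i) * norm v"
      by (simp add: sum_distrib_left mult.commute)
  qed
qed auto

lemma smooth_partial:
  assumes "smooth f"
  shows "f differentiable (at x)" "(\<lambda>x. frechet_derivative f (at x) (axis i 1)) differentiable (at x)"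
  using assms[unfolded smooth_def, rule_format, of "[]" x] assms[unfolded smooth_def, rule_format, of "[i]" x] by simp_all

text \<open>The partial derivatives are continuous, being differentiable, and inherit the
  periodicity, so they are bounded on one period cube and hence everywhere.\<close>

lemma smooth_periodic_lipschitz:
  fixes f :: "real ^ ('d::finite) \<Rightarrow> 'b::real_normed_vector"
  assumes f: "smooth f" "periodic f"
  shows "\<exists>L\<ge>0. \<forall>x y. norm (f x - f y) \<le> L * norm (x - y)"
proof -
  have "\<exists>M\<ge>0. \<forall>x. norm (frechet_derivative f (at x) (axis i 1)) \<le> M" for i
  proof -
    let ?g = "\<lambda>x. frechet_derivative f (at x) (axis i 1)"
    have g_per: "?g (x + (2 * pi) *\<^sub>R n) = ?g x" if n: "\<forall>i. n $ i \<in> \<int>" for x n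
    proof -
      let ?p = "(2 * pi) *\<^sub>R n"
      have "(f has_derivative frechet_derivative f (at (x + ?p))) (at (x + ?p))"
        using smooth_partial(1)[OF f(1)] frechet_derivative_works by blast
      moreover have "((\<lambda>y. y + ?p) has_derivative (\<lambda>y. y)) (at x)" by (auto intro!: derivative_eq_intros)
      ultimately have "((\<lambda>y. f (y + ?p)) has_derivative frechet_derivative f (at (x + ?p))) (at x)"
        using has_derivative_compose[of "\<lambda>y. y + ?p" "\<lambda>y. y" x UNIV f] by simp
      moreover have "(\<lambda>y. f (y + ?p)) = f" using f(2) n unfolding periodic_def by auto
      ultimately show ?thesis using frechet_derivative_at by metis
    qed
    let ?K = "cbox (\<chi> i. 0) (\<chi> i. 2 * pi) :: (real ^ 'd) set"
    have "continuous_on ?K ?g"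
      using smooth_partial(2)[OF f(1)] by (intro continuous_at_imp_continuous_on ballI differentiable_imp_continuous_within)
    then have "bounded (?g ` ?K)" using compact_continuous_image compact_cbox compact_imp_bounded by blast
    then obtain M where M: "\<And>x. x \<in> ?K \<Longrightarrow> norm (?g x) \<le> M" unfolding bounded_iff by auto
    have "norm (?g x) \<le> \<bar>M\<bar>" for x
    proof -
      obtain y where y: "y \<in> ?K" "embed x = embed y" using embed_fundamental_cube[of x] by blast
      then obtain n where "\<forall>i. n $ i \<in> \<int>" "x = y + (2 * pi) *\<^sub>R n" unfolding embed_eq_iff by blast
      then have "?g x = ?g y" using g_per by metis
      then show ?thesis using M[OF y(1)] by simp
    qed
    then show ?thesis by (intro exI[of _ "\<bar>M\<bar>"]) auto
  qed
  then obtain M where M: "\<And>i. M i \<ge> 0" "\<And>i x. norm (frechet_derivative f (at x) (axis i 1)) \<le> M i" by metis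
  have "norm (f x - f y) \<le> (\<Sum>i\<in>UNIV. M i) * norm (x - y)" for x y
    by (rule lipschitz_if_partials_bounded) (use smooth_partial(1)[OF f(1)] M in auto)
  moreover have "(\<Sum>i\<in>UNIV. M i) \<ge> 0" using M(1) by (simp add: sum_nonneg)
  ultimately show ?thesis by blast
qed

text \<open>The chord estimate leaves a multiple of \<open>2 * pi\<close> open. Within distance 1/4
  of 1 both arguments are at most 1/2 in modulus, which leaves room for the multiple zero
  only.\<close>

lemma Arg_lipschitz:
  assumes "cmod w = 1" "cmod z = 1" "cmod (w - 1) \<le> 1 / 4" "cmod (z - 1) \<le> 1 / 4"
  shows "\<bar>Arg w - Arg z\<bar> \<le> 2 * cmod (w - z)"
proof -
  have cis: "cis (Arg v) = v" if "cmod v = 1" for v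
    using that by (subst cis_Arg) (auto simp: sgn_eq)
  have big: "\<bar>m\<bar> \<ge> 1" if "m \<in> \<int>" "m \<noteq> 0" for m :: real
    using that by (rule Ints_nonzero_abs_ge1)
  have small: "\<bar>Arg v\<bar> \<le> 1 / 2" if v: "cmod v = 1" "cmod (v - 1) \<le> 1 / 4" for v
  proof -
    obtain m where m: "m \<in> \<int>" "\<bar>Arg v - 0 - 2 * pi * m\<bar> \<le> 2 * cmod (cis (Arg v) - cis 0)"
      using cis_near by blast
    then have *: "\<bar>Arg v - 2 * pi * m\<bar> \<le> 1 / 2" using cis[OF v(1)] v(2) by simp
    have "m = 0"
    proof (rule ccontr)
      assume "m \<noteq> 0"
      then have "2 * pi \<le> \<bar>2 * pi * m\<bar>" using big[OF m(1)] by (simp add: abs_mult)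
      then show False using * Arg_bounded[of v] pi_gt3 by linarith
    qed
    then show ?thesis using * by simp
  qed
  obtain m where m: "m \<in> \<int>" "\<bar>Arg w - Arg z - 2 * pi * m\<bar> \<le> 2 * cmod (cis (Arg w) - cis (Arg z))"
    using cis_near by blast
  then have *: "\<bar>Arg w - Arg z - 2 * pi * m\<bar> \<le> 2 * cmod (w - z)" using cis assms by simp
  have "cmod (w - z) \<le> cmod (w - 1) + cmod (z - 1)" using norm_triangle_ineq4[of "w - 1" "z - 1"] by simp
  then have "cmod (w - z) \<le> 1 / 2" using assms by simp
  have "m = 0"
  proof (rule ccontr)
    assume "m \<noteq> 0"
    then have "2 * pi \<le> \<bar>2 * pi * m\<bar>" using big[OF m(1)] by (simp add: abs_mult)
    then show False using * small[OF assms(1,3)] small[OF assms(2,4)] \<open>cmod (w - z) \<le> 1 / 2\<close> pi_gt3 by linarith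
  qed
  then show ?thesis using * by simp
qed

text \<open>Since \<open>F\<close> is C^1-close to \<open>F0\<close>, the map
  \<open>F \<circ> inv F0\<close> is close to the identity in the Lipschitz sense. Its lift is
  \<open>id + h\<close>, where \<open>h\<close> is the argument, angle by angle, of its quotient by
  the identity; these quotients are near 1, where \<open>Arg\<close> is Lipschitz.\<close>

lemma lift_of_near_identity:
  fixes F0 :: "('d::finite) torus \<Rightarrow> 'd torus"
  assumes F0: "F0 \<in> Diff"
  shows "\<exists>e>0. \<forall>F\<in>Diff. Cr_close 1 e F0 F \<longrightarrow>
    (\<exists>h. periodic h \<and> (\<forall>x y. norm (h x - h y) \<le> 1 / 2 * norm (x - y)) \<and>
         (\<forall>\<psi>. F (inv F0 (angle \<psi>)) = angle (\<psi> + h \<psi>)))"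
proof -
  obtain L where L: "L \<ge> 0" "\<And>x y. norm (in_angles (inv F0) x - in_angles (inv F0) y) \<le> L * norm (x - y)"
    using smooth_periodic_lipschitz[of "in_angles (inv F0)"] F0 periodic_in_angles unfolding Diff_def by blast
  define d where "d = real CARD('d)"
  have d: "d \<ge> 1" unfolding d_def by (simp add: Suc_leI)
  \<comment> \<open>Each component of \<open>h\<close> will have Lipschitz constant
    \<open>2 * (2 * d * L + 1) * e\<close>, and the sum over the \<open>d\<close> components must
    not exceed 1/2; the bound 1/4 serves \<open>Arg_lipschitz\<close>.\<close>
  define e where "e = min (1 / 4) (1 / (4 * d * (2 * d * L + 1)))"
  have pos: "4 * d * (2 * d * L + 1) > 0" using d L by (intro mult_pos_pos) (auto intro: add_nonneg_pos)
  have e: "e > 0" "e \<le> 1 / 4" "4 * d * (2 * d * L + 1) * e \<le> 1"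
  proof -
    show "e > 0" "e \<le> 1 / 4" using pos by (auto simp: e_def)
    have "e \<le> 1 / (4 * d * (2 * d * L + 1))" by (simp add: e_def)
    then show "4 * d * (2 * d * L + 1) * e \<le> 1" using pos by (simp add: field_simps)
  qed
  have "\<exists>h. periodic h \<and> (\<forall>x y. norm (h x - h y) \<le> 1 / 2 * norm (x - y)) \<and>
         (\<forall>\<psi>. F (inv F0 (angle \<psi>)) = angle (\<psi> + h \<psi>))"
    if F: "F \<in> Diff" and close: "Cr_close 1 e F0 F" for F
  proof -
    define D where "D \<phi> = in_angles F \<phi> - in_angles F0 \<phi>" for \<phi>
    have sm: "in_angles F differentiable (at x)" "in_angles F0 differentiable (at x)" for x
      using F F0 smooth_partial(1) unfolding Diff_def by blast+
    have D_small: "norm (D \<phi>) < e" for \<phi>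
      using close[unfolded Cr_close_def, rule_format, of "[]" \<phi>] by (simp add: D_def)
    have D_partial: "norm (frechet_derivative D (at x) (axis i 1)) \<le> e" for x i
    proof -
      have "(D has_derivative (\<lambda>v. frechet_derivative (in_angles F) (at x) v - frechet_derivative (in_angles F0) (at x) v)) (at x)"
        unfolding D_def by (intro has_derivative_diff) (use sm frechet_derivative_works in blast)+
      note eq = frechet_derivative_at[OF this, symmetric]
      have "norm (iter_partial [i] (in_angles F) x - iter_partial [i] (in_angles F0) x) < e"
        using close[unfolded Cr_close_def, rule_format, of "[i]" x] by simp
      then show ?thesis unfolding eq by simp
    qed
    have "D differentiable (at x)" for x unfolding D_def using sm by (intro differentiable_diff) auto
    from lipschitz_if_partials_bounded[OF this D_partial]
    have D_lip: "norm (D x - D y) \<le> (d * e) * norm (x - y)" for x y by (simp add: d_def)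
    have D_per: "periodic D" using periodic_in_angles[of F] periodic_in_angles[of F0] unfolding periodic_def D_def by simp
    define R K where "R \<psi> = Rep_torus (F (inv F0 (angle \<psi>)))" and "K \<psi> = R \<psi> - embed \<psi>" for \<psi>
    have K_D: "K \<psi> = D \<phi>" if "angle \<phi> = inv F0 (angle \<psi>)" for \<phi> \<psi>
    proof -
      have "surj F0" using F0 unfolding Diff_def by (auto dest: bij_is_surj)
      then have "F0 (inv F0 (angle \<psi>)) = angle \<psi>" by (rule surj_f_inv_f)
      then show ?thesis using that by (simp add: K_def R_def D_def in_angles_apply Rep_torus_angle_embed)
    qed
    have K_small: "norm (K \<psi>) \<le> e" for \<psi>
      using K_D D_small obtain_angle[of "inv F0 (angle \<psi>)"] by (metis less_imp_le)
    \<comment> \<open>No continuous choice of the angles of \<open>inv F0 (angle x)\<close> is made: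
      \<open>D\<close> is compared on the embedded torus, where \<open>inv F0\<close> is known to be
      Lipschitz with constant \<open>L\<close>.\<close>
    have K_lip: "norm (K x - K y) \<le> 2 * d * e * L * norm (x - y)" for x y
    proof -
      obtain a b where ab: "angle a = inv F0 (angle x)" "angle b = inv F0 (angle y)" using obtain_angle by metis
      have "norm (K x - K y) = norm (D a - D b)" using K_D ab by simp
      also have "\<dots> \<le> 2 * (d * e) * norm (embed a - embed b)"
        by (rule periodic_lipschitz_embed[OF D_per D_lip]) (use d e in simp)
      also have "norm (embed a - embed b) = norm (in_angles (inv F0) x - in_angles (inv F0) y)"
        by (simp add: in_angles_apply ab[symmetric] Rep_torus_angle_embed)
      also have "2 * (d * e) * \<dots> \<le> 2 * (d * e) * (L * norm (x - y))" using L d e by (intro mult_left_mono) auto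
      finally show ?thesis by (simp add: mult.assoc)
    qed
    define w where "w \<psi> k = R \<psi> $ k * cis (- \<psi> $ k)" for \<psi> k
    define h where "h \<psi> = (\<chi> k. Arg (w \<psi> k))" for \<psi>
    have w_unit: "cmod (w \<psi> k) = 1" for \<psi> k
      using Rep_torus[of "F (inv F0 (angle \<psi>))"] by (simp add: w_def R_def norm_mult)
    have w_eq: "w \<psi> k - 1 = K \<psi> $ k * cis (- \<psi> $ k)" for \<psi> k
      by (simp add: w_def K_def embed_def left_diff_distrib cis_mult)
    have w_near: "cmod (w \<psi> k - 1) \<le> 1 / 4" for \<psi> k
    proof -
      have "cmod (w \<psi> k - 1) = cmod (K \<psi> $ k)" unfolding w_eq by (simp add: norm_mult)
      also have "\<dots> \<le> norm (K \<psi>)" by (rule Finite_Cartesian_Product.norm_nth_le)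
      finally show ?thesis using K_small[of \<psi>] e by linarith
    qed
    have w_lip: "cmod (w x k - w y k) \<le> (2 * d * L + 1) * e * norm (x - y)" for x y k
    proof -
      have "w x k - w y k = (w x k - 1) - (w y k - 1)" by simp
      also have "\<dots> = (K x - K y) $ k * cis (- x $ k) + K y $ k * (cis (- x $ k) - cis (- y $ k))"
        unfolding w_eq by (simp add: algebra_simps)
      finally have "cmod (w x k - w y k) \<le> cmod ((K x - K y) $ k) + cmod (K y $ k) * cmod (cis (- x $ k) - cis (- y $ k))"
        by (simp only:) (rule order_trans[OF norm_triangle_ineq], simp add: norm_mult)
      also have "\<dots> \<le> 2 * d * e * L * norm (x - y) + e * norm (x - y)"
      proof (intro add_mono mult_mono)
        show "cmod ((K x - K y) $ k) \<le> 2 * d * e * L * norm (x - y)"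
          using Finite_Cartesian_Product.norm_nth_le K_lip order_trans by blast
        show "cmod (K y $ k) \<le> e" using Finite_Cartesian_Product.norm_nth_le K_small order_trans by blast
        have "cmod (cis (- x $ k) - cis (- y $ k)) \<le> \<bar>(x - y) $ k\<bar>"
          using cmod_cis_diff_le[of "- x $ k" "- y $ k"] by simp
        then show "cmod (cis (- x $ k) - cis (- y $ k)) \<le> norm (x - y)"
          using component_le_norm_cart[of "x - y" k] by linarith
      qed (use e in auto)
      finally show ?thesis by (simp add: algebra_simps)
    qed
    have "norm (h x - h y) \<le> 1 / 2 * norm (x - y)" for x y
    proof -
      have "norm (h x - h y) \<le> (\<Sum>k\<in>UNIV. \<bar>(h x - h y) $ k\<bar>)" by (rule norm_le_l1_cart)
      also have "\<dots> \<le> (\<Sum>k\<in>(UNIV::'d set). 2 * ((2 * d * L + 1) * e * norm (x - y)))"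
      proof (rule sum_mono)
        fix k
        have "\<bar>(h x - h y) $ k\<bar> = \<bar>Arg (w x k) - Arg (w y k)\<bar>" by (simp add: h_def)
        also have "\<dots> \<le> 2 * cmod (w x k - w y k)" by (intro Arg_lipschitz w_unit w_near)
        also have "\<dots> \<le> 2 * ((2 * d * L + 1) * e * norm (x - y))" using w_lip by simp
        finally show "\<bar>(h x - h y) $ k\<bar> \<le> 2 * ((2 * d * L + 1) * e * norm (x - y))" .
      qed
      also have "\<dots> = (4 * d * (2 * d * L + 1) * e) * norm (x - y) / 2" by (simp add: d_def)
      also have "\<dots> \<le> 1 * norm (x - y) / 2" using e(3) by (intro divide_right_mono mult_right_mono) auto
      finally show ?thesis by simp
    qed
    moreover have "periodic h"
      unfolding periodic_def
    proof (intro allI impI)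
      fix n :: "real ^ 'd" and \<psi> assume n: "\<forall>i. n $ i \<in> \<int>"
      have em: "embed (\<psi> + (2 * pi) *\<^sub>R n) = embed \<psi>" using n unfolding embed_eq_iff by blast
      then have "R (\<psi> + (2 * pi) *\<^sub>R n) = R \<psi>" unfolding R_def using angle_eq_iff by metis
      moreover have "cis ((\<psi> + (2 * pi) *\<^sub>R n) $ k) = cis (\<psi> $ k)" for k
        using em unfolding embed_def by (simp add: vec_eq_iff)
      then have "cis (- (\<psi> + (2 * pi) *\<^sub>R n) $ k) = cis (- \<psi> $ k)" for k by (metis cis_cnj vector_uminus_component)
      ultimately show "h (\<psi> + (2 * pi) *\<^sub>R n) = h \<psi>" by (simp only: h_def w_def)
    qed
    moreover have "F (inv F0 (angle \<psi>)) = angle (\<psi> + h \<psi>)" for \<psi>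
    proof -
      have "cis (\<psi> $ k + h \<psi> $ k) = R \<psi> $ k" for k
      proof -
        have "cis (h \<psi> $ k) = w \<psi> k" using w_unit[of \<psi> k] by (simp add: h_def) (subst cis_Arg, auto simp: sgn_eq)
        then show ?thesis unfolding cis_mult[symmetric] by (simp add: w_def cis_mult)
      qed
      then have "embed (\<psi> + h \<psi>) = R \<psi>" by (simp add: embed_def vec_eq_iff)
      then show ?thesis unfolding R_def by (metis Rep_torus_angle_embed Rep_torus_inject)
    qed
    ultimately show ?thesis by blast
  qed
  then show ?thesis using e(1) by blast
qed

text \<open>Closeness is measured in the embedding, so that no lift of \<open>F\<close> enters; only
  \<open>G\<close> lives on the covering.\<close>

definition approximable :: "(('d::finite) torus \<Rightarrow> 'd torus) \<Rightarrow> bool" where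
  "approximable F \<longleftrightarrow> (\<forall>e>0. \<exists>G\<in>attainable. \<forall>\<phi>. norm (in_angles F \<phi> - embed (G \<phi>)) \<le> e)"

lemma approximable_near:
  assumes F0: "approximable F0" and h: "periodic h" "\<And>x y. norm (h x - h y) \<le> 1 / 2 * norm (x - y)"
    and F: "\<And>p \<psi>. F0 p = angle \<psi> \<Longrightarrow> F p = angle (\<psi> + h \<psi>)"
  shows "approximable F"
  unfolding approximable_def
proof (intro allI impI)
  fix e :: real assume e: "e > 0"
  obtain G where G: "G \<in> attainable" "\<And>\<phi>. norm (in_angles F0 \<phi> - embed (G \<phi>)) \<le> e / 6"
    using F0 e unfolding approximable_def by (meson divide_pos_pos zero_less_numeral)
  obtain K where K: "K \<in> attainable" "\<And>x. norm (K x - (x + h x)) \<le> e / 2"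
    using near_identity_approximable[OF h, of "e / 2"] e by auto
  have "norm (in_angles F \<phi> - embed ((K \<circ> G) \<phi>)) \<le> e" for \<phi>
  proof -
    obtain \<psi>0 where \<psi>0: "F0 (angle \<phi>) = angle \<psi>0" using obtain_angle by metis
    obtain n where n: "\<forall>i. n $ i \<in> \<int>" "norm (\<psi>0 - G \<phi> - (2 * pi) *\<^sub>R n) \<le> 2 * norm (embed \<psi>0 - embed (G \<phi>))"
      using embed_near by blast
    \<comment> \<open>Among the lifts of \<open>F0 (angle \<phi>)\<close> one near
      \<open>G \<phi>\<close> is taken, at distance at most \<open>2 * (e / 6)\<close>. Adding
      \<open>h\<close> stretches this to at most \<open>e / 2\<close>, and \<open>K\<close> accounts
      for the other half.\<close>
    define \<psi> where "\<psi> = \<psi>0 - (2 * pi) *\<^sub>R n"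
    have "embed \<psi> = embed \<psi>0" unfolding \<psi>_def using periodic_minus[OF periodic_embed n(1)] by simp
    then have \<psi>: "F0 (angle \<phi>) = angle \<psi>" using \<psi>0 angle_eq_iff by metis
    have "embed \<psi>0 = in_angles F0 \<phi>" by (simp add: in_angles_apply \<psi>0 Rep_torus_angle_embed)
    then have near: "norm (\<psi> - G \<phi>) \<le> e / 3" using n(2) G(2)[of \<phi>] by (simp add: \<psi>_def algebra_simps)
    have "in_angles F \<phi> = embed (\<psi> + h \<psi>)" using F[OF \<psi>] by (simp add: in_angles_apply Rep_torus_angle_embed)
    then have "norm (in_angles F \<phi> - embed ((K \<circ> G) \<phi>)) \<le> norm ((\<psi> + h \<psi>) - K (G \<phi>))"
      using norm_embed_diff_le by simp
    also have "(\<psi> + h \<psi>) - K (G \<phi>) = (\<psi> - G \<phi>) + (h \<psi> - h (G \<phi>)) - (K (G \<phi>) - (G \<phi> + h (G \<phi>)))" by simp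
    also have "norm \<dots> \<le> (norm (\<psi> - G \<phi>) + norm (h \<psi> - h (G \<phi>))) + norm (K (G \<phi>) - (G \<phi> + h (G \<phi>)))"
      by (intro order_trans[OF norm_triangle_ineq4] add_right_mono norm_triangle_ineq)
    also have "\<dots> \<le> (e / 3 + 1 / 2 * (e / 3)) + e / 2"
      using near h(2)[of \<psi> "G \<phi>"] K(2)[of "G \<phi>"] by linarith
    finally show ?thesis by simp
  qed
  then show "\<exists>G\<in>attainable. \<forall>\<phi>. norm (in_angles F \<phi> - embed (G \<phi>)) \<le> e"
    using attainable.comp[OF K(1) G(1)] by blast
qed

text \<open>Openness of the set of approximable diffeomorphisms uses C^1-neighbourhoods, through the
  lift of \<open>F \<circ> inv F0\<close>; for closedness uniform neighbourhoods do, as a uniform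
  limit of approximable maps is approximable.\<close>

lemma Diff0_approximable:
  fixes Q :: "('d::finite) torus \<Rightarrow> 'd torus"
  assumes "Q \<in> Diff0"
  shows "approximable Q"
proof -
  define S where "S = {F :: 'd torus \<Rightarrow> 'd torus. F \<in> Diff \<and> approximable F}"
  have comp: "connected_component_of Diff_topology id Q" using assms unfolding Diff0_def by simp
  have id_in: "id \<in> connected_component_of_set Diff_topology (id :: 'd torus \<Rightarrow> 'd torus)"
    using connected_component_in_topspace[OF comp] by (simp add: connected_component_of_refl)
  \<comment> \<open>Membership in \<open>Diff\<close> is read off from the component containing
    \<open>Q\<close>: the component of a point outside the space would be empty.\<close>
  have id_Diff: "(id :: 'd torus \<Rightarrow> 'd torus) \<in> Diff"
    using connected_component_in_topspace[OF comp] by (simp add: topspace_Diff_topology)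
  have "approximable (id :: 'd torus \<Rightarrow> 'd torus)"
    unfolding approximable_def using id_attainable
    by (intro allI impI bexI[of _ id]) (auto simp: in_angles_apply Rep_torus_angle_embed)
  then have id_S: "id \<in> S" using id_Diff by (simp add: S_def)
  have "openin Diff_topology S"
    unfolding openin_Diff_topology Diff_open_def
  proof (intro conjI ballI)
    fix F0 assume F0: "F0 \<in> S"
    then have "F0 \<in> Diff" by (simp add: S_def)
    from lift_of_near_identity[OF this] obtain e where e: "e > 0"
      "\<And>F. F \<in> Diff \<Longrightarrow> Cr_close 1 e F0 F \<Longrightarrow> \<exists>h. periodic h \<and> (\<forall>x y. norm (h x - h y) \<le> 1 / 2 * norm (x - y)) \<and>
         (\<forall>\<psi>. F (inv F0 (angle \<psi>)) = angle (\<psi> + h \<psi>))" by metis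
    have "F \<in> S" if F: "F \<in> Diff" "Cr_close 1 e F0 F" for F
    proof -
      obtain h where h: "periodic h" "\<And>x y. norm (h x - h y) \<le> 1 / 2 * norm (x - y)"
        "\<And>\<psi>. F (inv F0 (angle \<psi>)) = angle (\<psi> + h \<psi>)" using e(2)[OF F] by blast
      have "inj F0" using F0 unfolding S_def Diff_def by (auto intro: bij_is_inj)
      then have lift: "F p = angle (\<psi> + h \<psi>)" if "F0 p = angle \<psi>" for p \<psi>
        using h(3)[of \<psi>] inv_f_f[of F0 p] that by simp
      have "approximable F0" using F0 by (simp add: S_def)
      then have "approximable F" using h(1,2) lift by (rule approximable_near)
      then show ?thesis using F by (simp add: S_def)
    qed
    then show "\<exists>r. \<exists>e>0. \<forall>F\<in>Diff. Cr_close r e F0 F \<longrightarrow> F \<in> S" using e(1) by blast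
  qed (simp add: S_def)
  moreover have "closedin Diff_topology S"
    unfolding closedin_def topspace_Diff_topology openin_Diff_topology Diff_open_def
  proof (intro conjI ballI)
    fix F0 assume "F0 \<in> Diff - S"
    then obtain e where e: "e > 0" "\<And>G. G \<in> attainable \<Longrightarrow> \<exists>\<phi>. norm (in_angles F0 \<phi> - embed (G \<phi>)) > e"
      unfolding S_def approximable_def by (auto simp: not_le)
    have "\<not> approximable F" if F: "Cr_close 0 (e / 2) F0 F" for F
    proof
      assume "approximable F"
      then obtain G where G: "G \<in> attainable" "\<And>\<phi>. norm (in_angles F \<phi> - embed (G \<phi>)) \<le> e / 2"
        using e(1) unfolding approximable_def by (meson half_gt_zero)
      obtain \<phi> where \<phi>: "norm (in_angles F0 \<phi> - embed (G \<phi>)) > e" using e(2)[OF G(1)] by blast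
      have "norm (in_angles F \<phi> - in_angles F0 \<phi>) < e / 2"
        using F[unfolded Cr_close_def, rule_format, of "[]" \<phi>] by simp
      then show False
        using \<phi> G(2)[of \<phi>] norm_triangle_ineq4[of "in_angles F \<phi> - embed (G \<phi>)" "in_angles F \<phi> - in_angles F0 \<phi>"] by simp
    qed
    then show "\<exists>r. \<exists>e>0. \<forall>F\<in>Diff. Cr_close r e F0 F \<longrightarrow> F \<in> Diff - S"
      using e(1) unfolding S_def by (intro exI[of _ 0] exI[of _ "e / 2"]) auto
  qed (auto simp: S_def)
  ultimately have "connected_component_of_set Diff_topology id \<subseteq> S"
    using connectedin_clopen_cases[OF connectedin_connected_component_of[of Diff_topology id], of S] id_S id_in
    by (auto simp: disjnt_iff)
  then show ?thesis using assms unfolding Diff0_def S_def by auto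
qed

lemma torus_dist_le:
  shows "torus_dist p (angle b) \<le> 2 * norm (Rep_torus p - embed b)"
proof -
  obtain a0 where a0: "angle a0 = p" using obtain_angle by blast
  obtain n where n: "\<forall>i. n $ i \<in> \<int>" "norm (a0 - b - (2 * pi) *\<^sub>R n) \<le> 2 * norm (embed a0 - embed b)"
    using embed_near by blast
  have "embed (a0 - (2 * pi) *\<^sub>R n) = embed a0" using periodic_minus[OF periodic_embed n(1)] .
  then have "angle (a0 - (2 * pi) *\<^sub>R n) = p" using a0 angle_eq_iff by metis
  then have "torus_dist p (angle b) \<le> norm (a0 - (2 * pi) *\<^sub>R n - b)"
    unfolding torus_dist_def by (intro cInf_lower bdd_belowI[of _ 0]) auto
  also have "\<dots> = norm (a0 - b - (2 * pi) *\<^sub>R n)" by (simp add: algebra_simps)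
  also have "\<dots> \<le> 2 * norm (Rep_torus p - embed b)" using n(2) a0 Rep_torus_angle_embed by metis
  finally show ?thesis .
qed

section \<open>Attainable maps are flows of the control systems\<close>

text \<open>All points are driven by one control, on an arbitrary interval so that maps can be run
  one after another. The solutions are those on the covering space.\<close>

definition steers ::
  "('c::euclidean_space \<Rightarrow> real ^ 'd \<Rightarrow> real ^ ('d::finite)) \<Rightarrow> real \<Rightarrow> real \<Rightarrow> (real ^ 'd \<Rightarrow> real ^ 'd) \<Rightarrow> bool" where
  "steers f a b G \<longleftrightarrow> (\<exists>u \<Phi>. u absolutely_integrable_on {a..b} \<and>
     (\<forall>x. \<Phi> a x = x \<and> \<Phi> b x = G x \<and> continuous_on {a..b} (\<lambda>t. \<Phi> t x) \<and>
        (\<forall>t\<in>{a..b}. (\<lambda>s. f (u s) (\<Phi> s x)) absolutely_integrable_on {a..t} \<and>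
           ((\<lambda>s. f (u s) (\<Phi> s x)) has_integral (\<Phi> t x - x)) {a..t})))"

lemma steers_constant_control:
  assumes ab: "a < b" and cont: "continuous_on UNIV (f w)"
    and der: "\<And>t x. ((\<lambda>t. \<Psi> t x) has_vector_derivative f w (\<Psi> t x)) (at t)"
    and init: "\<And>x. \<Psi> 0 x = x" and fin: "\<And>x. \<Psi> (b - a) x = G x"
  shows "steers f a b G"
proof -
  have der': "((\<lambda>t. \<Psi> (t - a) x) has_vector_derivative f w (\<Psi> (t - a) x)) (at t)" for t x
  proof -
    have "((\<lambda>t. t - a) has_vector_derivative 1) (at t)"
      unfolding has_real_derivative_iff_has_vector_derivative[symmetric] by (rule derivative_eq_intros refl)+ simp
    from vector_diff_chain_at[of "\<lambda>t. t - a" 1 t "\<lambda>t. \<Psi> t x" "f w (\<Psi> (t - a) x)", OF this der]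
    show ?thesis by (simp only: o_def scaleR_one)
  qed
  then have con: "continuous_on A (\<lambda>t. \<Psi> (t - a) x)" for A x
    by (intro continuous_at_imp_continuous_on ballI has_vector_derivative_continuous[OF der'])
  have con2: "continuous_on A (\<lambda>t. f w (\<Psi> (t - a) x))" for A x
    by (rule continuous_on_compose2[OF cont con]) auto
  have "((\<lambda>s. f w (\<Psi> (s - a) x)) has_integral (\<Psi> (t - a) x - x)) {a..t}" if "a \<le> t" for t x
    using fundamental_theorem_of_calculus[OF that, of "\<lambda>t. \<Psi> (t - a) x" "\<lambda>s. f w (\<Psi> (s - a) x)"]
      has_vector_derivative_at_within[OF der'] init by simp
  then show ?thesis
    unfolding steers_def using init fin con con2
    by (intro exI[of _ "\<lambda>s. w"] exI[of _ "\<lambda>t. \<Psi> (t - a)"]) (auto intro: absolutely_integrable_continuous_real)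
qed

lemma steers_comp:
  fixes f :: "'c::euclidean_space \<Rightarrow> real ^ 'd \<Rightarrow> real ^ ('d::finite)"
  assumes am: "a \<le> m" and mb: "m \<le> b" and H: "steers f a m H" and G: "steers f m b G"
  shows "steers f a b (G \<circ> H)"
proof -
  obtain u1 \<Phi>1 where 1: "u1 absolutely_integrable_on {a..m}"
    "\<And>x. \<Phi>1 a x = x" "\<And>x. \<Phi>1 m x = H x" "\<And>x. continuous_on {a..m} (\<lambda>t. \<Phi>1 t x)"
    "\<And>x t. t \<in> {a..m} \<Longrightarrow> (\<lambda>s. f (u1 s) (\<Phi>1 s x)) absolutely_integrable_on {a..t}"
    "\<And>x t. t \<in> {a..m} \<Longrightarrow> ((\<lambda>s. f (u1 s) (\<Phi>1 s x)) has_integral (\<Phi>1 t x - x)) {a..t}"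
    using H unfolding steers_def by blast
  obtain u2 \<Phi>2 where 2: "u2 absolutely_integrable_on {m..b}"
    "\<And>x. \<Phi>2 m x = x" "\<And>x. \<Phi>2 b x = G x" "\<And>x. continuous_on {m..b} (\<lambda>t. \<Phi>2 t x)"
    "\<And>x t. t \<in> {m..b} \<Longrightarrow> (\<lambda>s. f (u2 s) (\<Phi>2 s x)) absolutely_integrable_on {m..t}"
    "\<And>x t. t \<in> {m..b} \<Longrightarrow> ((\<lambda>s. f (u2 s) (\<Phi>2 s x)) has_integral (\<Phi>2 t x - x)) {m..t}"
    using G unfolding steers_def by blast
  define u \<Phi> where "u s = (if s \<le> m then u1 s else u2 s)"
    and "\<Phi> t x = (if t \<le> m then \<Phi>1 t x else \<Phi>2 t (H x))" for s t x
  have neg: "negligible {m}" by simp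
  have u_eq: "u s = u1 s" "f (u s) (\<Phi> s x) = f (u1 s) (\<Phi>1 s x)" if "s \<in> {a..m}" for s x
    using that by (auto simp: u_def \<Phi>_def)
  have u_eq2: "u s = u2 s" "f (u s) (\<Phi> s x) = f (u2 s) (\<Phi>2 s (H x))" if "s \<in> {m..b} - {m}" for s x
    using that by (auto simp: u_def \<Phi>_def)
  have "u absolutely_integrable_on {a..m} \<union> {m..b}"
  proof (rule absolutely_integrable_Un)
    show "u absolutely_integrable_on {a..m}"
      by (rule absolutely_integrable_spike[OF 1(1) negligible_empty]) (use u_eq in auto)
    show "u absolutely_integrable_on {m..b}"
      by (rule absolutely_integrable_spike[OF 2(1) neg]) (use u_eq2 in auto)
  qed
  then have u: "u absolutely_integrable_on {a..b}" using ivl_disj_un_two_touch(4)[OF am mb] by simp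
  have cont: "continuous_on {a..b} (\<lambda>t. \<Phi> t x)" for x
  proof -
    have "continuous_on ({a..m} \<union> {m..b}) (\<lambda>t. if t \<le> m then \<Phi>1 t x else \<Phi>2 t (H x))"
      by (rule continuous_on_If) (use 1(3,4) 2(2,4) in auto)
    then show ?thesis using ivl_disj_un_two_touch(4)[OF am mb] by (simp add: \<Phi>_def)
  qed
  have first: "(\<lambda>s. f (u s) (\<Phi> s x)) absolutely_integrable_on {a..t}"
      "((\<lambda>s. f (u s) (\<Phi> s x)) has_integral (\<Phi> t x - x)) {a..t}" if t: "t \<in> {a..m}" for t x
  proof -
    show "(\<lambda>s. f (u s) (\<Phi> s x)) absolutely_integrable_on {a..t}"
      by (rule absolutely_integrable_spike[OF 1(5)[OF t] negligible_empty]) (use u_eq t in auto)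
    have "((\<lambda>s. f (u s) (\<Phi> s x)) has_integral (\<Phi>1 t x - x)) {a..t}"
      by (rule has_integral_eq[OF _ 1(6)[OF t]]) (use u_eq t in auto)
    then show "((\<lambda>s. f (u s) (\<Phi> s x)) has_integral (\<Phi> t x - x)) {a..t}" using t by (simp add: \<Phi>_def)
  qed
  have second: "(\<lambda>s. f (u s) (\<Phi> s x)) absolutely_integrable_on {a..t} \<and>
      ((\<lambda>s. f (u s) (\<Phi> s x)) has_integral (\<Phi> t x - x)) {a..t}" if t: "t \<in> {m..b}" "t \<noteq> m" for t x
  proof
    have "(\<lambda>s. f (u s) (\<Phi> s x)) absolutely_integrable_on {m..t}"
      by (rule absolutely_integrable_spike[OF 2(5)[OF t(1)] neg]) (use u_eq2 t in auto)
    then have "(\<lambda>s. f (u s) (\<Phi> s x)) absolutely_integrable_on {a..m} \<union> {m..t}"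
      using first(1)[of m] am by (intro absolutely_integrable_Un) auto
    then show "(\<lambda>s. f (u s) (\<Phi> s x)) absolutely_integrable_on {a..t}"
      using ivl_disj_un_two_touch(4)[OF am, of t] t by simp
    have "((\<lambda>s. f (u s) (\<Phi> s x)) has_integral (\<Phi>2 t (H x) - H x)) {m..t}"
      by (rule has_integral_spike[OF neg _ 2(6)[OF t(1)]]) (use u_eq2 t in auto)
    moreover have "((\<lambda>s. f (u s) (\<Phi> s x)) has_integral (H x - x)) {a..m}"
      using first(2)[of m x] am 1(3) by (simp add: \<Phi>_def)
    ultimately have "((\<lambda>s. f (u s) (\<Phi> s x)) has_integral ((H x - x) + (\<Phi>2 t (H x) - H x))) {a..t}"
      using am t by (intro has_integral_combine[of a m t]) auto
    then show "((\<lambda>s. f (u s) (\<Phi> s x)) has_integral (\<Phi> t x - x)) {a..t}" using t by (simp add: \<Phi>_def)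
  qed
  have "(\<lambda>s. f (u s) (\<Phi> s x)) absolutely_integrable_on {a..t} \<and>
      ((\<lambda>s. f (u s) (\<Phi> s x)) has_integral (\<Phi> t x - x)) {a..t}" if "t \<in> {a..b}" for t x
    using first[of t x] second[of t x] that by (cases "t \<le> m") auto
  moreover have "\<Phi> a x = x" "\<Phi> b x = (G \<circ> H) x" for x
    using am mb 1(2,3) 2(2,3) by (auto simp: \<Phi>_def)
  ultimately show ?thesis unfolding steers_def using u cont by blast
qed

section \<open>Constant controls for the generators\<close>

lemma has_vector_derivative_along_axis:
  assumes "(g has_real_derivative g') (at t)"
  shows "((\<lambda>t. x + g t *\<^sub>R axis l (1::real)) has_vector_derivative g' *\<^sub>R axis l 1) (at t)"
proof -
  have "(g has_vector_derivative g') (at t)"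
    using assms by (simp add: has_real_derivative_iff_has_vector_derivative)
  from bounded_linear.has_vector_derivative[OF bounded_linear_scaleR_left this]
  have "((\<lambda>t. g t *\<^sub>R axis l (1::real)) has_vector_derivative g' *\<^sub>R axis l 1) (at t)" .
  from has_vector_derivative_add[OF has_vector_derivative_const this] show ?thesis by simp
qed

lemma sine_flow_shift_deriv:
  assumes "w \<noteq> 0"
  shows "((\<lambda>t. sine_flow_shift w (c * t) u) has_real_derivative c * sin (w * (u + sine_flow_shift w (c * t) u))) (at t)"
proof -
  have "((\<lambda>t. w * (c * t)) has_real_derivative w * c) (at t)" by (auto intro!: derivative_eq_intros)
  from DERIV_chain2[OF sine_flow_deriv this, of "w * u"]
  show ?thesis using assms unfolding sine_flow_shift_def by (auto intro!: derivative_eq_intros)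
qed

lemma continuous_system_A: "continuous_on UNIV (system_A w)"
  unfolding system_A_def by (cases w) (auto intro!: continuous_intros)

lemma continuous_system_B: "continuous_on UNIV (system_B w)"
  unfolding system_B_def by (cases w) (auto intro!: continuous_intros)

lemma steers_translation:
  assumes "a < b" "continuous_on UNIV (f w)" "\<And>\<phi>. f w \<phi> = (1 / (b - a)) *\<^sub>R \<beta>"
  shows "steers f a b (\<lambda>\<phi>. \<phi> + \<beta>)"
  by (rule steers_constant_control[where w = w and \<Psi> = "\<lambda>t \<phi>. \<phi> + t *\<^sub>R (1 / (b - a)) *\<^sub>R \<beta>"])
     (use assms in \<open>auto intro!: derivative_eq_intros\<close>)

lemma steers_sine:
  assumes "a < b" "continuous_on UNIV (f w)" "k \<noteq> 0"
    "\<And>\<phi>. f w \<phi> = (s / (b - a) * sin (k * \<phi> $ l)) *\<^sub>R axis l 1"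
  shows "steers f a b (push l (\<lambda>\<phi>. sine_flow_shift k s (\<phi> $ l)))"
proof (rule steers_constant_control[where w = w and \<Psi> = "\<lambda>t. push l (\<lambda>\<phi>. sine_flow_shift k (s / (b - a) * t) (\<phi> $ l))"])
  show "((\<lambda>t. push l (\<lambda>\<phi>. sine_flow_shift k (s / (b - a) * t) (\<phi> $ l)) x) has_vector_derivative
     f w (push l (\<lambda>\<phi>. sine_flow_shift k (s / (b - a) * t) (\<phi> $ l)) x)) (at t)" for t x
    unfolding assms(4) push_nth if_P[OF refl] unfolding push_def
    by (intro has_vector_derivative_along_axis sine_flow_shift_deriv assms)
qed (use assms in \<open>auto simp: push_def sine_flow_shift_def\<close>)

lemma steers_shear:
  fixes l :: "'d::finite"
  assumes "a < b" "continuous_on UNIV (f w)"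
    "\<And>\<phi>. f w \<phi> = (s / (b - a) * (\<Sum>j\<in>- {l}. sin (\<phi> $ j))) *\<^sub>R axis l 1"
  shows "steers f a b (push l (\<lambda>\<phi>. s * (\<Sum>j\<in>- {l}. sin (\<phi> $ j))))"
proof (rule steers_constant_control[where w = w and \<Psi> = "\<lambda>t. push l (\<lambda>\<phi>. s / (b - a) * (\<Sum>j\<in>- {l}. sin (\<phi> $ j)) * t)"])
  have eq: "(\<Sum>j\<in>- {l}. sin (push l g x $ j)) = (\<Sum>j\<in>- {l}. sin (x $ j))" for g and x :: "real ^ 'd"
    by (intro sum.cong) (auto simp: push_nth)
  show "((\<lambda>t. push l (\<lambda>\<phi>. s / (b - a) * (\<Sum>j\<in>- {l}. sin (\<phi> $ j)) * t) x) has_vector_derivative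
     f w (push l (\<lambda>\<phi>. s / (b - a) * (\<Sum>j\<in>- {l}. sin (\<phi> $ j)) * t) x)) (at t)" for t x
    unfolding assms(3) eq unfolding push_def
    by (intro has_vector_derivative_along_axis) (use assms(1) in \<open>auto intro!: derivative_eq_intros\<close>)
qed (use assms in \<open>auto simp: push_def\<close>)

lemma attainable_steers_A:
  assumes "G \<in> attainable" "a < b"
  shows "steers system_A a b G"
  using assms
proof (induction arbitrary: a b)
  case (translation \<beta>)
  show ?case
    by (rule steers_translation[where w = "((1 / (b - a)) *\<^sub>R \<beta>, 0, 0, 0)", OF translation continuous_system_A])
       (simp add: system_A_def vec_eq_iff)
next
  case (sine k l s)
  let ?w = "if k = 1 then (0, (s / (b - a)) *\<^sub>R axis l 1, 0, 0) else (0, 0, (s / (b - a)) *\<^sub>R axis l 1, 0)"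
  show ?case
    by (rule steers_sine[where w = ?w, OF sine(2) continuous_system_A])
       (use sine(1) in \<open>auto simp: system_A_def vec_eq_iff axis_def\<close>)
next
  case (shear l s)
  have split: "(\<Sum>j\<in>UNIV. sin (\<phi> $ j)) = sin (\<phi> $ l) + (\<Sum>j\<in>- {l}. sin (\<phi> $ j))" for \<phi> :: "real ^ 'a"
    using sum.remove[of UNIV l "\<lambda>j. sin (\<phi> $ j)"] by (simp add: Compl_eq_Diff_UNIV)
  \<comment> \<open>The control \<open>v\<close> alone would include
    \<open>sin (\<phi> $ l)\<close>; the opposite value of \<open>u1\<close> cancels that
    summand.\<close>
  show ?case
    by (rule steers_shear[where w = "(0, - (s / (b - a)) *\<^sub>R axis l 1, 0, (s / (b - a)) *\<^sub>R axis l 1)", OF shear continuous_system_A])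
       (auto simp: system_A_def vec_eq_iff axis_def split algebra_simps)
next
  case (comp F H)
  have "steers system_A a ((a + b) / 2) H" "steers system_A ((a + b) / 2) b F"
    using comp by auto
  then show ?case using comp(5) by (intro steers_comp) auto
qed

lemma attainable_steers_B:
  assumes "G \<in> attainable" "a < b"
  shows "steers system_B a b G"
  using assms
proof (induction arbitrary: a b)
  case (translation \<beta>)
  show ?case
    by (rule steers_translation[where w = "(1 / (b - a) * \<beta> $ 1, 0, 0)", OF translation continuous_system_B])
       (simp add: system_B_def vec_eq_iff)
next
  case (sine k l s)
  let ?w = "if k = 1 then (0, s / (b - a), 0) else (0, 0, s / (b - a))"
  have l: "\<phi> $ l = \<phi> $ 1" for \<phi> :: "real ^ 1"
    by (rule arg_cong[of l 1 "($) \<phi>"]) (simp add: num1_eq_iff)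
  show ?case
    by (rule steers_sine[where w = ?w, OF sine(2) continuous_system_B])
       (use sine(1) l in \<open>auto simp: system_B_def vec_eq_iff axis_def\<close>)
next
  case (shear l s)
  \<comment> \<open>On the circle there is no other angle: the shear is the identity, produced by
    the zero control.\<close>
  have "- {l} = {}" by (auto simp: num1_eq_iff)
  then show ?case
    by (intro steers_shear[where w = 0, OF shear continuous_system_B])
       (auto simp: system_B_def vec_eq_iff zero_prod_def)
next
  case (comp F H)
  have "steers system_B a ((a + b) / 2) H" "steers system_B ((a + b) / 2) b F"
    using comp by auto
  then show ?case using comp(5) by (intro steers_comp) auto
qed

section \<open>From maps of the covering to controllability on the torus\<close>

lemma C0_approx_controllable_if_steers:
  fixes f :: "'c::euclidean_space \<Rightarrow> real ^ 'd \<Rightarrow> real ^ ('d::finite)"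
  assumes f: "\<And>G a b. G \<in> attainable \<Longrightarrow> a < b \<Longrightarrow> steers f a b G" and T: "T > 0"
  shows "C0_approx_controllable f T"
  unfolding C0_approx_controllable_def
proof (intro ballI allI impI)
  fix Q :: "'d torus \<Rightarrow> 'd torus" and \<epsilon> :: real assume Q: "Q \<in> Diff0" and \<epsilon>: "\<epsilon> > 0"
  obtain G where G: "G \<in> attainable" "\<And>\<phi>. norm (in_angles Q \<phi> - embed (G \<phi>)) \<le> \<epsilon> / 4"
    using Diff0_approximable[OF Q] \<epsilon> unfolding approximable_def by (meson divide_pos_pos zero_less_numeral)
  obtain u \<Phi> where u: "u absolutely_integrable_on {0..T}"
     "\<And>x. \<Phi> 0 x = x" "\<And>x. \<Phi> T x = G x" "\<And>x. continuous_on {0..T} (\<lambda>t. \<Phi> t x)"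
     "\<And>x t. t \<in> {0..T} \<Longrightarrow> (\<lambda>s. f (u s) (\<Phi> s x)) absolutely_integrable_on {0..t}"
     "\<And>x t. t \<in> {0..T} \<Longrightarrow> ((\<lambda>s. f (u s) (\<Phi> s x)) has_integral (\<Phi> t x - x)) {0..t}"
    using f[OF G(1) T] unfolding steers_def by blast
  \<comment> \<open>Any choice of preimages serves: a flow is defined by the trajectory of each
    point separately.\<close>
  obtain lift :: "'d torus \<Rightarrow> real ^ 'd" where lift: "\<And>p. angle (lift p) = p" using obtain_angle by metis
  define P where "P t p = angle (\<Phi> t (lift p))" for t p
  have "solution f T u (\<lambda>t. \<Phi> t (lift p))" for p
    unfolding solution_def using u by auto
  then have "is_flow f T u P"
    unfolding is_flow_def trajectory_def P_def using lift u(2) by auto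
  moreover have "control T u" using u(1) by (simp add: control_def)
  moreover have "(SUP x. torus_dist (Q x) (P T x)) < \<epsilon>"
  proof -
    have "torus_dist (Q p) (P T p) \<le> \<epsilon> / 2" for p
      using torus_dist_le[of "Q p" "G (lift p)"] G(2)[of "lift p"] by (simp add: P_def u(3) in_angles_apply lift)
    then have "(SUP x. torus_dist (Q x) (P T x)) \<le> \<epsilon> / 2" by (intro cSUP_least) auto
    then show ?thesis using \<epsilon> by simp
  qed
  ultimately show "\<exists>u P. control T u \<and> is_flow f T u P \<and> (SUP x. torus_dist (Q x) (P T x)) < \<epsilon>" by blast
qed

lemma steerable_if_attainable:
  fixes f :: "'c::euclidean_space \<Rightarrow> real ^ 'd \<Rightarrow> real ^ ('d::finite)"
  assumes f: "\<And>G a b. G \<in> attainable \<Longrightarrow> a < b \<Longrightarrow> steers f a b G" and T: "T > 0"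
    and G: "G \<in> attainable" "\<And>k. k \<in> {1..N} \<Longrightarrow> x k = angle (X k)" "\<And>k. k \<in> {1..N} \<Longrightarrow> y k = angle (G (X k))"
  shows "steerable f T N x y"
proof -
  obtain u \<Phi> where u: "u absolutely_integrable_on {0..T}"
     "\<And>x. \<Phi> 0 x = x" "\<And>x. \<Phi> T x = G x" "\<And>x. continuous_on {0..T} (\<lambda>t. \<Phi> t x)"
     "\<And>x t. t \<in> {0..T} \<Longrightarrow> (\<lambda>s. f (u s) (\<Phi> s x)) absolutely_integrable_on {0..t}"
     "\<And>x t. t \<in> {0..T} \<Longrightarrow> ((\<lambda>s. f (u s) (\<Phi> s x)) has_integral (\<Phi> t x - x)) {0..t}"
    using f[OF G(1) T] unfolding steers_def by blast
  have "solution f T u (\<lambda>t. \<Phi> t x)" for x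
    unfolding solution_def using u by auto
  then have "\<exists>\<gamma>. trajectory f T u \<gamma> \<and> \<gamma> 0 = x k \<and> \<gamma> T = y k" if "k \<in> {1..N}" for k
    using G(2,3)[OF that] u(2,3) unfolding trajectory_def
    by (intro exI[of _ "\<lambda>t. angle (\<Phi> t (X k))"]) auto
  then show ?thesis unfolding steerable_def control_def using u(1) by blast
qed

section \<open>Solving equations close to the identity\<close>

lemma near_identity_surjective:
  fixes F :: "('b \<Rightarrow> real) \<Rightarrow> 'b \<Rightarrow> real"
  assumes r: "r > 0"
    and contr: "\<And>s s' M a. (\<forall>a\<in>I. \<bar>s a\<bar> \<le> r) \<Longrightarrow> (\<forall>a\<in>I. \<bar>s' a\<bar> \<le> r) \<Longrightarrow> (\<forall>a\<in>I. \<bar>s a - s' a\<bar> \<le> M) \<Longrightarrow> a \<in> I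
       \<Longrightarrow> \<bar>F s a - F s' a - (s a - s' a)\<bar> \<le> M / 2"
    and F0: "\<And>a. a \<in> I \<Longrightarrow> F (\<lambda>a. 0) a = 0"
    and y: "\<And>a. a \<in> I \<Longrightarrow> \<bar>y a\<bar> \<le> r / 2"
  shows "\<exists>s. (\<forall>a\<in>I. \<bar>s a\<bar> \<le> r) \<and> (\<forall>a\<in>I. F s a = y a)"
proof -
  \<comment> \<open>Iterates \<open>s - (F s - y)\<close>. Since \<open>F\<close> differs from the
    identity by a map with constant 1/2 in the maximum norm over \<open>I\<close>, the bounds on
    successive steps halve. With \<open>q n = r / 2^n\<close> the n-th iterate stays within
    \<open>r - q n\<close>, so the iteration never leaves the box of radius
    \<open>r\<close>.\<close>
  define \<sigma> where "\<sigma> = rec_nat (\<lambda>a. 0) (\<lambda>n s a. s a - (F s a - y a))"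
  have \<sigma>: "\<sigma> 0 = (\<lambda>a. 0)" "\<sigma> (Suc n) = (\<lambda>a. \<sigma> n a - (F (\<sigma> n) a - y a))" for n
    by (simp_all add: \<sigma>_def)
  define q where "q n = r * (1 / 2) ^ n" for n :: nat
  have q: "q 0 = r" "q (Suc n) = q n / 2" "q n > 0" for n using r by (auto simp: q_def)
  have inv: "\<forall>a\<in>I. \<bar>\<sigma> n a\<bar> \<le> r - q n \<and> \<bar>\<sigma> (Suc n) a - \<sigma> n a\<bar> \<le> q n / 2" for n
  proof (induction n)
    case 0
    then show ?case using F0 y by (simp add: \<sigma> q)
  next
    case (Suc n)
    have b: "\<forall>a\<in>I. \<bar>\<sigma> n a\<bar> \<le> r" "\<forall>a\<in>I. \<bar>\<sigma> (Suc n) a\<bar> \<le> r - q n / 2"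
      "\<forall>a\<in>I. \<bar>\<sigma> (Suc n) a - \<sigma> n a\<bar> \<le> q n / 2"
    proof -
      show "\<forall>a\<in>I. \<bar>\<sigma> n a\<bar> \<le> r" using Suc q(3)[of n] by force
      show "\<forall>a\<in>I. \<bar>\<sigma> (Suc n) a\<bar> \<le> r - q n / 2"
      proof
        fix a assume "a \<in> I"
        from bspec[OF Suc this] show "\<bar>\<sigma> (Suc n) a\<bar> \<le> r - q n / 2" by linarith
      qed
    qed (use Suc in blast)
    have b': "\<forall>a\<in>I. \<bar>\<sigma> (Suc n) a\<bar> \<le> r" using b(2) q(3)[of n] by force
    show ?case
    proof (intro ballI conjI)
      fix a assume a: "a \<in> I"
      show "\<bar>\<sigma> (Suc n) a\<bar> \<le> r - q (Suc n)" using b(2) a by (simp add: q)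
      have "\<sigma> (Suc (Suc n)) a - \<sigma> (Suc n) a = - (F (\<sigma> (Suc n)) a - F (\<sigma> n) a - (\<sigma> (Suc n) a - \<sigma> n a))"
        unfolding \<sigma>(2)[of "Suc n"] using fun_cong[OF \<sigma>(2)[of n], of a] by simp
      then show "\<bar>\<sigma> (Suc (Suc n)) a - \<sigma> (Suc n) a\<bar> \<le> q (Suc n) / 2"
        using contr[OF b' b(1) b(3) a] q(2)[of n] by linarith
    qed
  qed
  have tail: "\<bar>\<sigma> (n + m) a - \<sigma> n a\<bar> \<le> q n - q (n + m)" if "a \<in> I" for n m a
  proof (induction m)
    case (Suc m)
    have "\<bar>\<sigma> (Suc (n + m)) a - \<sigma> (n + m) a\<bar> \<le> q (n + m) / 2" using inv[of "n + m"] that by blast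
    then show ?case unfolding add_Suc_right using Suc q(2)[of "n + m"] by linarith
  qed simp
  have q0: "q \<longlonglongrightarrow> 0" unfolding q_def by (intro tendsto_mult_right_zero LIMSEQ_power_zero) auto
  have "convergent (\<lambda>n. \<sigma> n a)" if a: "a \<in> I" for a
  proof (rule Cauchy_convergent, rule metric_CauchyI)
    fix e :: real assume "e > 0"
    then obtain n' where n': "q n' < e / 2"
      using order_tendstoD(2)[OF q0, of "e / 2"] by (auto simp: eventually_sequentially)
    have "dist (\<sigma> m a) (\<sigma> k a) < e" if "n' \<le> m" "n' \<le> k" for m k
      using tail[OF a, of n' "m - n'"] tail[OF a, of n' "k - n'"] that q(3)[of m] q(3)[of k] n' by (simp add: dist_real_def)
    then show "\<exists>M. \<forall>m\<ge>M. \<forall>k\<ge>M. dist (\<sigma> m a) (\<sigma> k a) < e" by blast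
  qed
  then obtain \<tau> where \<tau>: "\<And>a. a \<in> I \<Longrightarrow> (\<lambda>n. \<sigma> n a) \<longlonglongrightarrow> \<tau> a" unfolding convergent_def by metis
  have \<tau>_near: "\<bar>\<tau> a - \<sigma> n a\<bar> \<le> q n" if a: "a \<in> I" for a n
  proof (rule LIMSEQ_le_const2)
    show "(\<lambda>k. \<bar>\<sigma> (k + n) a - \<sigma> n a\<bar>) \<longlonglongrightarrow> \<bar>\<tau> a - \<sigma> n a\<bar>"
      by (intro tendsto_intros LIMSEQ_ignore_initial_segment \<tau>[OF a])
    show "\<exists>N. \<forall>k\<ge>N. \<bar>\<sigma> (k + n) a - \<sigma> n a\<bar> \<le> q n"
    proof (intro exI allI impI)
      fix k
      show "\<bar>\<sigma> (k + n) a - \<sigma> n a\<bar> \<le> q n"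
        using tail[OF a, of n k] q(3)[of "n + k"] by (simp add: add.commute)
    qed
  qed
  have \<tau>_r: "\<forall>a\<in>I. \<bar>\<tau> a\<bar> \<le> r" using \<tau>_near[of _ 0] by (simp add: \<sigma> q)
  have "F \<tau> a = y a" if a: "a \<in> I" for a
  proof -
    have "\<bar>F \<tau> a - y a\<bar> \<le> 2 * q n" for n
    proof -
      have "\<forall>a\<in>I. \<bar>\<sigma> n a\<bar> \<le> r" using inv[of n] q(3)[of n] by force
      from contr[OF \<tau>_r this, of "q n" a] have "\<bar>F \<tau> a - F (\<sigma> n) a - (\<tau> a - \<sigma> n a)\<bar> \<le> q n / 2" using \<tau>_near a by blast
      moreover have "\<bar>F (\<sigma> n) a - y a\<bar> \<le> q n / 2" using inv[of n] a by (auto simp: \<sigma>(2) abs_minus_commute)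
      ultimately show ?thesis using \<tau>_near[OF a, of n] by linarith
    qed
    moreover have "(\<lambda>n. 2 * q n) \<longlonglongrightarrow> 2 * 0" by (intro tendsto_intros q0)
    ultimately have "\<bar>F \<tau> a - y a\<bar> \<le> 2 * 0" using LIMSEQ_le_const by blast
    then show ?thesis by simp
  qed
  then show ?thesis using \<tau>_r by blast
qed

section \<open>Orbits of configurations\<close>

text \<open>Distinctness is required on the torus although the points are lifts. Indices run from 0,
  in contrast to the ensembles, which are indexed by \<open>{1..N}\<close>.\<close>

definition distinct_points :: "nat \<Rightarrow> (nat \<Rightarrow> real ^ ('d::finite)) \<Rightarrow> bool" where
  "distinct_points N X \<longleftrightarrow> (\<forall>i<N. \<forall>j<N. i \<noteq> j \<longrightarrow> embed (X i) \<noteq> embed (X j))"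

definition same_orbit :: "nat \<Rightarrow> (nat \<Rightarrow> real ^ ('d::finite)) \<Rightarrow> (nat \<Rightarrow> real ^ 'd) \<Rightarrow> bool" where
  "same_orbit N X Y \<longleftrightarrow> (\<exists>G\<in>attainable. \<forall>i<N. G (X i) = Y i)"

lemma same_orbit_sym: "same_orbit N X Y \<Longrightarrow> same_orbit N Y X"
  unfolding same_orbit_def using attainable_inverse by metis

lemma same_orbit_trans: "same_orbit N X Y \<Longrightarrow> same_orbit N Y Z \<Longrightarrow> same_orbit N X Z"
  unfolding same_orbit_def
proof (elim bexE)
  fix G H assume "G \<in> attainable" "\<forall>i<N. G (X i) = Y i" "H \<in> attainable" "\<forall>i<N. H (Y i) = Z i"
  then show "\<exists>G\<in>attainable. \<forall>i<N. G (X i) = Z i" by (intro bexI[of _ "H \<circ> G"] attainable.comp) auto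
qed

text \<open>The field is a tent function of the distance to \<open>X i\<close> in the embedding,
  periodic and Lipschitz, which vanishes from distance \<open>\<rho>\<close> on and hence at all
  other points.\<close>

lemma bump_exists:
  fixes X :: "nat \<Rightarrow> real ^ ('d::finite)"
  assumes X: "distinct_points N X" and i: "i < N"
  shows "\<exists>Z. att.tangent Z \<and> (\<forall>j<N. Z (X j) = (if j = i then axis k 1 else 0))"
proof -
  \<comment> \<open>The element 1 keeps the set nonempty when there is no other point.\<close>
  define D where "D = insert 1 ((\<lambda>j. norm (embed (X j) - embed (X i))) ` {j. j < N \<and> j \<noteq> i})"
  define \<rho> where "\<rho> = Min D"
  have fin: "finite D" unfolding D_def by simp
  have "\<forall>t\<in>D. t > 0" using X i unfolding D_def distinct_points_def by auto
  then have \<rho>: "\<rho> > 0" unfolding \<rho>_def using fin by (simp add: D_def)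
  have far: "norm (embed (X j) - embed (X i)) \<ge> \<rho>" if "j < N" "j \<noteq> i" for j
    unfolding \<rho>_def using fin that by (intro Min_le) (auto simp: D_def)
  define b where "b \<phi> = max 0 (1 - norm (embed \<phi> - embed (X i)) / \<rho>)" for \<phi>
  have "att.tangent (\<lambda>\<phi>. b \<phi> *\<^sub>R axis k 1)"
  proof (rule tangent_scalar)
    show "periodic b" using periodic_embed unfolding periodic_def b_def by auto
    fix x y :: "real ^ 'd"
    have "\<bar>b x - b y\<bar> \<le> \<bar>norm (embed x - embed (X i)) / \<rho> - norm (embed y - embed (X i)) / \<rho>\<bar>"
      unfolding b_def by (auto simp: max_def)
    also have "\<dots> = \<bar>norm (embed x - embed (X i)) - norm (embed y - embed (X i))\<bar> / \<rho>"
      using \<rho> by (simp add: diff_divide_distrib[symmetric])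
    also have "\<dots> \<le> norm (x - y) / \<rho>"
      using \<rho> norm_triangle_ineq3[of "embed x - embed (X i)" "embed y - embed (X i)"] norm_embed_diff_le[of x y]
      by (intro divide_right_mono) auto
    finally show "\<bar>b x - b y\<bar> \<le> 1 / \<rho> * norm (x - y)" by simp
  qed (use \<rho> in simp)
  moreover have "b (X j) = (if j = i then 1 else 0)" if "j < N" for j
    using far[OF that] \<rho> by (auto simp: b_def max_def)
  ultimately show ?thesis by (intro exI[of _ "\<lambda>\<phi>. b \<phi> *\<^sub>R axis k 1"]) auto
qed

text \<open>One bump field for each point and each coordinate direction gives
  \<open>N * CARD('d)\<close> parameters. At the configuration the combination of the fields has the
  parameters themselves as coordinates, so the map from parameters to configurations differs from
  the identity by a map with constant 1/2, and nearby targets are hit exactly.\<close>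

lemma orbit_open:
  fixes X :: "nat \<Rightarrow> real ^ ('d::finite)"
  assumes X: "distinct_points N X"
  shows "\<exists>r>0. \<forall>Y. (\<forall>i<N. norm (Y i - X i) \<le> r) \<longrightarrow> same_orbit N X Y"
proof -
  define I where "I = {..<N} \<times> (UNIV :: 'd set)"
  have "finite I" unfolding I_def by simp
  then obtain L where L: "set L = I" "distinct L" using finite_distinct_list by blast
  have "\<forall>a. \<exists>Z. fst a < N \<longrightarrow> att.tangent Z \<and> (\<forall>j<N. Z (X j) = (if j = fst a then axis (snd a) 1 else 0))"
    using bump_exists[OF X] by blast
  then obtain Z where Z: "\<And>a. fst a < N \<Longrightarrow> att.tangent (Z a)"
      "\<And>a j. fst a < N \<Longrightarrow> j < N \<Longrightarrow> Z a (X j) = (if j = fst a then axis (snd a) 1 else 0)"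
    by metis
  have tan: "att.tangent (Z a)" if "a \<in> set L" for a using that L Z(1) by (auto simp: I_def)
  have half: "(1 / 2 :: real) > 0" by simp
  obtain d \<Psi> where d: "d > 0" and \<Psi>: "att.parameter_family (1 / 2) L Z d \<Psi>"
    using att.parameter_family_exists[of L Z "1 / 2", OF tan half] by blast
  note \<Psi> = att.parameter_familyD[OF \<Psi>]
  have sum: "(\<Sum>a\<leftarrow>L. c a *\<^sub>R Z a (X j)) $ k = c (j, k)" if "j < N" for c j k
  proof -
    have "(\<Sum>a\<leftarrow>L. c a *\<^sub>R Z a (X j)) = (\<Sum>a\<in>I. c a *\<^sub>R Z a (X j))"
      using L by (simp add: sum_list_distinct_conv_sum_set)
    also have "\<dots> $ k = (\<Sum>a\<in>I. if a = (j, k) then c (j, k) else 0)"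
      unfolding sum_component using that Z(2) by (intro sum.cong) (auto simp: I_def axis_def split: if_splits)
    also have "\<dots> = c (j, k)" using that \<open>finite I\<close> by (simp add: I_def)
    finally show ?thesis .
  qed
  have "same_orbit N X Y" if Y: "\<forall>i<N. norm (Y i - X i) \<le> d / 2" for Y
  proof -
    define F where "F s a = (\<Psi> s (X (fst a)) - X (fst a)) $ snd a" for s a
    have "\<exists>s. (\<forall>a\<in>I. \<bar>s a\<bar> \<le> d) \<and> (\<forall>a\<in>I. F s a = (Y (fst a) - X (fst a)) $ snd a)"
    proof (rule near_identity_surjective[OF d])
      fix s s' :: "nat \<times> 'd \<Rightarrow> real" and M a
      assume s: "\<forall>a\<in>I. \<bar>s a\<bar> \<le> d" "\<forall>a\<in>I. \<bar>s' a\<bar> \<le> d" "\<forall>a\<in>I. \<bar>s a - s' a\<bar> \<le> M" and a: "a \<in> I"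
      have M: "M \<ge> 0" using s(3) a abs_ge_zero order_trans by blast
      have j: "fst a < N" using a by (auto simp: I_def)
      let ?v = "\<Psi> s (X (fst a)) - \<Psi> s' (X (fst a)) - (\<Sum>b\<leftarrow>L. (s b - s' b) *\<^sub>R Z b (X (fst a)))"
      have "norm ?v \<le> 1 / 2 * M" using s M L by (intro \<Psi>(3)) auto
      then have "\<bar>?v $ snd a\<bar> \<le> 1 / 2 * M" using component_le_norm_cart[of ?v "snd a"] by linarith
      moreover have "?v $ snd a = F s a - F s' a - (s a - s' a)"
        using sum[OF j, of "\<lambda>b. s b - s' b" "snd a"] by (simp add: F_def)
      ultimately show "\<bar>F s a - F s' a - (s a - s' a)\<bar> \<le> M / 2" by simp
    next
      fix a assume "a \<in> I"
      then show "F (\<lambda>a. 0) a = 0" using \<Psi>(2) by (simp add: F_def)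
    next
      fix a assume "a \<in> I"
      then have "norm (Y (fst a) - X (fst a)) \<le> d / 2" using Y by (auto simp: I_def)
      then show "\<bar>(Y (fst a) - X (fst a)) $ snd a\<bar> \<le> d / 2"
        using component_le_norm_cart[of "Y (fst a) - X (fst a)" "snd a"] by linarith
    qed
    then obtain s where s: "\<forall>a\<in>I. \<bar>s a\<bar> \<le> d" "\<And>a. a \<in> I \<Longrightarrow> F s a = (Y (fst a) - X (fst a)) $ snd a" by blast
    have "\<Psi> s (X i) = Y i" if "i < N" for i
    proof -
      have "(\<Psi> s (X i)) $ k = Y i $ k" for k using s(2)[of "(i, k)"] that by (simp add: I_def F_def)
      then show ?thesis by (simp add: vec_eq_iff)
    qed
    moreover have "\<Psi> s \<in> attainable" using \<Psi>(1) s(1) L by blast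
    ultimately show ?thesis unfolding same_orbit_def by blast
  qed
  then show ?thesis using d by (intro exI[of _ "d / 2"]) auto
qed

lemma same_orbit_segment:
  fixes X Y :: "nat \<Rightarrow> real ^ ('d::finite)"
  assumes dist: "\<And>t. 0 \<le> t \<Longrightarrow> t \<le> 1 \<Longrightarrow> distinct_points N (\<lambda>i. X i + t *\<^sub>R (Y i - X i))"
  shows "same_orbit N X Y"
proof -
  let ?c = "\<lambda>t i. X i + t *\<^sub>R (Y i - X i)"
  define B where "B = (\<Sum>i<N. norm (Y i - X i)) + 1"
  have B: "B > 0" "\<And>i. i < N \<Longrightarrow> norm (Y i - X i) \<le> B"
  proof -
    show "B > 0" unfolding B_def by (simp add: sum_nonneg add_nonneg_pos)
    fix i assume "i < N"
    then have "norm (Y i - X i) \<le> (\<Sum>i<N. norm (Y i - X i))" by (intro member_le_sum) auto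
    then show "norm (Y i - X i) \<le> B" unfolding B_def by simp
  qed
  have "same_orbit N (?c 0) (?c 1)"
  proof (rule connected_equivalence_relation[where S = "{0..1::real}" and R = "\<lambda>s t. same_orbit N (?c s) (?c t)"])
    fix t :: real assume t: "t \<in> {0..1}"
    then obtain r where r: "r > 0" "\<And>Z. (\<forall>i<N. norm (Z i - ?c t i) \<le> r) \<Longrightarrow> same_orbit N (?c t) Z"
      using orbit_open[OF dist, of t] by auto
    show "\<exists>T. openin (top_of_set {0..1}) T \<and> t \<in> T \<and> (\<forall>s\<in>T. same_orbit N (?c t) (?c s))"
    proof (intro exI[of _ "{0..1} \<inter> ball t (r / B)"] conjI ballI)
      fix s assume "s \<in> {0..1} \<inter> ball t (r / B)"
      then have s: "\<bar>s - t\<bar> * B \<le> r" using B(1) by (auto simp: dist_real_def field_simps abs_minus_commute)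
      have "norm (?c s i - ?c t i) \<le> r" if "i < N" for i
      proof -
        have "?c s i - ?c t i = (s - t) *\<^sub>R (Y i - X i)" by (simp add: algebra_simps)
        then have "norm (?c s i - ?c t i) = \<bar>s - t\<bar> * norm (Y i - X i)" by simp
        also have "\<dots> \<le> \<bar>s - t\<bar> * B" using B(2)[OF that] by (intro mult_left_mono) auto
        finally show ?thesis using s by linarith
      qed
      then show "same_orbit N (?c t) (?c s)" by (intro r(2)) auto
    qed (use t r B in \<open>auto simp: openin_open_Int\<close>)
  qed (auto intro: same_orbit_sym same_orbit_trans)
  then show ?thesis by simp
qed

section \<open>Transitivity in dimension greater than one\<close>

lemma countable_lattice: "countable {n :: real ^ ('d::finite). \<forall>i. n $ i \<in> \<int>}"
proof -
  have "{n :: real ^ 'd. \<forall>i. n $ i \<in> \<int>} \<subseteq> range (\<lambda>g :: 'd \<Rightarrow> int. \<chi> i. of_int (g i))"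
  proof
    fix n :: "real ^ 'd" assume "n \<in> {n. \<forall>i. n $ i \<in> \<int>}"
    then have "\<forall>i. \<exists>g. n $ i = of_int g" by (auto elim: Ints_cases)
    then obtain g where "\<forall>i. n $ i = of_int (g i)" by metis
    then have "n = (\<chi> i. of_int (g i))" by (simp add: vec_eq_iff)
    then show "n \<in> range (\<lambda>g :: 'd \<Rightarrow> int. \<chi> i. of_int (g i))" by blast
  qed
  then show ?thesis by (rule countable_subset) simp
qed

lemma same_orbit_move_one:
  fixes X :: "nat \<Rightarrow> real ^ ('d::finite)"
  assumes d: "CARD('d) > 1" and i: "i < N" and X: "distinct_points N X" and q: "distinct_points N (X(i := q))"
  shows "same_orbit N X (X(i := q))"
proof -
  \<comment> \<open>Forbidden positions on the covering: all lattice translates of the other points.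
    They are countable, so the complement is connected when the dimension exceeds one.\<close>
  define C where "C = (\<Union>j\<in>{..<N} - {i}. {p. embed p = embed (X j)})"
  have "{p. embed p = embed (X j)} = (\<lambda>n. X j + (2 * pi) *\<^sub>R n) ` {n. \<forall>i. n $ i \<in> \<int>}" for j
    unfolding embed_eq_iff by auto
  then have "countable C" unfolding C_def using countable_lattice by (intro countable_UN) auto
  then have "connected (- C)" using d by (intro path_connected_imp_connected path_connected_complement_countable) auto
  moreover have "p \<in> - C \<longleftrightarrow> distinct_points N (X(i := p))" for p
  proof
    assume "distinct_points N (X(i := p))"
    then have "embed p \<noteq> embed (X j)" if "j < N" "j \<noteq> i" for j
    proof -
      have "embed ((X(i := p)) i) \<noteq> embed ((X(i := p)) j)"
        using \<open>distinct_points N (X(i := p))\<close> that i unfolding distinct_points_def by blast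
      then show ?thesis using that by simp
    qed
    then show "p \<in> - C" by (auto simp: C_def)
  next
    assume p: "p \<in> - C"
    show "distinct_points N (X(i := p))"
      unfolding distinct_points_def
    proof (intro allI impI)
      fix j k assume jk: "j < N" "k < N" "j \<noteq> k"
      have "embed p \<noteq> embed (X j)" if "j < N" "j \<noteq> i" for j using p that by (auto simp: C_def)
      then show "embed ((X(i := p)) j) \<noteq> embed ((X(i := p)) k)"
        using X jk unfolding distinct_points_def by (cases "j = i"; cases "k = i") (auto simp: eq_commute)
    qed
  qed
  note C = this
  have "X i \<in> - C" "q \<in> - C" using C X q by auto
  have "same_orbit N (X(i := X i)) (X(i := q))"
  proof (rule connected_equivalence_relation[where S = "- C" and R = "\<lambda>p q. same_orbit N (X(i := p)) (X(i := q))"])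
    fix p assume p: "p \<in> - C"
    then obtain r where r: "r > 0" "\<And>Z. (\<forall>j<N. norm (Z j - (X(i := p)) j) \<le> r) \<Longrightarrow> same_orbit N (X(i := p)) Z"
      using orbit_open[of N "X(i := p)"] C by auto
    show "\<exists>T. openin (top_of_set (- C)) T \<and> p \<in> T \<and> (\<forall>s\<in>T. same_orbit N (X(i := p)) (X(i := s)))"
    proof (intro exI[of _ "(- C) \<inter> ball p r"] conjI ballI)
      fix s assume "s \<in> (- C) \<inter> ball p r"
      then show "same_orbit N (X(i := p)) (X(i := s))"
        using r(1) by (intro r(2)) (auto simp: dist_norm norm_minus_commute)
    qed (use p r in \<open>auto simp: openin_open_Int\<close>)
  qed (use \<open>connected (- C)\<close> \<open>X i \<in> - C\<close> \<open>q \<in> - C\<close> in \<open>auto intro: same_orbit_sym same_orbit_trans\<close>)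
  then show ?thesis by simp
qed

text \<open>Attainable maps commute with deck transformations, hence act on the torus. For the sine
  flow of frequency \<open>w\<close> this rests on \<open>w\<close> being an integer.\<close>

lemma attainable_equivariant:
  assumes "G \<in> attainable" "\<forall>i. n $ i \<in> \<int>"
  shows "G (x + (2 * pi) *\<^sub>R n) = G x + (2 * pi) *\<^sub>R n"
  using assms
proof (induction arbitrary: x)
  case (sine w l s)
  have "w \<in> \<int>" "n $ l \<in> \<int>" using sine by auto
  then have "w * n $ l \<in> \<int>" by (rule Ints_mult)
  then obtain m :: int where m: "w * n $ l = of_int m" by (auto elim: Ints_cases)
  have "sine_flow (w * s) (w * (x $ l + 2 * pi * n $ l)) = sine_flow (w * s) (w * x $ l) + 2 * pi * of_int m"
  proof -
    have 1: "w * (x $ l + 2 * pi * n $ l) = w * x $ l + 2 * pi * of_int m"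
      unfolding m[symmetric] by (simp add: algebra_simps)
    have "sin (w * x $ l + 2 * pi * of_int m) = sin (w * x $ l)" "cos (w * x $ l + 2 * pi * of_int m) = cos (w * x $ l)"
      by (simp_all add: sin_add cos_add sin_int_2pin cos_int_2pin)
    then show ?thesis unfolding 1 sine_flow_def by simp
  qed
  then have "sine_flow_shift w s (x $ l + 2 * pi * n $ l) = sine_flow_shift w s (x $ l)"
    using sine(1) m unfolding sine_flow_shift_def by (auto simp: field_simps)
  then show ?case by (simp add: vec_eq_iff push_nth)
next
  case (shear l s)
  have "sin (x $ j + 2 * pi * n $ j) = sin (x $ j)" for j
  proof -
    from shear have "n $ j \<in> \<int>" by blast
    then obtain m :: int where "n $ j = of_int m" by (auto elim: Ints_cases)
    then show ?thesis by (simp add: sin_add sin_int_2pin cos_int_2pin)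
  qed
  then show ?case by (simp add: vec_eq_iff push_nth)
qed (auto simp: algebra_simps)

lemma attainable_embed:
  assumes G: "G \<in> attainable" and "embed x \<noteq> embed y"
  shows "embed (G x) \<noteq> embed (G y)"
proof
  assume "embed (G x) = embed (G y)"
  then obtain n where n: "\<forall>i. n $ i \<in> \<int>" "G x = G y + (2 * pi) *\<^sub>R n" unfolding embed_eq_iff by blast
  obtain H where "\<forall>x. H (G x) = x" using attainable_inverse[OF G] by blast
  then have "x = y + (2 * pi) *\<^sub>R n" using n attainable_equivariant[OF G n(1), of y] by metis
  then show False using assms(2) n(1) unfolding embed_eq_iff by blast
qed

text \<open>The first \<open>N\<close> points are brought to their targets by some \<open>G\<close>,
  which carries the last point to a place distinct from these targets on the torus; then it alone is
  moved while the others end where they are.\<close>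

lemma same_orbit_all:
  fixes X Y :: "nat \<Rightarrow> real ^ ('d::finite)"
  assumes d: "CARD('d) > 1" and X: "distinct_points N X" and Y: "distinct_points N Y"
  shows "same_orbit N X Y"
  using X Y
proof (induction N)
  case 0
  show ?case unfolding same_orbit_def using id_attainable by auto
next
  case (Suc N)
  have "distinct_points N X" "distinct_points N Y" using Suc.prems unfolding distinct_points_def by auto
  then obtain G where G: "G \<in> attainable" "\<And>i. i < N \<Longrightarrow> G (X i) = Y i" using Suc.IH unfolding same_orbit_def by blast
  let ?Z = "Y(N := G (X N))"
  have Z: "G (X i) = ?Z i" if "i < Suc N" for i using G(2) that by (auto simp: less_Suc_eq)
  then have "same_orbit (Suc N) X ?Z" using G(1) unfolding same_orbit_def by blast
  moreover have "distinct_points (Suc N) ?Z"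
    unfolding distinct_points_def
  proof (intro allI impI)
    fix i j assume ij: "i < Suc N" "j < Suc N" "i \<noteq> j"
    then have "embed (X i) \<noteq> embed (X j)" using Suc.prems(1) unfolding distinct_points_def by blast
    from attainable_embed[OF G(1) this] show "embed (?Z i) \<noteq> embed (?Z j)" unfolding Z[OF ij(1)] Z[OF ij(2)] .
  qed
  then have "same_orbit (Suc N) ?Z (?Z(N := Y N))" by (intro same_orbit_move_one d) (use Suc.prems in auto)
  ultimately have "same_orbit (Suc N) X (?Z(N := Y N))" by (rule same_orbit_trans)
  then show ?case by simp
qed

section \<open>Cyclic order and the control system on the circle\<close>

lemma solution_increment:
  assumes \<phi>: "solution f T u \<phi>" and pq: "0 \<le> p" "p \<le> q" "q \<le> T"
  shows "((\<lambda>s. f (u s) (\<phi> s)) has_integral (\<phi> q - \<phi> p)) {p..q}"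
proof -
  let ?F = "\<lambda>s. f (u s) (\<phi> s)"
  have q: "(?F has_integral (\<phi> q - \<phi> 0)) {0..q}" and p: "(?F has_integral (\<phi> p - \<phi> 0)) {0..p}"
    using \<phi> pq unfolding solution_def by auto
  have "?F integrable_on {p..q}" by (rule integrable_subinterval_real[of _ 0 q]) (use q pq in auto)
  then have pq_int: "(?F has_integral integral {p..q} ?F) {p..q}" by (rule integrable_integral)
  have "\<phi> q - \<phi> 0 = (\<phi> p - \<phi> 0) + integral {p..q} ?F"
    by (rule has_integral_unique[OF q has_integral_combine[OF pq(1,2) p pq_int]])
  then have "integral {p..q} ?F = \<phi> q - \<phi> p" by (simp add: algebra_simps)
  with pq_int show ?thesis by simp
qed

text \<open>The Lipschitz rate \<open>g\<close> is merely integrable in time, so time is cut into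
  pieces on which its integral is at most 1/2. Running back from a time where the solutions agree,
  the maximum of their distance on a piece is at most half of itself, hence zero.\<close>

lemma solution_backward_unique:
  fixes f :: "'c \<Rightarrow> real ^ 'd \<Rightarrow> real ^ ('d::finite)"
  assumes \<phi>: "solution f T u \<phi>" and \<psi>: "solution f T u \<psi>"
    and g: "g integrable_on {0..T}" "\<And>s. g s \<ge> 0"
    and lip: "\<And>s x y. norm (f (u s) x - f (u s) y) \<le> g s * norm (x - y)"
    and t0: "0 \<le> t0" "t0 \<le> T" "\<phi> t0 = \<psi> t0"
  shows "\<phi> 0 = \<psi> 0"
proof -
  define \<gamma> where "\<gamma> t = integral {0..t} g" for t
  define D where "D t = norm (\<phi> t - \<psi> t)" for t
  have D_cont: "continuous_on {0..T} D"
    unfolding D_def using \<phi> \<psi> unfolding solution_def by (intro continuous_intros) auto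
  have "continuous_on {0..T} \<gamma>" unfolding \<gamma>_def by (rule indefinite_integral_continuous_1[OF g(1)])
  then have "uniformly_continuous_on {0..T} \<gamma>" by (rule compact_uniformly_continuous) auto
  then have "\<exists>\<delta>>0. \<forall>x\<in>{0..T}. \<forall>y\<in>{0..T}. dist y x < \<delta> \<longrightarrow> dist (\<gamma> y) (\<gamma> x) < 1 / 2"
    unfolding uniformly_continuous_on_def by (rule allE[of _ "1 / 2"]) simp
  then obtain \<delta> where \<delta>_pos: "\<delta> > 0"
    and \<delta>_close: "\<forall>x\<in>{0..T}. \<forall>y\<in>{0..T}. dist y x < \<delta> \<longrightarrow> dist (\<gamma> y) (\<gamma> x) < 1 / 2"
    by (elim exE conjE) (rule that)
  have "\<bar>\<gamma> q - \<gamma> p\<bar> \<le> 1 / 2" if "p \<in> {0..T}" "q \<in> {0..T}" "\<bar>q - p\<bar> < \<delta>" for p q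
    using \<delta>_close[THEN bspec, OF that(1), THEN bspec, OF that(2)] that(3) by (simp add: dist_real_def)
  note \<delta> = \<delta>_pos this
  have backward: "D p = 0" if q: "q \<le> T" "D q = 0" and p: "0 \<le> p" "p \<le> q" "q - p < \<delta>" for p q
  proof -
    have "continuous_on {p..q} D" by (rule continuous_on_subset[OF D_cont]) (use p q in auto)
    then obtain m where m: "m \<in> {p..q}" "\<And>s. s \<in> {p..q} \<Longrightarrow> D s \<le> D m"
      using continuous_attains_sup[of "{p..q}" D] p by auto
    let ?h = "\<lambda>s. f (u s) (\<phi> s) - f (u s) (\<psi> s)"
    have h: "(?h has_integral ((\<phi> q - \<phi> m) - (\<psi> q - \<psi> m))) {m..q}"
      using m p q by (intro has_integral_diff solution_increment[OF \<phi>] solution_increment[OF \<psi>]) auto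
    have gm: "g integrable_on {m..q}" by (rule integrable_subinterval_real[OF g(1)]) (use m p q in auto)
    have "D m = norm (integral {m..q} ?h)"
      using q(2) integral_unique[OF h] by (simp add: D_def norm_minus_commute)
    also have "\<dots> \<le> integral {m..q} (\<lambda>s. g s * D m)"
    proof (rule integral_norm_bound_integral)
      show "?h integrable_on {m..q}" using h by blast
      show "(\<lambda>s. g s * D m) integrable_on {m..q}" using gm by (rule integrable_on_mult_left)
      fix s assume s: "s \<in> {m..q}"
      have "norm (?h s) \<le> g s * D s" using lip[of s "\<phi> s" "\<psi> s"] by (simp add: D_def)
      also have "\<dots> \<le> g s * D m" using m s g(2)[of s] by (intro mult_left_mono) auto
      finally show "norm (?h s) \<le> g s * D m" .
    qed
    also have "\<dots> = integral {m..q} g * D m" by simp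
    also have "integral {m..q} g = \<gamma> q - \<gamma> m"
    proof -
      have "integral {0..m} g + integral {m..q} g = integral {0..q} g"
        by (rule Henstock_Kurzweil_Integration.integral_combine) (use m p q g(1) in \<open>auto intro: integrable_subinterval_real\<close>)
      then show ?thesis by (simp add: \<gamma>_def)
    qed
    finally have "D m \<le> (\<gamma> q - \<gamma> m) * D m" .
    moreover have "\<bar>\<gamma> q - \<gamma> m\<bar> \<le> 1 / 2" by (rule \<delta>(2)) (use m p q in auto)
    then have "\<gamma> q - \<gamma> m \<le> 1 / 2" by linarith
    then have "(\<gamma> q - \<gamma> m) * D m \<le> 1 / 2 * D m" by (rule mult_right_mono) (simp add: D_def)
    ultimately have "D m \<le> 0" by simp
    moreover have "D p \<le> D m" using m p by auto
    moreover have "D p \<ge> 0" by (simp add: D_def)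
    ultimately show ?thesis by simp
  qed
  have "D (max 0 (t0 - real n * (\<delta> / 2))) = 0" for n
  proof (induction n)
    case 0
    then show ?case using t0 by (simp add: D_def)
  next
    case (Suc n)
    define z where "z = real n * (\<delta> / 2)"
    have z: "z \<ge> 0" "real (Suc n) * (\<delta> / 2) = z + \<delta> / 2"
      using \<delta>(1) by (simp_all add: z_def distrib_right)
    show ?case unfolding z(2)
      by (rule backward[OF _ Suc[folded z_def]]) (use t0 \<delta>(1) z(1) in \<open>auto simp: max_def\<close>)
  qed
  moreover obtain n :: nat where "real n > t0 / (\<delta> / 2)" using reals_Archimedean2 by blast
  then have "t0 - real n * (\<delta> / 2) \<le> 0" using \<delta>(1) by (simp add: field_simps)
  ultimately have "D 0 = 0" by (metis max.absorb1)
  then show ?thesis by (simp add: D_def)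
qed

lemma norm_vec_1: "norm (x :: real ^ 1) = \<bar>x $ 1\<bar>"
  by (simp add: norm_vec_def L2_set_def)

lemma system_B_lipschitz: "norm (system_B w x - system_B w y) \<le> 3 * norm w * norm (x - y)"
proof -
  obtain a b c where w: "w = (a, b, c)" by (cases w)
  have bc: "\<bar>b\<bar> \<le> norm w" "\<bar>c\<bar> \<le> norm w"
    using norm_fst_le[of b c] norm_snd_le[of c b] norm_snd_le[of "(b, c)" a] unfolding w real_norm_def by linarith+
  have "(system_B w x - system_B w y) $ 1 = b * (sin (x $ 1) - sin (y $ 1)) + c * (sin (2 * x $ 1) - sin (2 * y $ 1))"
    by (simp add: w system_B_def algebra_simps)
  then have "norm (system_B w x - system_B w y) \<le> \<bar>b\<bar> * \<bar>sin (x $ 1) - sin (y $ 1)\<bar> + \<bar>c\<bar> * \<bar>sin (2 * x $ 1) - sin (2 * y $ 1)\<bar>"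
    unfolding norm_vec_1 abs_mult[symmetric] by (simp only: abs_triangle_ineq)
  also have "\<dots> \<le> norm w * \<bar>x $ 1 - y $ 1\<bar> + norm w * \<bar>2 * x $ 1 - 2 * y $ 1\<bar>"
    using bc by (intro add_mono mult_mono abs_sin_diff_le) auto
  also have "\<bar>2 * x $ 1 - 2 * y $ 1\<bar> = 2 * \<bar>x $ 1 - y $ 1\<bar>"
    unfolding right_diff_distrib[symmetric] abs_mult by simp
  also have "norm w * \<bar>x $ 1 - y $ 1\<bar> + norm w * (2 * \<bar>x $ 1 - y $ 1\<bar>) = 3 * norm w * norm (x - y)"
    unfolding norm_vec_1 by simp
  finally show ?thesis .
qed

text \<open>Otherwise the lifted solutions would meet at some time by the intermediate value
  theorem, and backward uniqueness would make them start together.\<close>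

lemma solution_B_order_preserving:
  assumes u: "control T u" and \<phi>: "solution system_B T u \<phi>" and \<psi>: "solution system_B T u \<psi>"
    and T: "T \<ge> 0" and less: "\<phi> 0 $ 1 < \<psi> 0 $ 1"
  shows "\<phi> T $ 1 < \<psi> T $ 1"
proof (rule ccontr)
  assume "\<not> \<phi> T $ 1 < \<psi> T $ 1"
  moreover have "continuous_on {0..T} (\<lambda>t. \<psi> t $ 1 - \<phi> t $ 1)"
    using \<phi> \<psi> unfolding solution_def by (intro continuous_intros) auto
  ultimately obtain t where t: "0 \<le> t" "t \<le> T" "\<psi> t $ 1 - \<phi> t $ 1 = 0"
    using IVT2'[of "\<lambda>t. \<psi> t $ 1 - \<phi> t $ 1" T 0 0] T less by auto
  then have "\<phi> t = \<psi> t" by (simp add: vec_eq_iff)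
  then have "\<phi> 0 = \<psi> 0"
  proof (intro solution_backward_unique[OF \<phi> \<psi> _ _ _ t(1,2), where g = "\<lambda>s. 3 * norm (u s)"])
    show "(\<lambda>s. 3 * norm (u s)) integrable_on {0..T}"
      using u unfolding control_def absolutely_integrable_on_def by (intro integrable_on_mult_right) auto
  qed (auto intro: system_B_lipschitz)
  then show False using less by simp
qed

lemma solution_B_shift:
  assumes "solution system_B T u \<phi>" "m \<in> \<int>"
  shows "solution system_B T u (\<lambda>t. \<phi> t + vec (2 * pi * m))"
proof -
  obtain k :: int where k: "m = of_int k" using assms(2) by (auto elim: Ints_cases)
  have 1: "sin (x + 2 * pi * of_int k) = sin x" for x by (simp add: sin_add sin_int_2pin cos_int_2pin)
  have "2 * (x + 2 * pi * of_int k) = 2 * x + 2 * pi * of_int (2 * k)" for x by simp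
  then have 2: "sin (2 * (x + 2 * pi * of_int k)) = sin (2 * x)" for x
    by (metis sin_add sin_int_2pin cos_int_2pin mult_1_right mult_zero_right add.right_neutral)
  have "system_B w (\<psi> + vec (2 * pi * m)) = system_B w \<psi>" for w \<psi>
    by (cases w) (simp only: system_B_def k vec_eq_iff vector_add_component vec_component vec_lambda_beta prod.case 1 2, simp)
  then show ?thesis
    using assms(1) unfolding solution_def by (auto intro!: continuous_intros)
qed

section \<open>Cyclic order in terms of lifted angles\<close>

lemma embed_vec_eq_iff: "embed (vec a :: real ^ 1) = embed (vec b) \<longleftrightarrow> (\<exists>m\<in>\<int>. a = b + 2 * pi * m)"
proof
  assume "embed (vec a :: real ^ 1) = embed (vec b)"
  then obtain n :: "real ^ 1" where "\<forall>i. n $ i \<in> \<int>" "vec a = vec b + (2 * pi) *\<^sub>R n" unfolding embed_eq_iff by blast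
  then show "\<exists>m\<in>\<int>. a = b + 2 * pi * m" by (intro bexI[of _ "n $ 1"]) (auto simp: vec_eq_iff)
next
  assume "\<exists>m\<in>\<int>. a = b + 2 * pi * m"
  then obtain m where "m \<in> \<int>" "a = b + 2 * pi * m" by blast
  then show "embed (vec a :: real ^ 1) = embed (vec b)"
    unfolding embed_eq_iff by (intro exI[of _ "vec m"]) (auto simp: vec_eq_iff)
qed

lemma angle_vec_eq_iff: "angle (vec a :: real ^ 1) = angle (vec b) \<longleftrightarrow> (\<exists>m\<in>\<int>. a = b + 2 * pi * m)"
  by (simp add: angle_eq_iff embed_vec_eq_iff)

lemma vec_nth_1: "vec (x $ 1) = (x :: real ^ 1)"
  by (simp add: vec_eq_iff)

text \<open>Representatives of the points in \<open>[0, 2 * pi)\<close> are sorted; one turn then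
  starts at the smallest.\<close>

lemma listed_along_exists:
  assumes inj: "inj_on x {1..N}"
  shows "\<exists>\<sigma>. listed_along N x \<sigma>"
proof -
  have "\<exists>r. 0 \<le> r \<and> r < 2 * pi \<and> x k = angle (vec r)" for k
  proof -
    obtain \<phi> where \<phi>: "angle \<phi> = x k" using obtain_angle by blast
    define r where "r = 2 * pi * frac (\<phi> $ 1 / (2 * pi))"
    have "0 \<le> r" "r < 2 * pi" using frac_lt_1[of "\<phi> $ 1 / (2 * pi)"] by (auto simp: r_def)
    moreover have "r = \<phi> $ 1 + 2 * pi * (- of_int \<lfloor>\<phi> $ 1 / (2 * pi)\<rfloor>)"
      by (simp add: r_def frac_def right_diff_distrib)
    then have "\<exists>m\<in>\<int>. r = \<phi> $ 1 + 2 * pi * m" by (rule bexI) auto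
    then have "angle (vec r) = angle (vec (\<phi> $ 1) :: real ^ 1)" unfolding angle_vec_eq_iff .
    then have "x k = angle (vec r)" using \<phi> by (simp add: vec_nth_1)
    ultimately show ?thesis by blast
  qed
  then obtain \<rho> where \<rho>: "\<And>k. 0 \<le> \<rho> k" "\<And>k. \<rho> k < 2 * pi" "\<And>k. x k = angle (vec (\<rho> k))" by metis
  define \<sigma> where "\<sigma> = sort_key \<rho> [1..<Suc N]"
  have \<sigma>: "distinct \<sigma>" "set \<sigma> = {1..N}" "length \<sigma> = N" "sorted (map \<rho> \<sigma>)" by (auto simp: \<sigma>_def)
  have "\<rho> (\<sigma> ! i) < \<rho> (\<sigma> ! j) \<and> \<rho> (\<sigma> ! j) < \<rho> (\<sigma> ! i) + 2 * pi" if "i < N" "j < N" "i < j" for i j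
  proof
    have "\<rho> (\<sigma> ! i) \<le> \<rho> (\<sigma> ! j)" using sorted_nth_mono[OF \<sigma>(4), of i j] that \<sigma>(3) by simp
    moreover have "\<rho> (\<sigma> ! i) \<noteq> \<rho> (\<sigma> ! j)"
    proof
      assume "\<rho> (\<sigma> ! i) = \<rho> (\<sigma> ! j)"
      then have "x (\<sigma> ! i) = x (\<sigma> ! j)" using \<rho>(3) by metis
      moreover have "\<sigma> ! i \<in> {1..N}" "\<sigma> ! j \<in> {1..N}" using \<sigma>(2,3) that nth_mem by metis+
      ultimately have "\<sigma> ! i = \<sigma> ! j" using inj by (auto dest: inj_onD)
      then show False using \<sigma>(1,3) that by (simp add: nth_eq_iff_index_eq)
    qed
    ultimately show "\<rho> (\<sigma> ! i) < \<rho> (\<sigma> ! j)" by simp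
    show "\<rho> (\<sigma> ! j) < \<rho> (\<sigma> ! i) + 2 * pi" using \<rho>(1)[of "\<sigma> ! i"] \<rho>(2)[of "\<sigma> ! j"] by linarith
  qed
  then have "listed_along N x \<sigma>"
    unfolding listed_along_def using \<sigma> \<rho>(3) by (intro conjI exI[of _ "\<lambda>i. \<rho> (\<sigma> ! i)"]) auto
  then show ?thesis by blast
qed

text \<open>The trajectories are lifted so as to start at the angles \<open>\<theta> i\<close>.
  Preservation of order gives the strict increase at time \<open>T\<close>, and comparison with a
  solution shifted by a full turn gives the bound \<open>2 * pi\<close>. The same list therefore
  lists both ensembles, with rotation 0.\<close>

lemma equally_ordered_if_steerable:
  assumes T: "T > 0" and inj: "inj_on x {1..N}" and st: "steerable system_B T N x y"
  shows "equally_ordered N x y"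
proof -
  obtain \<sigma> where "listed_along N x \<sigma>" using listed_along_exists[OF inj] by blast
  then obtain \<theta> where \<sigma>: "distinct \<sigma>" "set \<sigma> = {1..N}"
    and \<theta>: "\<And>i. i < N \<Longrightarrow> x (\<sigma> ! i) = angle (vec (\<theta> i))"
      "\<And>i j. i < N \<Longrightarrow> j < N \<Longrightarrow> i < j \<Longrightarrow> \<theta> i < \<theta> j \<and> \<theta> j < \<theta> i + 2 * pi"
    unfolding listed_along_def by blast
  have len: "length \<sigma> = N" using distinct_card[OF \<sigma>(1)] \<sigma>(2) by simp
  obtain u where u: "control T u" "\<And>k. k \<in> {1..N} \<Longrightarrow> \<exists>\<gamma>. trajectory system_B T u \<gamma> \<and> \<gamma> 0 = x k \<and> \<gamma> T = y k"
    using st unfolding steerable_def by blast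
  have "\<exists>\<psi>. solution system_B T u \<psi> \<and> \<psi> 0 = vec (\<theta> i) \<and> angle (\<psi> T) = y (\<sigma> ! i)" if i: "i < N" for i
  proof -
    have "\<sigma> ! i \<in> {1..N}" using \<sigma>(2) len i nth_mem by metis
    then obtain \<phi> where \<phi>: "solution system_B T u \<phi>" "angle (\<phi> 0) = x (\<sigma> ! i)" "angle (\<phi> T) = y (\<sigma> ! i)"
      using u(2)[of "\<sigma> ! i"] T unfolding trajectory_def by (metis atLeastAtMost_iff less_imp_le order_refl)
    have "angle (vec (\<theta> i)) = angle (vec (\<phi> 0 $ 1) :: real ^ 1)" using \<theta>(1)[OF i] \<phi>(2) by (simp add: vec_nth_1)
    then obtain m where m: "m \<in> \<int>" "\<theta> i = \<phi> 0 $ 1 + 2 * pi * m" unfolding angle_vec_eq_iff by blast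
    let ?\<psi> = "\<lambda>t. \<phi> t + vec (2 * pi * m)"
    have "solution system_B T u ?\<psi>" by (rule solution_B_shift[OF \<phi>(1) m(1)])
    moreover have "?\<psi> 0 = vec (\<theta> i)" unfolding m(2) by (simp add: vec_eq_iff)
    moreover have "angle (?\<psi> T) = y (\<sigma> ! i)"
    proof -
      have "\<exists>m\<in>\<int>. ?\<psi> T $ 1 = \<phi> T $ 1 + 2 * pi * m" using m(1) by (intro bexI[of _ m]) auto
      then have "angle (vec (?\<psi> T $ 1)) = angle (vec (\<phi> T $ 1) :: real ^ 1)" unfolding angle_vec_eq_iff .
      then show ?thesis unfolding vec_nth_1 using \<phi>(3) by simp
    qed
    ultimately show ?thesis by blast
  qed
  then obtain \<psi> where \<psi>: "\<And>i. i < N \<Longrightarrow> solution system_B T u (\<psi> i)" "\<And>i. i < N \<Longrightarrow> \<psi> i 0 = vec (\<theta> i)"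
      "\<And>i. i < N \<Longrightarrow> angle (\<psi> i T) = y (\<sigma> ! i)" by metis
  have ord: "\<psi> i T $ 1 < \<psi> j T $ 1 \<and> \<psi> j T $ 1 < \<psi> i T $ 1 + 2 * pi" if ij: "i < N" "j < N" "i < j" for i j
  proof
    show "\<psi> i T $ 1 < \<psi> j T $ 1"
      by (rule solution_B_order_preserving[OF u(1)]) (use \<psi> \<theta>(2) ij T in auto)
    have "solution system_B T u (\<lambda>t. \<psi> i t + vec (2 * pi * 1))" by (rule solution_B_shift[OF \<psi>(1)[OF ij(1)]]) simp
    then have "\<psi> j T $ 1 < (\<psi> i T + vec (2 * pi * 1)) $ 1"
      by (rule solution_B_order_preserving[OF u(1) \<psi>(1)[OF ij(2)]]) (use \<psi>(2) \<theta>(2) ij T in auto)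
    then show "\<psi> j T $ 1 < \<psi> i T $ 1 + 2 * pi" by simp
  qed
  have "listed_along N y \<sigma>"
    unfolding listed_along_def
  proof (intro conjI \<sigma> exI[of _ "\<lambda>i. \<psi> i T $ 1"] allI impI)
    fix i assume "i < N"
    then show "y (\<sigma> ! i) = angle (vec (\<psi> i T $ 1))" unfolding vec_nth_1 using \<psi>(3) by simp
  qed (use ord in blast)+
  then show ?thesis
    unfolding equally_ordered_def using \<open>listed_along N x \<sigma>\<close> by (intro exI[of _ \<sigma>] exI[of _ 0]) auto
qed

text \<open>After rotation to the same list, initial and final angles satisfy the same strict linear
  inequalities. These define a convex set, so the segment between the lifted configurations consists
  of distinct points, and \<open>same_orbit_segment\<close> applies.\<close>

lemma steerable_if_equally_ordered:
  assumes T: "T > 0" and eq: "equally_ordered N x y"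
  shows "steerable system_B T N x y"
proof -
  obtain \<sigma> \<tau> n where \<sigma>: "listed_along N x \<sigma>" and \<tau>: "listed_along N y \<tau>" and rot: "\<tau> = rotate n \<sigma>"
    using eq unfolding equally_ordered_def by blast
  obtain \<theta> where "distinct \<sigma>" "set \<sigma> = {1..N}"
    and \<theta>: "\<And>i. i < N \<Longrightarrow> x (\<sigma> ! i) = angle (vec (\<theta> i))"
      "\<And>i j. i < N \<Longrightarrow> j < N \<Longrightarrow> i < j \<Longrightarrow> \<theta> i < \<theta> j \<and> \<theta> j < \<theta> i + 2 * pi"
    using \<sigma> unfolding listed_along_def by blast
  then have len: "length \<sigma> = N" using distinct_card[of \<sigma>] by simp
  obtain \<eta> where \<eta>: "\<And>i. i < N \<Longrightarrow> y (\<tau> ! i) = angle (vec (\<eta> i))"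
      "\<And>i j. i < N \<Longrightarrow> j < N \<Longrightarrow> i < j \<Longrightarrow> \<eta> i < \<eta> j \<and> \<eta> j < \<eta> i + 2 * pi"
    using \<tau> unfolding listed_along_def by blast
  define m where "m = n mod N"
  \<comment> \<open>\<open>j p\<close> is the place in \<open>\<tau>\<close> of the entry
    \<open>\<sigma> ! p\<close>. Entries before the cut \<open>m\<close> come last in
    \<open>\<tau>\<close>, so \<open>\<zeta>\<close> lowers their angles by one turn to put them
    first again.\<close>
  define j where "j p = (if m \<le> p then p - m else p + N - m)" for p
  define \<zeta> where "\<zeta> p = \<eta> (j p) - (if m \<le> p then 0 else 2 * pi)" for p
  have j: "j p < N" "\<tau> ! j p = \<sigma> ! p" if p: "p < N" for p
  proof -
    have "m < N" using p by (simp add: m_def)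
    then show jN: "j p < N" using p by (auto simp: j_def)
    have "(n + j p) mod N = (m + j p) mod N" unfolding m_def by (simp add: mod_add_left_eq)
    also have "\<dots> = p" using p \<open>m < N\<close> by (auto simp: j_def)
    finally show "\<tau> ! j p = \<sigma> ! p" unfolding rot using jN len by (simp add: nth_rotate)
  qed
  have \<zeta>: "y (\<sigma> ! p) = angle (vec (\<zeta> p))" if p: "p < N" for p
  proof -
    have "\<exists>m\<in>\<int>. \<zeta> p = \<eta> (j p) + 2 * pi * m"
    proof (cases "m \<le> p")
      case True
      then show ?thesis by (intro bexI[of _ 0]) (auto simp: \<zeta>_def)
    next
      case False
      then show ?thesis by (intro bexI[of _ "- 1"]) (auto simp: \<zeta>_def)
    qed
    then have "angle (vec (\<zeta> p)) = angle (vec (\<eta> (j p)) :: real ^ 1)" unfolding angle_vec_eq_iff .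
    then show ?thesis using \<eta>(1)[OF j(1)[OF p]] j(2)[OF p] by simp
  qed
  have \<zeta>_ord: "\<zeta> p < \<zeta> q \<and> \<zeta> q < \<zeta> p + 2 * pi" if pq: "p < N" "q < N" "p < q" for p q
  proof -
    have "m < N" using pq by (simp add: m_def)
    consider "m \<le> p" | "q < m" | "p < m" "m \<le> q" by linarith
    then show ?thesis
    proof cases
      case 1
      then have "j p < j q" using pq by (auto simp: j_def)
      then show ?thesis using \<eta>(2)[OF j(1)[OF pq(1)] j(1)[OF pq(2)]] 1 pq by (simp add: \<zeta>_def)
    next
      case 2
      then have "j p < j q" using pq \<open>m < N\<close> by (auto simp: j_def)
      then show ?thesis using \<eta>(2)[OF j(1)[OF pq(1)] j(1)[OF pq(2)]] 2 pq by (simp add: \<zeta>_def)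
    next
      case 3
      then have "j q < j p" using pq \<open>m < N\<close> by (auto simp: j_def)
      then show ?thesis using \<eta>(2)[OF j(1)[OF pq(2)] j(1)[OF pq(1)]] 3 pq by (simp add: \<zeta>_def)
    qed
  qed
  have "same_orbit N (\<lambda>i. vec (\<theta> i) :: real ^ 1) (\<lambda>i. vec (\<zeta> i))"
  proof (rule same_orbit_segment)
    fix t :: real assume t: "0 \<le> t" "t \<le> 1"
    define c where "c i = \<theta> i + t * (\<zeta> i - \<theta> i)" for i
    have c: "vec (\<theta> i) + t *\<^sub>R (vec (\<zeta> i) - vec (\<theta> i)) = (vec (c i) :: real ^ 1)" for i
      by (simp add: vec_eq_iff c_def)
    have mix: "0 < a + t * (b - a) \<and> a + t * (b - a) < r" if "0 < a" "a < r" "0 < b" "b < r" for a b r :: real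
    proof -
      have pos: "(1 - t) * p + t * q > 0" if "p > 0" "q > 0" for p q
      proof (cases "t = 0")
        case False
        then show ?thesis using t that by (intro add_nonneg_pos) auto
      qed (use that in simp)
      have "a + t * (b - a) = (1 - t) * a + t * b" "r - (a + t * (b - a)) = (1 - t) * (r - a) + t * (r - b)"
        by (simp_all add: algebra_simps)
      moreover have "(1 - t) * a + t * b > 0" by (rule pos) fact+
      moreover have "(1 - t) * (r - a) + t * (r - b) > 0" by (rule pos) (use that in simp_all)
      ultimately show ?thesis by (metis diff_gt_0_iff_gt)
    qed
    have ord: "0 < c k - c i \<and> c k - c i < 2 * pi" if "i < N" "k < N" "i < k" for i k
    proof -
      have "c k - c i = (\<theta> k - \<theta> i) + t * ((\<zeta> k - \<zeta> i) - (\<theta> k - \<theta> i))" by (simp add: c_def algebra_simps)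
      then show ?thesis using mix[of "\<theta> k - \<theta> i" "2 * pi" "\<zeta> k - \<zeta> i"] \<theta>(2)[OF that] \<zeta>_ord[OF that] by simp
    qed
    have ne: "embed (vec (c i) :: real ^ 1) \<noteq> embed (vec (c k))" if "i < N" "k < N" "i < k" for i k
    proof
      assume "embed (vec (c i) :: real ^ 1) = embed (vec (c k))"
      then obtain m where m: "m \<in> \<int>" "c i = c k + 2 * pi * m" unfolding embed_vec_eq_iff by blast
      have small: "\<bar>2 * pi * m\<bar> < 2 * pi" "2 * pi * m \<noteq> 0" using ord[OF that] m(2) by linarith+
      then have "1 \<le> \<bar>m\<bar>" using m(1) by (intro Ints_nonzero_abs_ge1) auto
      then have "2 * pi * 1 \<le> 2 * pi * \<bar>m\<bar>" by (intro mult_left_mono) auto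
      then show False using small(1) by (simp add: abs_mult)
    qed
    show "distinct_points N (\<lambda>i. vec (\<theta> i) + t *\<^sub>R (vec (\<zeta> i) - vec (\<theta> i)) :: real ^ 1)"
      unfolding distinct_points_def c using ne by (metis linorder_neqE_nat)
  qed
  then obtain G where G: "G \<in> attainable" "\<And>i. i < N \<Longrightarrow> G (vec (\<theta> i)) = (vec (\<zeta> i) :: real ^ 1)" unfolding same_orbit_def by blast
  have "\<exists>i<N. \<sigma> ! i = k" if "k \<in> {1..N}" for k
    using that \<open>set \<sigma> = {1..N}\<close> len by (metis in_set_conv_nth)
  then obtain pos where pos: "\<And>k. k \<in> {1..N} \<Longrightarrow> pos k < N \<and> \<sigma> ! pos k = k" by metis
  show ?thesis
  proof (rule steerable_if_attainable[OF attainable_steers_B T G(1)])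
    fix k assume k: "k \<in> {1..N}"
    show "x k = angle (vec (\<theta> (pos k)))" using \<theta>(1)[of "pos k"] pos[OF k] by simp
    show "y k = angle (G (vec (\<theta> (pos k))))" using \<zeta>[of "pos k"] G(2)[of "pos k"] pos[OF k] by simp
  qed
qed

lemma steerable_A:
  fixes x y :: "nat \<Rightarrow> ('d::finite) torus"
  assumes d: "CARD('d) > 1" and T: "T > 0" and x: "inj_on x {1..N}" and y: "inj_on y {1..N}"
  shows "steerable (system_A :: _ \<Rightarrow> real ^ 'd \<Rightarrow> real ^ 'd) T N x y"
proof -
  obtain lift :: "'d torus \<Rightarrow> real ^ 'd" where lift: "\<And>p. angle (lift p) = p" using obtain_angle by metis
  \<comment> \<open>Shift of the index by one, from ensembles on \<open>{1..N}\<close> to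
    configurations starting at 0.\<close>
  have dist: "distinct_points N (\<lambda>i. lift (z (Suc i)))" if "inj_on z {1..N}" for z
    unfolding distinct_points_def angle_eq_iff[symmetric] lift
  proof (intro allI impI notI)
    fix i j assume "i < N" "j < N" "i \<noteq> j" "z (Suc i) = z (Suc j)"
    then show False using inj_onD[OF that, of "Suc i" "Suc j"] by simp
  qed
  obtain G where G: "G \<in> attainable" "\<And>i. i < N \<Longrightarrow> G (lift (x (Suc i))) = lift (y (Suc i))"
    using same_orbit_all[OF d dist[OF x] dist[OF y]] unfolding same_orbit_def by blast
  show ?thesis
  proof (rule steerable_if_attainable[OF attainable_steers_A T G(1)])
    fix k assume "k \<in> {1..N}"
    then show "x k = angle (lift (x k))" "y k = angle (G (lift (x k)))"
      using G(2)[of "k - 1"] lift by auto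
  qed
qed

theorem theorem6p6:
  shows
    "(CARD('d::finite) > 1 \<longrightarrow>
        (\<forall>N\<ge>1. \<forall>T>0. \<forall>x y :: nat \<Rightarrow> 'd torus.
           inj_on x {1..N} \<and> inj_on y {1..N} \<longrightarrow>
           steerable (system_A :: _ \<Rightarrow> real ^ 'd \<Rightarrow> real ^ 'd) T N x y) \<and>
        (\<forall>T>0. C0_approx_controllable (system_A :: _ \<Rightarrow> real ^ 'd \<Rightarrow> real ^ 'd) T)) \<and>
     (\<forall>T>0. C0_approx_controllable system_B T) \<and>
     (\<forall>N\<ge>1. \<forall>T>0. \<forall>x y :: nat \<Rightarrow> 1 torus.
        inj_on x {1..N} \<and> inj_on y {1..N} \<longrightarrow>
        (steerable system_B T N x y \<longleftrightarrow> equally_ordered N x y))"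
proof (intro conjI impI allI)
  fix T :: real assume "T > 0"
  then show "C0_approx_controllable (system_A :: _ \<Rightarrow> real ^ 'd \<Rightarrow> real ^ 'd) T"
    by (intro C0_approx_controllable_if_steers attainable_steers_A)
next
  fix T :: real assume "T > 0"
  then show "C0_approx_controllable system_B T"
    by (intro C0_approx_controllable_if_steers attainable_steers_B)
qed (auto intro: steerable_A equally_ordered_if_steerable steerable_if_equally_ordered)

end
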